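(* Let $\mathbb{G}$ be a homogeneous Lie group of homogeneous dimension $Q$ and let $|\cdot|$ be an arbitrary homogeneous quasi-norm. Let $1<p\le q<\infty$ and $0<a<Q/p$. Let $0\le b<Q$ and $\frac{a}{Q}=\frac1p-\frac1q+\frac{b}{qQ}$. Assume that $T^{(1)}_a$ is a function on $\mathbb G\setminus\{0\}$ with $|T^{(1)}_{a}(x)|\le C_{2}|x|^{a-Q}$ for some positive $C_{2}=C_{2}(a,Q)$. Then there exists a positive constant $C_{1}=C_{1}(p,q,a,b)$ such that $$\left\|\frac{f\ast T^{(1)}_{a}}{|x|^{b/q}}\right\|_{L^{q}(\mathbb{G})}\le C_{1}\|f\|_{L^{p}(\mathbb{G})}$$ holds for all $f\in L^{p}(\mathbb{G})$.
   Context: A homogeneous group $\mathbb{G}$ is a connected simply connected Lie group whose Lie algebra $\mathfrak g$ is equipped with a family of dilations $D_\lambda=\mathrm{Exp}(A\ln\lambda)$, $\lambda>0$, where $A$ is a diagonalisable linear operator on $\mathfrak g$ with positive eigenvalues and each $D_\lambda$ is a Lie algebra morphism. Through the exponential map, $\mathbb G$ is identified with $\mathbb R^n$ (identity element $0$), the dilations act on $\mathbb G$ (written $x\mapsto\lambda x$), and Lebesgue measure $dx$ is a Haar measure. The homogeneous dimension is $Q=\mathrm{Tr}\,A$. A homogeneous quasi-norm is a continuous function $|\cdot|:\mathbb G\to[0,\infty)$ with $|x^{-1}|=|x|$, $|\lambda x|=\lambda|x|$ for $\lambda>0$, and $|x|=0$ iff $x=0$. Convolution: $(f\ast g)(x)=\int_{\mathbb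 G}f(y)g(y^{-1}x)\,dy$. All functions are measurable. The group, the quasi-norm and $C_2$ are fixed, and the constant $C_1$ is independent of $f$. *)

theory Defs
  imports "HOL-Analysis.Analysis"
begin

section \<open>Lie groups on $\mathbb{R}^n$ in exponential coordinates\<close>

primrec times_differentiable ::
  "nat \<Rightarrow> ('a::euclidean_space \<Rightarrow> 'b::euclidean_space) \<Rightarrow> bool" where
  "times_differentiable 0 f \<longleftrightarrow> continuous_on UNIV f"
| "times_differentiable (Suc k) f \<longleftrightarrow>
     (\<forall>x. f differentiable (at x)) \<and>
     (\<forall>v. times_differentiable k (\<lambda>x. frechet_derivative f (at x) v))"

definition smooth_map :: "('a::euclidean_space \<Rightarrow> 'b::euclidean_space) \<Rightarrow> bool" where
  "smooth_map f \<longleftrightarrow> (\<forall>k. times_differentiable k f)"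

text \<open>
  A Lie group with underlying manifold $\mathbb{R}^n$ (hence connected and simply connected) and
  identity \<open>0\<close>. The Lie algebra is the tangent space at \<open>0\<close>, which is again $\mathbb{R}^n$.
  The last axiom says that \<open>t \<mapsto> t v\<close> is the one-parameter subgroup with velocity \<open>v\<close> at
  \<open>t = 0\<close>, that is, that the exponential map is the identity: the group has been identified with
  its Lie algebra through the exponential map.
\<close>

locale exponential_lie_group = Groups.group gmul 0 ginv
  for gmul :: "real ^ 'n \<Rightarrow> real ^ 'n \<Rightarrow> real ^ 'n" and ginv :: "real ^ 'n \<Rightarrow> real ^ 'n" +
  assumes smooth_mult: "smooth_map (\<lambda>z. gmul (fst z) (snd z))"
    and smooth_inv: "smooth_map ginv"
    and one_parameter_subgroup: "gmul (s *\<^sub>R v) (t *\<^sub>R v) = (s + t) *\<^sub>R v"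

definition left_invariant_field ::
  "(real ^ 'n \<Rightarrow> real ^ 'n \<Rightarrow> real ^ 'n) \<Rightarrow> real ^ 'n \<Rightarrow> real ^ 'n \<Rightarrow> real ^ 'n" where
  "left_invariant_field gmul v x = frechet_derivative (\<lambda>y. gmul x y) (at 0) v"

text \<open>
  The value at the identity of the commutator \<open>[X, Y] = DY(X) - DX(Y)\<close> of the left-invariant vector
  fields \<open>X\<close>, \<open>Y\<close> extending \<open>u\<close>, \<open>v\<close>.
\<close>

definition lie_bracket ::
  "(real ^ 'n \<Rightarrow> real ^ 'n \<Rightarrow> real ^ 'n) \<Rightarrow> real ^ 'n \<Rightarrow> real ^ 'n \<Rightarrow> real ^ 'n" where
  "lie_bracket gmul u v =
     frechet_derivative (left_invariant_field gmul v) (at 0) u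
     - frechet_derivative (left_invariant_field gmul u) (at 0) v"

definition lie_algebra_endomorphism ::
  "(real ^ 'n \<Rightarrow> real ^ 'n \<Rightarrow> real ^ 'n) \<Rightarrow> (real ^ 'n \<Rightarrow> real ^ 'n) \<Rightarrow> bool" where
  "lie_algebra_endomorphism gmul D \<longleftrightarrow>
     linear D \<and> (\<forall>u v. D (lie_bracket gmul u v) = lie_bracket gmul (D u) (D v))"


section \<open>Homogeneous groups\<close>

definition diagonalisable :: "(real ^ 'n \<Rightarrow> real ^ 'n) \<Rightarrow> bool" where
  "diagonalisable A \<longleftrightarrow>
     (\<exists>B. independent B \<and> span B = UNIV \<and> (\<forall>v\<in>B. \<exists>c. A v = c *\<^sub>R v))"

definition is_eigenvalue :: "(real ^ 'n \<Rightarrow> real ^ 'n) \<Rightarrow> real \<Rightarrow> bool" where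
  "is_eigenvalue A c \<longleftrightarrow> (\<exists>v. v \<noteq> 0 \<and> A v = c *\<^sub>R v)"

definition operator_exp :: "(real ^ 'n \<Rightarrow> real ^ 'n) \<Rightarrow> real ^ 'n \<Rightarrow> real ^ 'n" where
  "operator_exp L x = (\<Sum>k. (1 / fact k) *\<^sub>R (L ^^ k) x)"

text \<open>
  In exponential coordinates the dilation of the Lie algebra and the induced dilation
  \<open>x \<mapsto> rx\<close> of the group are the same map. It is only meant for \<open>r > 0\<close>.
\<close>

definition dilation :: "(real ^ 'n \<Rightarrow> real ^ 'n) \<Rightarrow> real \<Rightarrow> real ^ 'n \<Rightarrow> real ^ 'n" where
  "dilation A r = operator_exp (\<lambda>x. ln r *\<^sub>R A x)"

locale homogeneous_group = exponential_lie_group gmul ginv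
  for gmul :: "real ^ 'n \<Rightarrow> real ^ 'n \<Rightarrow> real ^ 'n" and ginv :: "real ^ 'n \<Rightarrow> real ^ 'n" +
  fixes A :: "real ^ 'n \<Rightarrow> real ^ 'n"
  assumes linear_A: "linear A"
    and diagonalisable_A: "diagonalisable A"
    and positive_eigenvalues: "is_eigenvalue A c \<Longrightarrow> c > 0"
    and dilation_endomorphism: "r > 0 \<Longrightarrow> lie_algebra_endomorphism gmul (dilation A r)"

definition homogeneous_dimension :: "(real ^ 'n \<Rightarrow> real ^ 'n) \<Rightarrow> real" where
  "homogeneous_dimension A = trace (matrix A)"

definition homogeneous_quasi_norm ::
  "(real ^ 'n \<Rightarrow> real ^ 'n) \<Rightarrow> (real ^ 'n \<Rightarrow> real ^ 'n) \<Rightarrow> (real ^ 'n \<Rightarrow> real) \<Rightarrow> bool" where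
  "homogeneous_quasi_norm ginv A N \<longleftrightarrow>
     continuous_on UNIV N \<and>
     (\<forall>x. N x \<ge> 0) \<and>
     (\<forall>x. N (ginv x) = N x) \<and>
     (\<forall>r>0. \<forall>x. N (dilation A r x) = r * N x) \<and>
     (\<forall>x. N x = 0 \<longleftrightarrow> x = 0)"


section \<open>Lebesgue spaces and convolution\<close>

text \<open>
  Elements of $L^p$ are functions rather than classes. Lebesgue measure on exponential coordinates
  is a Haar measure of a homogeneous group.
\<close>

definition Lp_space :: "real \<Rightarrow> (real ^ 'n \<Rightarrow> complex) set" where
  "Lp_space p = {f \<in> borel_measurable lebesgue. integrable lebesgue (\<lambda>x. norm (f x) powr p)}"

definition Lp_norm :: "real \<Rightarrow> (real ^ 'n \<Rightarrow> complex) \<Rightarrow> real" where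
  "Lp_norm p f = (LINT x|lebesgue. norm (f x) powr p) powr (1 / p)"

text \<open>
  The Bochner integral is \<open>0\<close> where the integrand is not integrable, so a claim about the
  convolution at \<open>x\<close> is only meaningful together with \<open>convolution_exists_at\<close>.
\<close>

definition convolution_exists_at ::
  "(real ^ 'n \<Rightarrow> real ^ 'n \<Rightarrow> real ^ 'n) \<Rightarrow> (real ^ 'n \<Rightarrow> real ^ 'n) \<Rightarrow>
   (real ^ 'n \<Rightarrow> complex) \<Rightarrow> (real ^ 'n \<Rightarrow> complex) \<Rightarrow> real ^ 'n \<Rightarrow> bool" where
  "convolution_exists_at gmul ginv f g x \<longleftrightarrow>
     integrable lebesgue (\<lambda>y. f y * g (gmul (ginv y) x))"

definition convolution ::
  "(real ^ 'n \<Rightarrow> real ^ 'n \<Rightarrow> real ^ 'n) \<Rightarrow> (real ^ 'n \<Rightarrow> real ^ 'n) \<Rightarrow>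
   (real ^ 'n \<Rightarrow> complex) \<Rightarrow> (real ^ 'n \<Rightarrow> complex) \<Rightarrow> real ^ 'n \<Rightarrow> complex" where
  "convolution gmul ginv f g x = (LINT y|lebesgue. f y * g (gmul (ginv y) x))"

end

theory Submission
  imports Defs
begin

text \<open>
  In exponential coordinates the differential of left translation is determined by the bracket, so a
  Lie algebra endomorphism \<open>D\<close> carries \<open>t \<mapsto> x \<cdot> t y\<close> to an integral curve of the left-invariant
  field of \<open>D y\<close>, and is therefore a group endomorphism. Hence dilations are automorphisms; they
  contract to the identity, which forces left translations to have Jacobian one and gives the
  quasi-triangle inequality. What remains is a weighted estimate for the Riesz potential on a
  quasi-metric measure space whose balls of radius \<open>r\<close> have volume at most a multiple of \<open>r powr Q\<close>. For
  \<open>p < q\<close> it follows by truncating function and kernel at a common scale and integrating over the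
  scale (Marcinkiewicz interpolation); for \<open>p = q\<close>, where \<open>b = a p\<close>, it is Schur's test with a power
  weight.
\<close>

section \<open>Lie algebra endomorphisms as group endomorphisms\<close>

text \<open>The hypothesis on dilations concerns only the Lie algebra. Compatibility with the group
  law is extracted from the axiom that lines through \<open>0\<close> are one-parameter subgroups:
  it turns the differential of left translation into a solution of a linear equation, and uniqueness
  for linear equations is the only ODE theory that enters. The analytic part is governed by one
  exponent, \<kappa> = Q/p - a = (Q - b)/q; the free parameters in the estimates are chosen so that
  terms at distance \<open>r\<close> scale like \<open>r powr (- \<kappa>)\<close>. Interpolation
  needs an exponent \<open>s < p\<close> with \<open>b < a * s\<close>. This is possible exactly
  when \<open>b < a * p\<close>, which follows from \<open>p < q\<close> but fails for
  \<open>p = q\<close>, where \<open>b = a * p\<close>; hence two different arguments. Existence of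
  the convolution is part of the claim, so nothing may presuppose a finite potential. The estimates
  therefore produce an integrable majorant \<Phi>, and its finiteness almost everywhere is what
  yields existence.\<close>

lemma has_vector_derivative_at_iff_tendsto:
  fixes f :: "real \<Rightarrow> 'a::real_normed_vector"
  shows "(f has_vector_derivative d) (at t) \<longleftrightarrow>
    ((\<lambda>h. (1 / h) *\<^sub>R (f (t + h) - f t)) \<longlongrightarrow> d) (at 0)"
proof -
  have *: "norm (f (t + h) - f t - h *\<^sub>R d) / norm h = norm ((1 / h) *\<^sub>R (f (t + h) - f t) - d)"
    if "h \<noteq> 0" for h
  proof -
    have "(1 / h) *\<^sub>R (f (t + h) - f t) - d = (1 / h) *\<^sub>R (f (t + h) - f t - h *\<^sub>R d)"
      using that by (simp add: scaleR_diff_right)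
    then show ?thesis by simp
  qed
  have "(f has_vector_derivative d) (at t) \<longleftrightarrow>
      ((\<lambda>h. norm (f (t + h) - f t - h *\<^sub>R d) / norm h) \<longlongrightarrow> 0) (at 0)"
    by (simp add: has_vector_derivative_def has_derivative_at bounded_linear_scaleR_left)
  also have "\<dots> \<longleftrightarrow> ((\<lambda>h. norm ((1 / h) *\<^sub>R (f (t + h) - f t) - d)) \<longlongrightarrow> 0) (at 0)"
    by (rule filterlim_cong) (auto simp: eventually_at_filter * simp del: real_norm_def)
  also have "\<dots> \<longleftrightarrow> ((\<lambda>h. (1 / h) *\<^sub>R (f (t + h) - f t)) \<longlongrightarrow> d) (at 0)"
    by (simp add: tendsto_norm_zero_iff LIM_zero_iff)
  finally show ?thesis .
qed

text \<open>Gronwall's argument: if \<open>K\<close> bounds the operator, then the squared norm of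
  \<open>E\<close> times \<open>exp (- 2 * K * t)\<close> is nonincreasing, and it starts at
  0.\<close>

lemma linear_ode_unique:
  fixes E :: "real \<Rightarrow> 'a::euclidean_space"
  assumes "linear M"
    and E: "\<And>t. (E has_vector_derivative M (E t)) (at t)"
    and "E 0 = 0" and "0 \<le> t"
  shows "E t = 0"
proof -
  obtain K where K: "\<And>x. norm (M x) \<le> K * norm x"
    using linear_bounded[OF \<open>linear M\<close>] by blast
  define g where "g t = (E t \<bullet> E t) * exp (- 2 * K * t)" for t
  have g': "(g has_real_derivative (2 * (E s \<bullet> M (E s)) - 2 * K * (E s \<bullet> E s)) * exp (- 2 * K * s)) (at s)"
    for s
  proof -
    have "((\<lambda>t. E t \<bullet> E t) has_vector_derivative (E s \<bullet> M (E s) + M (E s) \<bullet> E s)) (at s)"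
      by (rule bounded_bilinear.has_vector_derivative[OF bounded_bilinear_inner E E])
    then have "((\<lambda>t. E t \<bullet> E t) has_real_derivative 2 * (E s \<bullet> M (E s))) (at s)"
      by (simp add: has_real_derivative_iff_has_vector_derivative inner_commute)
    then have "(g has_real_derivative (2 * (E s \<bullet> M (E s))) * exp (- 2 * K * s)
        + (exp (- 2 * K * s) * (- 2 * K)) * (E s \<bullet> E s)) (at s)"
      unfolding g_def by (rule DERIV_mult) (auto intro!: derivative_eq_intros)
    then show ?thesis by (simp add: algebra_simps)
  qed
  have neg: "(2 * (E s \<bullet> M (E s)) - 2 * K * (E s \<bullet> E s)) * exp (- 2 * K * s) \<le> 0" for s
  proof -
    have "E s \<bullet> M (E s) \<le> norm (E s) * norm (M (E s))" by (rule norm_cauchy_schwarz)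
    also have "\<dots> \<le> norm (E s) * (K * norm (E s))" by (rule mult_left_mono[OF K]) simp
    also have "\<dots> = K * (E s \<bullet> E s)" by (simp add: dot_square_norm power2_eq_square)
    finally show ?thesis by (simp add: mult_le_0_iff)
  qed
  have "g t \<le> g 0"
    by (rule DERIV_nonpos_imp_nonincreasing[OF \<open>0 \<le> t\<close>]) (use g' neg in blast)
  then have "(E t \<bullet> E t) * exp (- 2 * K * t) \<le> 0" by (simp add: g_def \<open>E 0 = 0\<close>)
  then have "E t \<bullet> E t \<le> 0" by (simp add: mult_le_0_iff)
  then show ?thesis by (metis inner_eq_zero_iff inner_ge_zero order_antisym)
qed

text \<open>In finite dimension, expanding the vector argument in a basis upgrades continuity for
  each fixed vector to joint continuity. Smoothness of the product supplies only the former for its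
  derivative.\<close>

lemma tendsto_pointwise_continuous_linear:
  fixes F :: "'a::t2_space \<Rightarrow> 'b::euclidean_space \<Rightarrow> 'c::real_normed_vector"
  assumes lin: "\<And>y. linear (F y)"
    and cont: "\<And>w. continuous_on UNIV (\<lambda>y. F y w)"
    and "(g \<longlongrightarrow> y) net" and "(u \<longlongrightarrow> w) net"
  shows "((\<lambda>h. F (g h) (u h)) \<longlongrightarrow> F y w) net"
proof -
  have expand: "F y w = (\<Sum>i\<in>Basis. (w \<bullet> i) *\<^sub>R F y i)" for y w
  proof -
    interpret linear "F y" by (rule lin)
    have "F y (\<Sum>i\<in>Basis. (w \<bullet> i) *\<^sub>R i) = (\<Sum>i\<in>Basis. (w \<bullet> i) *\<^sub>R F y i)"
      by (simp add: sum scale)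
    then show ?thesis by (simp add: euclidean_representation)
  qed
  have "((\<lambda>h. F (g h) i) \<longlongrightarrow> F y i) net" for i
    using continuous_on_tendsto_compose[OF cont \<open>(g \<longlongrightarrow> y) net\<close>] by simp
  then have "((\<lambda>h. \<Sum>i\<in>Basis. (u h \<bullet> i) *\<^sub>R F (g h) i) \<longlongrightarrow> (\<Sum>i\<in>Basis. (w \<bullet> i) *\<^sub>R F y i)) net"
    using \<open>(u \<longlongrightarrow> w) net\<close> by (intro tendsto_intros)
  then show ?thesis by (simp add: expand[symmetric])
qed

section \<open>Differential calculus of the group law in exponential coordinates\<close>

context exponential_lie_group
begin

definition mult_deriv :: "(real ^ 'n) \<times> (real ^ 'n) \<Rightarrow> (real ^ 'n) \<times> (real ^ 'n) \<Rightarrow> real ^ 'n" where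
  "mult_deriv z = frechet_derivative (\<lambda>z. gmul (fst z) (snd z)) (at z)"

lemma mult_times_differentiable: "times_differentiable k (\<lambda>z. gmul (fst z) (snd z))"
  using smooth_mult by (simp add: smooth_map_def)

lemma mult_has_derivative: "((\<lambda>z. gmul (fst z) (snd z)) has_derivative mult_deriv z) (at z)"
  using mult_times_differentiable[of "Suc 0"] unfolding mult_deriv_def
  by (simp only: times_differentiable.simps frechet_derivative_works)

lemma linear_mult_deriv: "linear (mult_deriv z)"
  using mult_has_derivative has_derivative_linear by blast

lemma mult_deriv_add: "mult_deriv z (u + v) = mult_deriv z u + mult_deriv z v"
  by (rule linear_add[OF linear_mult_deriv])

lemma mult_deriv_continuous: "continuous_on UNIV (\<lambda>z. mult_deriv z v)"
  using mult_times_differentiable[of "Suc 0"]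
  by (simp only: times_differentiable.simps mult_deriv_def)

lemma mult_deriv_differentiable: "(\<lambda>z. mult_deriv z v) differentiable at z"
  using mult_times_differentiable[of "Suc (Suc 0)"]
  by (simp only: times_differentiable.simps mult_deriv_def)

lemma mult_continuous: "continuous_on UNIV (\<lambda>z. gmul (fst z) (snd z))"
  using mult_times_differentiable[of 0] by simp

lemma has_vector_derivative_mult:
  assumes "(c has_vector_derivative c') (at t)" and "(e has_vector_derivative e') (at t)"
  shows "((\<lambda>t. gmul (c t) (e t)) has_vector_derivative mult_deriv (c t, e t) (c', e')) (at t)"
proof -
  have "((\<lambda>t. (c t, e t)) has_derivative (\<lambda>h. (h *\<^sub>R c', h *\<^sub>R e'))) (at t)"
    using assms unfolding has_vector_derivative_def by (rule has_derivative_Pair)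
  from has_derivative_compose[OF this mult_has_derivative]
  have "((\<lambda>t. gmul (c t) (e t)) has_derivative (\<lambda>h. mult_deriv (c t, e t) (h *\<^sub>R c', h *\<^sub>R e'))) (at t)"
    by simp
  moreover have "mult_deriv (c t, e t) (h *\<^sub>R c', h *\<^sub>R e') = h *\<^sub>R mult_deriv (c t, e t) (c', e')" for h
    using linear_scale[OF linear_mult_deriv, of "(c t, e t)" h "(c', e')"] by simp
  ultimately show ?thesis by (simp add: has_vector_derivative_def)
qed

lemma has_vector_derivative_mult_right:
  assumes "(e has_vector_derivative e') (at t)"
  shows "((\<lambda>t. gmul x (e t)) has_vector_derivative mult_deriv (x, e t) (0, e')) (at t)"
  by (rule has_vector_derivative_mult[OF has_vector_derivative_const assms])

lemma has_vector_derivative_mult_left: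
  assumes "(c has_vector_derivative c') (at t)"
  shows "((\<lambda>t. gmul (c t) y) has_vector_derivative mult_deriv (c t, y) (c', 0)) (at t)"
  by (rule has_vector_derivative_mult[OF assms has_vector_derivative_const])

lemma has_vector_derivative_line: "((\<lambda>s. x + s *\<^sub>R v) has_vector_derivative v) (at t)"
  "((\<lambda>s. s *\<^sub>R v) has_vector_derivative v) (at t)"
  by (auto intro!: derivative_eq_intros)

lemma mult_zero_right [simp]: "gmul x 0 = x"
  by (metis add_0 left_inverse group_left_neutral local.assoc local.left_cancel)

lemma mult_zero_left [simp]: "gmul 0 x = x"
  by (rule group_left_neutral)

lemma mult_uminus_right [simp]: "gmul x (- x) = 0"
  using one_parameter_subgroup[of 1 x "-1"] by simp

lemma mult_uminus_left [simp]: "gmul (- x) x = 0"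
  using one_parameter_subgroup[of "-1" x 1] by simp

lemma ginv_eq_uminus: "ginv x = - x"
  by (metis left_inverse mult_uminus_left right_inverse local.assoc group_left_neutral mult_zero_right)

lemma mult_uminus_cancel_left [simp]: "gmul x (gmul (- x) y) = y" "gmul (- x) (gmul x y) = y"
  by (simp_all flip: local.assoc)

lemma uminus_mult: "- gmul x y = gmul (- y) (- x)"
proof -
  have "gmul (gmul x y) (gmul (- y) (- x)) = gmul (gmul x y) (- gmul x y)"
    by (simp add: local.assoc)
  then show ?thesis by (metis left_cancel)
qed

text \<open>The value at \<open>x\<close> of the left-invariant field with value \<open>v\<close> at
  the identity.\<close>

abbreviation dleft :: "real ^ 'n \<Rightarrow> real ^ 'n \<Rightarrow> real ^ 'n" where
  "dleft x v \<equiv> mult_deriv (x, 0) (0, v)"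

text \<open>The Maurer-Cartan form: the differential at \<open>x\<close> of left translation by the
  inverse of \<open>x\<close>, bringing tangent vectors back to the identity.\<close>

definition dleft_inv :: "real ^ 'n \<Rightarrow> real ^ 'n \<Rightarrow> real ^ 'n" where
  "dleft_inv x v = mult_deriv (- x, x) (0, v)"

lemma linear_mult_deriv_snd: "linear (\<lambda>v. mult_deriv z (0, v))"
proof -
  have "linear (\<lambda>v::real ^ 'n. (0 :: real ^ 'n, v))" by (rule linearI) auto
  from linear_compose[OF this linear_mult_deriv] show ?thesis by (simp add: o_def)
qed

lemma linear_dleft: "linear (dleft x)"
  by (rule linear_mult_deriv_snd)

lemma linear_dleft_inv: "linear (dleft_inv x)"
  unfolding dleft_inv_def by (rule linear_mult_deriv_snd)

lemma mult_deriv_zero_left: "mult_deriv (0, y) (0, w) = w"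
proof -
  have "((\<lambda>s. y + s *\<^sub>R w) has_vector_derivative mult_deriv (0, y) (0, w)) (at 0)"
    using has_vector_derivative_mult_right[OF has_vector_derivative_line(1), of 0 y w 0] by simp
  then show ?thesis using has_vector_derivative_line(1) vector_derivative_unique_at by blast
qed

text \<open>Negation is the group inverse and reverses products, so near the identity right
  translation by \<open>y\<close> is left translation by \<open>- y\<close> conjugated with
  negation. This trades right differentials for left ones and is the origin of the bracket term in
  the equation for \<open>dleft_inv\<close> along a line.\<close>

lemma mult_deriv_zero_right: "mult_deriv (0, y) (v, 0) = dleft (- y) v"
proof -
  have "((\<lambda>s. gmul (s *\<^sub>R v) y) has_vector_derivative mult_deriv (0, y) (v, 0)) (at 0)"
    using has_vector_derivative_mult_left[OF has_vector_derivative_line(2), of v y 0] by simp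
  moreover have "((\<lambda>s. - gmul (- y) (s *\<^sub>R (- v))) has_vector_derivative - dleft (- y) (- v)) (at 0)"
    using has_vector_derivative_mult_right[OF has_vector_derivative_line(2), of "- y" "- v" 0]
    by (auto intro!: derivative_eq_intros)
  moreover have "gmul (s *\<^sub>R v) y = - gmul (- y) (s *\<^sub>R (- v))" for s
    by (simp add: uminus_mult)
  ultimately have "mult_deriv (0, y) (v, 0) = - dleft (- y) (- v)"
    by (simp add: vector_derivative_unique_at)
  then show ?thesis by (simp add: linear_neg[OF linear_dleft])
qed

lemma dleft_dleft_inv: "dleft x (dleft_inv x w) = w"
proof -
  have "((\<lambda>s. gmul (- x) (x + s *\<^sub>R w)) has_vector_derivative dleft_inv x w) (at 0)"
    using has_vector_derivative_mult_right[OF has_vector_derivative_line(1), of "- x" x w 0]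
    by (simp add: dleft_inv_def)
  from has_vector_derivative_mult_right[OF this, of x]
  have "((\<lambda>s. x + s *\<^sub>R w) has_vector_derivative dleft x (dleft_inv x w)) (at 0)" by simp
  then show ?thesis using has_vector_derivative_line(1) vector_derivative_unique_at by blast
qed

lemma dleft_inv_dleft: "dleft_inv x (dleft x v) = v"
proof -
  have "((\<lambda>s. gmul x (s *\<^sub>R v)) has_vector_derivative dleft x v) (at 0)"
    using has_vector_derivative_mult_right[OF has_vector_derivative_line(2), of x v 0] by simp
  from has_vector_derivative_mult_right[OF this, of "- x"]
  have "((\<lambda>s. s *\<^sub>R v) has_vector_derivative dleft_inv x (dleft x v)) (at 0)"
    by (simp add: dleft_inv_def)
  then show ?thesis using has_vector_derivative_line(2) vector_derivative_unique_at by blast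
qed

text \<open>A curve through \<open>y\<close> is first brought to the identity:
  \<open>x (y + s w)\<close> is \<open>x y\<close> times \<open>(- y) (y + s w)\<close>, where the
  last factor starts at \<open>0\<close>.\<close>

lemma mult_deriv_right: "mult_deriv (x, y) (0, w) = dleft (gmul x y) (dleft_inv y w)"
proof -
  have "((\<lambda>s. gmul (- y) (y + s *\<^sub>R w)) has_vector_derivative dleft_inv y w) (at 0)"
    using has_vector_derivative_mult_right[OF has_vector_derivative_line(1), of "- y" y w 0]
    by (simp add: dleft_inv_def)
  from has_vector_derivative_mult_right[OF this, of "gmul x y"]
  have "((\<lambda>s. gmul x (y + s *\<^sub>R w)) has_vector_derivative dleft (gmul x y) (dleft_inv y w)) (at 0)"
    by (simp add: local.assoc)
  moreover have "((\<lambda>s. gmul x (y + s *\<^sub>R w)) has_vector_derivative mult_deriv (x, y) (0, w)) (at 0)"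
    using has_vector_derivative_mult_right[OF has_vector_derivative_line(1), of x y w 0] by simp
  ultimately show ?thesis using vector_derivative_unique_at by blast
qed

section \<open>The bracket as the first-order part of left-invariant fields\<close>

definition bracket_half :: "real ^ 'n \<Rightarrow> real ^ 'n \<Rightarrow> real ^ 'n" where
  "bracket_half u v = frechet_derivative (\<lambda>x. dleft x v) (at 0) u"

lemma dleft_differentiable: "(\<lambda>x. dleft x v) differentiable at x"
proof -
  have "(\<lambda>z. mult_deriv z (0, v)) differentiable (at ((\<lambda>x. (x, 0)) x))"
    by (rule mult_deriv_differentiable)
  moreover have "(\<lambda>x::real ^ 'n. (x, 0 :: real ^ 'n)) differentiable at x"
    unfolding differentiable_def by (auto intro!: derivative_eq_intros)
  ultimately show ?thesis
    using differentiable_chain_at[of "\<lambda>x. (x, 0)" x "\<lambda>z. mult_deriv z (0, v)"] by (simp add: o_def)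
qed

lemma dleft_has_derivative: "((\<lambda>x. dleft x v) has_derivative (\<lambda>u. bracket_half u v)) (at 0)"
  using dleft_differentiable[of v 0] by (simp add: bracket_half_def frechet_derivative_works)

lemma dleft_line_has_vector_derivative:
  "((\<lambda>s. dleft (s *\<^sub>R u) v) has_vector_derivative bracket_half u v) (at 0)"
proof -
  have "((\<lambda>s::real. s *\<^sub>R u) has_derivative (\<lambda>h. h *\<^sub>R u)) (at 0)"
    by (auto intro!: derivative_eq_intros)
  from has_derivative_compose[OF this, of "\<lambda>x. dleft x v"] dleft_has_derivative[of v]
  have "((\<lambda>s. dleft (s *\<^sub>R u) v) has_derivative (\<lambda>h. bracket_half (h *\<^sub>R u) v)) (at 0)" by simp
  moreover have "bracket_half (h *\<^sub>R u) v = h *\<^sub>R bracket_half u v" for h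
    using linear_scale[OF has_derivative_linear[OF dleft_has_derivative]] .
  ultimately show ?thesis by (simp add: has_vector_derivative_def)
qed

lemma bracket_half_add_left: "bracket_half (u + u') v = bracket_half u v + bracket_half u' v"
  using linear_add[OF has_derivative_linear[OF dleft_has_derivative]] .

lemma linear_bracket_half: "linear (bracket_half u)"
proof (rule linearI)
  fix v w c
  have "((\<lambda>s. dleft (s *\<^sub>R u) (v + w)) has_vector_derivative bracket_half u v + bracket_half u w) (at 0)"
    using has_vector_derivative_add[OF dleft_line_has_vector_derivative dleft_line_has_vector_derivative]
    by (simp add: linear_add[OF linear_dleft])
  then show "bracket_half u (v + w) = bracket_half u v + bracket_half u w"
    using dleft_line_has_vector_derivative vector_derivative_unique_at by blast
  have "((\<lambda>s. dleft (s *\<^sub>R u) (c *\<^sub>R v)) has_vector_derivative c *\<^sub>R bracket_half u v) (at 0)"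
    using bounded_linear.has_vector_derivative[OF bounded_linear_scaleR_right dleft_line_has_vector_derivative]
    by (simp add: linear_scale[OF linear_dleft])
  then show "bracket_half u (c *\<^sub>R v) = c *\<^sub>R bracket_half u v"
    using dleft_line_has_vector_derivative vector_derivative_unique_at by blast
qed

text \<open>On the line through \<open>u\<close> the left-invariant field of \<open>u\<close> is
  constantly \<open>u\<close>, being the velocity of a one-parameter subgroup; its derivative along
  that line therefore vanishes.\<close>

lemma bracket_half_self: "bracket_half u u = 0"
proof -
  have "dleft (s *\<^sub>R u) u = u" for s
  proof -
    have "((\<lambda>t. gmul (s *\<^sub>R u) (t *\<^sub>R u)) has_vector_derivative dleft (s *\<^sub>R u) u) (at 0)"
      using has_vector_derivative_mult_right[OF has_vector_derivative_line(2), of "s *\<^sub>R u" u 0] by simp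
    then have "((\<lambda>t. s *\<^sub>R u + t *\<^sub>R u) has_vector_derivative dleft (s *\<^sub>R u) u) (at 0)"
      by (simp add: one_parameter_subgroup scaleR_add_left)
    then show ?thesis using has_vector_derivative_line(1) vector_derivative_unique_at by blast
  qed
  then have "((\<lambda>s::real. u) has_vector_derivative bracket_half u u) (at 0)"
    using dleft_line_has_vector_derivative[of u u] by simp
  then show ?thesis using has_vector_derivative_const vector_derivative_unique_at by blast
qed

text \<open>Polarising the vanishing on the diagonal gives antisymmetry, so the two terms of the
  commutator are opposite to each other and their difference is twice the first.\<close>

lemma lie_bracket_eq: "lie_bracket gmul u v = 2 *\<^sub>R bracket_half u v"
proof -
  have field: "left_invariant_field gmul v = (\<lambda>x. dleft x v)" for v
  proof
    fix x :: "real ^ 'n"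
    have "((\<lambda>y::real ^ 'n. (x, y)) has_derivative (\<lambda>v. (0, v))) (at 0)"
      by (auto intro!: derivative_eq_intros)
    from has_derivative_compose[OF this, of "\<lambda>z. gmul (fst z) (snd z)", OF mult_has_derivative]
    have "((\<lambda>y. gmul x y) has_derivative (\<lambda>v. dleft x v)) (at 0)" by simp
    then show "left_invariant_field gmul v x = dleft x v"
      unfolding left_invariant_field_def using frechet_derivative_at by metis
  qed
  have "0 = bracket_half (u + v) (u + v)" by (simp add: bracket_half_self)
  also have "\<dots> = bracket_half u v + bracket_half v u"
    unfolding bracket_half_add_left linear_add[OF linear_bracket_half] by (simp add: bracket_half_self)
  finally have "bracket_half v u = - bracket_half u v"
    by (metis neg_eq_iff_add_eq_0)
  then show ?thesis
    unfolding lie_bracket_def field bracket_half_def[symmetric] by (simp add: scaleR_2)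
qed

lemma linear_lie_bracket: "linear (lie_bracket gmul u)"
proof -
  have "lie_bracket gmul u = (\<lambda>v. 2 *\<^sub>R bracket_half u v)" by (simp add: lie_bracket_eq fun_eq_iff)
  then show ?thesis using linear_compose_scale_right[OF linear_bracket_half] by metis
qed

text \<open>
  In exponential coordinates, variations of the one-parameter subgroup \<open>t \<mapsto> t x\<close> satisfy a linear
  equation with coefficients given by the bracket; this is the formula for the differential of the
  exponential map in disguise.
\<close>

lemma dleft_inv_line_has_vector_derivative:
  "((\<lambda>t. dleft_inv (t *\<^sub>R x) (t *\<^sub>R v)) has_vector_derivative
      v - lie_bracket gmul x (dleft_inv (t *\<^sub>R x) (t *\<^sub>R v))) (at t)"
proof -
  define J where "J t = dleft_inv (t *\<^sub>R x) (t *\<^sub>R v)" for t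
  \<comment> \<open>In the notation of exponentials, \<open>J t\<close> is the velocity at
    \<open>s = 0\<close> of \<open>exp (- t x) exp (t (x + s v))\<close>.\<close>
  have curve: "((\<lambda>s. gmul (- (t *\<^sub>R x)) (t *\<^sub>R (x + s *\<^sub>R v))) has_vector_derivative J t) (at 0)" for t
    using has_vector_derivative_mult_right[OF has_vector_derivative_line(1), of "- (t *\<^sub>R x)" "t *\<^sub>R x" "t *\<^sub>R v" 0]
    by (simp add: J_def dleft_inv_def algebra_simps)
  \<comment> \<open>The one-parameter law splits \<open>exp ((t + h) (x + s v))\<close> into its
    factors at times \<open>t\<close> and \<open>h\<close>. Differentiating the resulting identity
    at \<open>s = 0\<close> compares \<open>J (t + h)\<close> with \<open>J t\<close>; moving the
    factor at time \<open>h\<close> to the other side is what produces \<open>- (h x)\<close> on the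
    right.\<close>
  have J_step: "dleft (h *\<^sub>R x) (J (t + h)) = dleft (- (h *\<^sub>R x)) (J t) + h *\<^sub>R v" for h
  proof -
    have "gmul (h *\<^sub>R x) (gmul (- ((t + h) *\<^sub>R x)) ((t + h) *\<^sub>R (x + s *\<^sub>R v)))
        = gmul (gmul (- (t *\<^sub>R x)) (t *\<^sub>R (x + s *\<^sub>R v))) (h *\<^sub>R x + s *\<^sub>R (h *\<^sub>R v))" for s
    proof -
      have "gmul (h *\<^sub>R x) (- ((t + h) *\<^sub>R x)) = - (t *\<^sub>R x)"
        using one_parameter_subgroup[of h x "- (t + h)"] by (simp add: algebra_simps)
      moreover have "gmul (t *\<^sub>R (x + s *\<^sub>R v)) (h *\<^sub>R x + s *\<^sub>R (h *\<^sub>R v)) = (t + h) *\<^sub>R (x + s *\<^sub>R v)"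
        using one_parameter_subgroup[of t "x + s *\<^sub>R v" h] by (simp add: scaleR_add_right mult.commute)
      ultimately show ?thesis by (metis local.assoc)
    qed
    then have "((\<lambda>s. gmul (h *\<^sub>R x) (gmul (- ((t + h) *\<^sub>R x)) ((t + h) *\<^sub>R (x + s *\<^sub>R v))))
        has_vector_derivative mult_deriv (0, h *\<^sub>R x) (J t, h *\<^sub>R v)) (at 0)"
      using has_vector_derivative_mult[OF curve[of t] has_vector_derivative_line(1), of "h *\<^sub>R x" "h *\<^sub>R v"]
      by simp
    moreover have "((\<lambda>s. gmul (h *\<^sub>R x) (gmul (- ((t + h) *\<^sub>R x)) ((t + h) *\<^sub>R (x + s *\<^sub>R v))))
        has_vector_derivative dleft (h *\<^sub>R x) (J (t + h))) (at 0)"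
      using has_vector_derivative_mult_right[OF curve[of "t + h"], of "h *\<^sub>R x"] by simp
    ultimately have "dleft (h *\<^sub>R x) (J (t + h)) = mult_deriv (0, h *\<^sub>R x) (J t, h *\<^sub>R v)"
      using vector_derivative_unique_at by blast
    also have "\<dots> = mult_deriv (0, h *\<^sub>R x) (J t, 0) + mult_deriv (0, h *\<^sub>R x) (0, h *\<^sub>R v)"
      by (simp flip: mult_deriv_add)
    finally show ?thesis by (simp add: mult_deriv_zero_left mult_deriv_zero_right)
  qed
  \<comment> \<open>By the identity just shown, \<open>dleft (h x)\<close> applied to
    \<open>J (t + h) - J t\<close> is \<open>h v\<close> plus \<open>\<psi> h\<close>, so the
    derivative of \<psi> at 0 is the whole bracket term.\<close>
  define \<psi> where "\<psi> h = dleft (h *\<^sub>R (- x)) (J t) - dleft (h *\<^sub>R x) (J t)" for h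
  have "(\<psi> has_vector_derivative bracket_half (- x) (J t) - bracket_half x (J t)) (at 0)"
    unfolding \<psi>_def by (intro has_vector_derivative_diff dleft_line_has_vector_derivative)
  moreover have "bracket_half (- x) (J t) = - bracket_half x (J t)"
    using bracket_half_add_left[of x "- x" "J t"] linear_0[OF has_derivative_linear[OF dleft_has_derivative]]
    by (simp add: eq_neg_iff_add_eq_0 add.commute)
  ultimately have "(\<psi> has_vector_derivative - lie_bracket gmul x (J t)) (at 0)"
    by (simp add: lie_bracket_eq scaleR_2)
  then have "((\<lambda>h. (1 / h) *\<^sub>R \<psi> h) \<longlongrightarrow> - lie_bracket gmul x (J t)) (at 0)"
    unfolding has_vector_derivative_at_iff_tendsto by (simp add: \<psi>_def)
  then have lim: "((\<lambda>h. v + (1 / h) *\<^sub>R \<psi> h) \<longlongrightarrow> v - lie_bracket gmul x (J t)) (at 0)"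
    using tendsto_add[OF tendsto_const[of v]] by fastforce
  \<comment> \<open>Undoing \<open>dleft (h x)\<close> requires a limit in which operator and
    argument move together.\<close>
  have cont: "continuous_on UNIV (\<lambda>y. dleft_inv y w)" for w
    unfolding dleft_inv_def
    by (rule continuous_on_compose2[OF mult_deriv_continuous]) (auto intro!: continuous_intros)
  have "((\<lambda>h::real. h *\<^sub>R x) \<longlongrightarrow> 0) (at 0)" by (auto intro!: tendsto_eq_intros)
  from tendsto_pointwise_continuous_linear[OF linear_dleft_inv cont this lim]
  have "((\<lambda>h. dleft_inv (h *\<^sub>R x) (v + (1 / h) *\<^sub>R \<psi> h)) \<longlongrightarrow> v - lie_bracket gmul x (J t)) (at 0)"
    by (simp add: dleft_inv_def mult_deriv_zero_left)
  moreover have "\<forall>\<^sub>F h in at 0. dleft_inv (h *\<^sub>R x) (v + (1 / h) *\<^sub>R \<psi> h) = (1 / h) *\<^sub>R (J (t + h) - J t)"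
  proof -
    have "dleft_inv (h *\<^sub>R x) (v + (1 / h) *\<^sub>R \<psi> h) = (1 / h) *\<^sub>R (J (t + h) - J t)" if "h \<noteq> 0" for h
    proof -
      have "J (t + h) - J t = dleft_inv (h *\<^sub>R x) (dleft (h *\<^sub>R x) (J (t + h)) - dleft (h *\<^sub>R x) (J t))"
        by (simp add: linear_diff[OF linear_dleft_inv] dleft_inv_dleft)
      also have "\<dots> = dleft_inv (h *\<^sub>R x) (h *\<^sub>R (v + (1 / h) *\<^sub>R \<psi> h))"
        using that by (simp only: J_step) (simp add: \<psi>_def scaleR_add_right algebra_simps)
      also have "\<dots> = h *\<^sub>R dleft_inv (h *\<^sub>R x) (v + (1 / h) *\<^sub>R \<psi> h)"
        by (rule linear_scale[OF linear_dleft_inv])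
      finally show ?thesis using that by simp
    qed
    then show ?thesis by (simp add: eventually_at_filter)
  qed
  ultimately have "((\<lambda>h. (1 / h) *\<^sub>R (J (t + h) - J t)) \<longlongrightarrow> v - lie_bracket gmul x (J t)) (at 0)"
    by (rule Lim_transform_eventually)
  then show ?thesis unfolding has_vector_derivative_at_iff_tendsto J_def .
qed

text \<open>Applying \<open>D\<close> to the solution for \<open>x\<close> and \<open>v\<close>
  yields a solution of the equation for \<open>D x\<close> and \<open>D v\<close>, because
  \<open>D\<close> respects the bracket. Both vanish at time 0, so they agree at time 1, which says
  that \<open>D\<close> intertwines \<open>dleft_inv\<close>; inverting gives the claim.\<close>

lemma dleft_endomorphism:
  assumes D: "lie_algebra_endomorphism gmul D"
  shows "D (dleft x v) = dleft (D x) (D v)"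
proof -
  have lin: "linear D" and br: "\<And>u v. D (lie_bracket gmul u v) = lie_bracket gmul (D u) (D v)"
    using D by (auto simp: lie_algebra_endomorphism_def)
  have inv: "D (dleft_inv x v) = dleft_inv (D x) (D v)" for v
  proof -
    define E where "E t = D (dleft_inv (t *\<^sub>R x) (t *\<^sub>R v)) - dleft_inv (t *\<^sub>R D x) (t *\<^sub>R D v)" for t
    have "(E has_vector_derivative - lie_bracket gmul (D x) (E t)) (at t)" for t
    proof -
      have "(E has_vector_derivative D (v - lie_bracket gmul x (dleft_inv (t *\<^sub>R x) (t *\<^sub>R v)))
          - (D v - lie_bracket gmul (D x) (dleft_inv (t *\<^sub>R D x) (t *\<^sub>R D v)))) (at t)"
        unfolding E_def
        by (intro has_vector_derivative_diff dleft_inv_line_has_vector_derivative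
            bounded_linear.has_vector_derivative[OF linear_conv_bounded_linear[THEN iffD1, OF lin]])
      then show ?thesis
        by (simp add: E_def linear_diff[OF lin] br linear_diff[OF linear_lie_bracket] algebra_simps)
    qed
    moreover have "E 0 = 0"
      by (simp add: E_def linear_0[OF linear_dleft_inv] linear_0[OF lin])
    ultimately have "E 1 = 0"
      using linear_ode_unique[OF linear_compose_neg[OF linear_lie_bracket], of E "D x" 1] by simp
    then show ?thesis by (simp add: E_def)
  qed
  have "dleft (D x) (D v) = dleft (D x) (D (dleft_inv x (dleft x v)))" by (simp add: dleft_inv_dleft)
  then show ?thesis by (simp add: inv dleft_dleft_inv)
qed

lemma lie_algebra_endomorphism_imp_group_endomorphism:
  assumes D: "lie_algebra_endomorphism gmul D"
  shows "D (gmul x y) = gmul (D x) (D y)"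
proof -
  have lin: "linear D" using D by (auto simp: lie_algebra_endomorphism_def)
  define c where "c t = D (gmul x (t *\<^sub>R y))" for t
  define w where "w = D y"
  have c': "(c has_vector_derivative dleft (c t) w) (at t)" for t
  proof -
    have "((\<lambda>s. gmul (gmul x (t *\<^sub>R y)) (s *\<^sub>R y)) has_vector_derivative dleft (gmul x (t *\<^sub>R y)) y) (at 0)"
      using has_vector_derivative_mult_right[OF has_vector_derivative_line(2), of "gmul x (t *\<^sub>R y)" y 0] by simp
    then have "((\<lambda>s. gmul x ((t + s) *\<^sub>R y)) has_vector_derivative dleft (gmul x (t *\<^sub>R y)) y) (at 0)"
      by (simp add: local.assoc one_parameter_subgroup)
    then have "((\<lambda>s. gmul x (s *\<^sub>R y)) has_vector_derivative dleft (gmul x (t *\<^sub>R y)) y) (at t)"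
      unfolding has_vector_derivative_at_iff_tendsto by simp
    from bounded_linear.has_vector_derivative[OF linear_conv_bounded_linear[THEN iffD1, OF lin] this]
    show ?thesis by (simp add: c_def[abs_def] w_def dleft_endomorphism[OF D])
  qed
  \<comment> \<open>Uniqueness of integral curves is obtained by hand: multiplying \<open>c\<close>
    on the right by the one-parameter subgroup of \<open>- w\<close> should undo its motion, so the
    product is shown to have zero derivative.\<close>
  have "((\<lambda>t. gmul (c t) (t *\<^sub>R (- w))) has_vector_derivative 0) (at t)" for t
  proof -
    have "((\<lambda>t. gmul (c t) (t *\<^sub>R (- w))) has_vector_derivative
        mult_deriv (c t, t *\<^sub>R (- w)) (dleft (c t) w, - w)) (at t)"
      by (rule has_vector_derivative_mult[OF c' has_vector_derivative_line(2)])
    moreover have "mult_deriv (c t, t *\<^sub>R (- w)) (dleft (c t) w, - w)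
        = mult_deriv (c t, t *\<^sub>R (- w)) (dleft (c t) w, 0) + mult_deriv (c t, t *\<^sub>R (- w)) (0, - w)"
      by (simp flip: mult_deriv_add)
    \<comment> \<open>The velocity of \<open>c\<close> at \<open>t\<close> is also that of
      \<open>s \<mapsto> c t \<cdot> s w\<close>. Since multiples of \<open>w\<close> multiply by
      adding their coefficients, following it by \<open>- t w\<close> only moves the second factor
      through \<open>- t w\<close> in direction \<open>w\<close>.\<close>
    moreover have "mult_deriv (c t, t *\<^sub>R (- w)) (dleft (c t) w, 0) = mult_deriv (c t, t *\<^sub>R (- w)) (0, w)"
    proof -
      have "((\<lambda>s. gmul (c t) (s *\<^sub>R w)) has_vector_derivative dleft (c t) w) (at 0)"
        using has_vector_derivative_mult_right[OF has_vector_derivative_line(2), of "c t" w 0] by simp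
      from has_vector_derivative_mult_left[OF this, of "t *\<^sub>R (- w)"]
      have "((\<lambda>s. gmul (gmul (c t) (s *\<^sub>R w)) (t *\<^sub>R (- w))) has_vector_derivative
          mult_deriv (c t, t *\<^sub>R (- w)) (dleft (c t) w, 0)) (at 0)" by simp
      moreover have "gmul (gmul (c t) (s *\<^sub>R w)) (t *\<^sub>R (- w)) = gmul (c t) (t *\<^sub>R (- w) + s *\<^sub>R w)" for s
        using one_parameter_subgroup[of s w "- t"] by (simp add: local.assoc scaleR_diff_left)
      moreover have "((\<lambda>s. gmul (c t) (t *\<^sub>R (- w) + s *\<^sub>R w)) has_vector_derivative
          mult_deriv (c t, t *\<^sub>R (- w)) (0, w)) (at 0)"
        using has_vector_derivative_mult_right[OF has_vector_derivative_line(1), of "c t" "t *\<^sub>R (- w)" w 0] by simp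
      ultimately show ?thesis by (simp add: vector_derivative_unique_at)
    qed
    moreover have "mult_deriv (c t, t *\<^sub>R (- w)) (0, w) + mult_deriv (c t, t *\<^sub>R (- w)) (0, - w) = 0"
      using linear_0[OF linear_mult_deriv] by (simp flip: mult_deriv_add zero_prod_def)
    ultimately show ?thesis by simp
  qed
  then obtain k where k: "\<And>t. gmul (c t) (t *\<^sub>R (- w)) = k"
    using has_vector_derivative_zero_constant[of UNIV] by auto
  from k[of 0] have "k = D x" by (simp add: c_def)
  with k[of 1] have "gmul (D (gmul x y)) (- D y) = D x" by (simp add: c_def w_def)
  then have "gmul (gmul (D (gmul x y)) (- D y)) (D y) = gmul (D x) (D y)" by simp
  then show ?thesis by (simp add: local.assoc)
qed

end

section \<open>Maps with constant Jacobian\<close>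

text \<open>
  The change of variables theorem of the library is stated for \<open>real ^ 'n\<close> with a well-ordered
  index type; it is transported to arbitrary finite index types along this copy.
\<close>

typedef 'n ordered_copy = "UNIV :: 'n set" ..

instantiation ordered_copy :: (finite) "{finite, wellorder}"
begin

definition less_eq_ordered_copy :: "'a ordered_copy \<Rightarrow> 'a ordered_copy \<Rightarrow> bool" where
  "x \<le> y \<longleftrightarrow> to_nat (Rep_ordered_copy x) \<le> to_nat (Rep_ordered_copy y)"

definition less_ordered_copy :: "'a ordered_copy \<Rightarrow> 'a ordered_copy \<Rightarrow> bool" where
  "x < y \<longleftrightarrow> to_nat (Rep_ordered_copy x) < to_nat (Rep_ordered_copy y)"

instance
proof
  have "UNIV = range (Abs_ordered_copy :: 'a \<Rightarrow> _)"
    by (metis Rep_ordered_copy_inverse surj_def)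
  then show "finite (UNIV :: 'a ordered_copy set)"
    by (metis finite_code finite_imageI)
next
  fix P :: "'a ordered_copy \<Rightarrow> bool" and x
  assume step: "\<And>x. (\<And>y. y < x \<Longrightarrow> P y) \<Longrightarrow> P x"
  show "P x"
    by (induction x rule: measure_induct_rule[of "\<lambda>x. to_nat (Rep_ordered_copy x)"])
      (auto intro: step simp: less_ordered_copy_def)
qed (auto simp: less_eq_ordered_copy_def less_ordered_copy_def Rep_ordered_copy_inject)

end

definition to_ordered :: "real ^ 'n::finite \<Rightarrow> real ^ 'n ordered_copy" where
  "to_ordered x = (\<chi> j. x $ Rep_ordered_copy j)"

definition of_ordered :: "real ^ 'n::finite ordered_copy \<Rightarrow> real ^ 'n" where
  "of_ordered y = (\<chi> i. y $ Abs_ordered_copy i)"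

lemma of_to_ordered [simp]: "of_ordered (to_ordered x) = x"
  by (simp add: of_ordered_def to_ordered_def vec_eq_iff Abs_ordered_copy_inverse)

lemma to_of_ordered [simp]: "to_ordered (of_ordered y) = y"
  by (simp add: of_ordered_def to_ordered_def vec_eq_iff Rep_ordered_copy_inverse)

lemma linear_to_ordered: "linear to_ordered"
  by (rule linearI) (auto simp: to_ordered_def vec_eq_iff)

lemma linear_of_ordered: "linear of_ordered"
  by (rule linearI) (auto simp: of_ordered_def vec_eq_iff)

lemma continuous_on_to_ordered: "continuous_on S to_ordered"
  by (simp add: linear_to_ordered linear_continuous_on linear_linear)

lemma continuous_on_of_ordered: "continuous_on S of_ordered"
  by (simp add: linear_of_ordered linear_continuous_on linear_linear)

lemma bij_Abs_ordered_copy: "bij Abs_ordered_copy"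
  by (metis Abs_ordered_copy_inverse Rep_ordered_copy_inverse UNIV_I bijI')

lemma distr_of_ordered: "distr lborel borel of_ordered = (lborel :: (real ^ 'n::finite) measure)"
proof (rule lborel_eqI[symmetric])
  have [measurable]: "of_ordered \<in> borel \<rightarrow>\<^sub>M borel"
    by (intro borel_measurable_continuous_onI continuous_on_of_ordered)
  fix l u :: "real ^ 'n"
  assume le: "\<And>b. b \<in> Basis \<Longrightarrow> l \<bullet> b \<le> u \<bullet> b"
  have le': "l $ i \<le> u $ i" for i
    using le[of "axis i 1"] by (simp add: axis_in_Basis_iff inner_axis)
  have "of_ordered -` box l u = box (to_ordered l) (to_ordered u)"
  proof -
    have "(\<forall>i. l $ i < y $ Abs_ordered_copy i \<and> y $ Abs_ordered_copy i < u $ i) \<longleftrightarrow>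
        (\<forall>j. l $ Rep_ordered_copy j < y $ j \<and> y $ j < u $ Rep_ordered_copy j)" for y :: "real ^ 'n ordered_copy"
      by (metis Abs_ordered_copy_inverse Rep_ordered_copy_inverse UNIV_I)
    then show ?thesis
      by (auto simp: mem_box_cart of_ordered_def to_ordered_def vimage_def)
  qed
  then have "emeasure (distr lborel borel of_ordered) (box l u)
      = emeasure lborel (box (to_ordered l) (to_ordered u))"
    by (simp add: emeasure_distr)
  also have "\<dots> = (\<Prod>b\<in>Basis. (to_ordered u - to_ordered l) \<bullet> b)"
    using le' by (intro emeasure_lborel_box) (auto simp: Basis_vec_def inner_axis to_ordered_def)
  also have "(\<Prod>b\<in>Basis. (to_ordered u - to_ordered l) \<bullet> b) = (\<Prod>j\<in>UNIV. (to_ordered u - to_ordered l) $ j)"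
    by (simp add: Basis_vec_def inner_axis prod.UNION_disjoint axis_eq_axis image_UN[symmetric] prod.reindex inj_on_def)
  also have "\<dots> = (\<Prod>i\<in>UNIV. (u - l) $ i)"
    using prod.reindex_bij_betw[OF bij_Abs_ordered_copy, of "\<lambda>j. (to_ordered u - to_ordered l) $ j"]
    by (simp add: to_ordered_def Abs_ordered_copy_inverse)
  also have "\<dots> = (\<Prod>b\<in>Basis. (u - l) \<bullet> b)"
    by (simp add: Basis_vec_def inner_axis prod.UNION_disjoint axis_eq_axis image_UN[symmetric] prod.reindex inj_on_def)
  finally show "emeasure (distr lborel borel of_ordered) (box l u) = (\<Prod>b\<in>Basis. (u - l) \<bullet> b)" .
qed simp

text \<open>The determinant is taken in the ordered coordinates so that it is literally the Jacobian
  in the transported change of variables formula.\<close>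

definition op_det :: "(real ^ 'n \<Rightarrow> real ^ 'n::finite) \<Rightarrow> real" where
  "op_det f = det (matrix (to_ordered \<circ> f \<circ> of_ordered))"

lemma op_det_id: "op_det (\<lambda>x :: real ^ 'n. x) = 1"
proof -
  have "to_ordered \<circ> (\<lambda>x :: real ^ 'n. x) \<circ> of_ordered = id" by (simp add: fun_eq_iff)
  then show ?thesis unfolding op_det_def by (simp only: matrix_id_mat_1 det_I)
qed

lemma op_det_compose:
  assumes "linear f" and "linear g"
  shows "op_det (\<lambda>x. f (g x)) = op_det f * op_det g"
proof -
  have lin: "linear (to_ordered \<circ> h \<circ> of_ordered)" if "linear h" for h :: "real ^ 'a \<Rightarrow> real ^ 'a"
    by (intro linear_compose linear_of_ordered linear_to_ordered that)
  have "to_ordered \<circ> (\<lambda>x. f (g x)) \<circ> of_ordered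
      = (to_ordered \<circ> f \<circ> of_ordered) \<circ> (to_ordered \<circ> g \<circ> of_ordered)"
    by (simp add: fun_eq_iff)
  then show ?thesis
    by (simp add: op_det_def matrix_compose[OF lin[OF assms(2)] lin[OF assms(1)]] det_mul)
qed

lemma op_det_diagonal: "op_det (\<lambda>y. \<chi> i. d i * y $ i) = (\<Prod>i\<in>UNIV. d i)"
proof -
  let ?M = "matrix (to_ordered \<circ> (\<lambda>y. \<chi> i. d i * y $ i) \<circ> of_ordered)"
  have M: "?M $ j $ k = (if j = k then d (Rep_ordered_copy j) else 0)" for j k
    by (auto simp: matrix_def to_ordered_def of_ordered_def axis_def Rep_ordered_copy_inverse)
  have "det ?M = (\<Prod>j\<in>UNIV. d (Rep_ordered_copy j))"
    by (subst det_diagonal) (auto simp: M)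
  also have "\<dots> = (\<Prod>i\<in>UNIV. d i)"
    using prod.reindex_bij_betw[OF bij_Abs_ordered_copy, of "\<lambda>j. d (Rep_ordered_copy j)"]
    by (simp add: Abs_ordered_copy_inverse)
  finally show ?thesis by (simp add: op_det_def)
qed

lemma continuous_on_op_det:
  assumes "\<And>v. continuous_on S (\<lambda>x. F x v)"
  shows "continuous_on S (\<lambda>x. op_det (F x))"
  unfolding op_det_def det_def matrix_def o_def
  by (auto intro!: continuous_intros assms simp: to_ordered_def)

text \<open>The change of variables formula is applied only to boxes. Boxes determine Lebesgue
  measure, so the image measure under \<open>h\<close>, divided by \<open>c\<close>, is Lebesgue
  measure, and this covers all Borel sets, including those of infinite measure.\<close>

lemma emeasure_lborel_constant_jacobian_ordered:
  fixes g :: "real ^ 'm::{finite, wellorder} \<Rightarrow> real ^ 'm::_"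
  assumes "c > 0"
    and der: "\<And>x. (g has_derivative g' x) (at x)"
    and det: "\<And>x. \<bar>det (matrix (g' x))\<bar> = c"
    and inv: "\<And>x. g (h x) = x" "\<And>x. h (g x) = x"
    and cont: "continuous_on UNIV h"
    and S: "S \<in> sets borel"
  shows "emeasure lborel (h -` S) = c * emeasure lborel S"
proof -
  have [measurable]: "h \<in> borel \<rightarrow>\<^sub>M borel"
    by (rule borel_measurable_continuous_onI[OF cont])
  have vimage: "h -` S = g ` S" for S
  proof
    show "h -` S \<subseteq> g ` S" using inv(1) by (metis image_eqI subsetI vimageD)
    show "g ` S \<subseteq> h -` S" using inv(2) by auto
  qed
  have box: "emeasure lborel (h -` box l u) = c * emeasure lborel (box l u)" for l u
  proof -
    have "((\<lambda>x. \<bar>det (matrix (g' x))\<bar>) has_integral (c * measure lborel (box l u))) (box l u)"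
      using has_integral_mult_right[OF has_integral_measure_lborel[of "box l u"], of c]
      by (simp add: det emeasure_lborel_box_eq)
    then have *: "h -` box l u \<in> lmeasurable \<and> measure lebesgue (h -` box l u) = c * measure lborel (box l u)"
      unfolding vimage
      by (subst has_measure_differentiable_image[where f' = g'])
        (simp_all add: has_derivative_at_withinI[OF der] inj_on_inverseI[of _ h, OF inv(2)])
    have sets: "h -` box l u \<in> sets lborel"
      using measurable_sets[of h borel borel "box l u"] by simp
    then have "emeasure lborel (h -` box l u) = emeasure lebesgue (h -` box l u)"
      by simp
    also have "\<dots> = ennreal (c * measure lborel (box l u))"
      using * emeasure_eq_measure2 by metis
    also have "\<dots> = c * emeasure lborel (box l u)"
      using \<open>c > 0\<close> emeasure_eq_ennreal_measure[of lborel "box l u"] emeasure_lborel_box_finite[of l u]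
      by (simp add: ennreal_mult less_top)
    finally show ?thesis .
  qed
  have "lborel = scale_measure (1 / c) (distr lborel borel h)"
  proof (rule lborel_eqI)
    fix l u :: "real ^ 'm::_"
    assume "\<And>b. b \<in> Basis \<Longrightarrow> l \<bullet> b \<le> u \<bullet> b"
    then have "emeasure lborel (box l u) = (\<Prod>b\<in>Basis. (u - l) \<bullet> b)" by (rule emeasure_lborel_box)
    then show "emeasure (scale_measure (ennreal (1 / c)) (distr lborel borel h)) (box l u) = (\<Prod>b\<in>Basis. (u - l) \<bullet> b)"
      using \<open>c > 0\<close> by (simp add: emeasure_distr box ennreal_mult[symmetric] mult.assoc[symmetric])
  qed simp
  from arg_cong[OF this, of "\<lambda>M. emeasure M S"]
  have "emeasure lborel S = ennreal (1 / c) * emeasure lborel (h -` S)"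
    using S by (simp add: emeasure_distr)
  then have "ennreal c * emeasure lborel S = (ennreal c * ennreal (1 / c)) * emeasure lborel (h -` S)"
    by (simp add: mult.assoc)
  then show ?thesis using \<open>c > 0\<close> by (simp flip: ennreal_mult)
qed

lemma emeasure_lborel_constant_jacobian:
  fixes g :: "real ^ 'n::finite \<Rightarrow> real ^ 'n"
  assumes "c > 0"
    and der: "\<And>x. (g has_derivative g' x) (at x)"
    and det: "\<And>x. \<bar>op_det (g' x)\<bar> = c"
    and inv: "\<And>x. g (h x) = x" "\<And>x. h (g x) = x"
    and cont: "continuous_on UNIV h"
    and S: "S \<in> sets borel"
  shows "emeasure lborel (h -` S) = c * emeasure lborel S"
proof -
  have [measurable]: "of_ordered \<in> borel \<rightarrow>\<^sub>M borel" "h \<in> borel \<rightarrow>\<^sub>M borel"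
    by (auto intro!: borel_measurable_continuous_onI continuous_on_of_ordered cont)
  have transport: "emeasure lborel X = emeasure lborel (of_ordered -` X)"
    if "X \<in> sets borel" for X :: "(real ^ 'n) set"
  proof -
    have "emeasure lborel X = emeasure (distr lborel borel of_ordered) X"
      by (simp add: distr_of_ordered)
    then show ?thesis using that by (simp add: emeasure_distr)
  qed
  define h' where "h' = to_ordered \<circ> h \<circ> of_ordered"
  have meas: "h -` S \<in> sets borel" "of_ordered -` S \<in> sets borel"
    using measurable_sets[of h borel borel S] measurable_sets[of of_ordered borel borel S] S by simp_all
  have "emeasure lborel (h -` S) = emeasure lborel (of_ordered -` (h -` S))"
    using meas(1) by (rule transport)
  also have "of_ordered -` (h -` S) = h' -` (of_ordered -` S)" by (auto simp: h'_def)
  also have "emeasure lborel \<dots> = c * emeasure lborel (of_ordered -` S)"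
  proof (rule emeasure_lborel_constant_jacobian_ordered[where g = "to_ordered \<circ> g \<circ> of_ordered"
        and g' = "\<lambda>y. to_ordered \<circ> g' (of_ordered y) \<circ> of_ordered", OF \<open>c > 0\<close>])
    show "(to_ordered \<circ> g \<circ> of_ordered has_derivative to_ordered \<circ> g' (of_ordered y) \<circ> of_ordered) (at y)" for y
      by (rule diff_chain_at[OF linear_imp_has_derivative[OF linear_of_ordered]
            diff_chain_at[OF der linear_imp_has_derivative[OF linear_to_ordered]], unfolded o_assoc])
    show "continuous_on UNIV h'"
      unfolding h'_def o_def
      by (intro continuous_on_compose2[OF continuous_on_to_ordered] continuous_on_compose2[OF cont]
          continuous_on_of_ordered) auto
  qed (use inv det meas in \<open>auto simp: h'_def op_det_def\<close>)
  also have "emeasure lborel (of_ordered -` S) = emeasure lborel S"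
    using S by (rule transport[symmetric])
  finally show ?thesis .
qed

section \<open>Dilations, Haar measure and the quasi-norm\<close>

context homogeneous_group
begin

text \<open>\<open>T\<close> carries the standard basis to a basis of eigenvectors of
  \<open>A\<close>, and \<open>S\<close> is its inverse. Since the trace is invariant under
  conjugation, the exponents add up to the homogeneous dimension, which is what makes it the scaling
  exponent of volume.\<close>

lemma dilation_diagonal_form:
  obtains T S :: "real ^ 'n \<Rightarrow> real ^ 'n" and c :: "'n \<Rightarrow> real"
  where "linear T" and "linear S" and "\<And>x. T (S x) = x" and "\<And>y. S (T y) = y" and "\<And>i. c i > 0"
    and "\<And>r x. r > 0 \<Longrightarrow> dilation A r x = T (\<chi> i. r powr c i * S x $ i)"
    and "(\<Sum>i\<in>UNIV. c i) = homogeneous_dimension A"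
proof -
  obtain B where B: "independent B" "span B = UNIV" "\<And>v. v \<in> B \<Longrightarrow> \<exists>c. A v = c *\<^sub>R v"
    using diagonalisable_A unfolding diagonalisable_def by blast
  have "finite B" using B(1) by (rule finiteI_independent)
  moreover have "card B = CARD('n)"
    using basis_card_eq_dim[of B UNIV] B by simp
  ultimately obtain e where e: "bij_betw e (UNIV :: 'n set) B"
    using finite_same_card_bij[of "UNIV :: 'n set" B] by auto
  then have eB: "e i \<in> B" for i by (auto simp: bij_betw_def)
  then have "\<exists>c. A (e i) = c *\<^sub>R e i" for i using B(3) by blast
  then obtain c where c: "\<And>i. A (e i) = c i *\<^sub>R e i" by metis
  have nz: "e i \<noteq> 0" for i using eB B(1) dependent_zero by metis
  have c_pos: "c i > 0" for i
    by (rule positive_eigenvalues) (use c nz in \<open>auto simp: is_eigenvalue_def\<close>)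
  define T where "T y = (\<Sum>i\<in>UNIV. y $ i *\<^sub>R e i)" for y :: "real ^ 'n"
  have T: "linear T"
    by (rule linearI) (auto simp: T_def sum.distrib scaleR_add_left scaleR_sum_right)
  have T_axis: "T (axis i 1) = e i" for i
    by (simp add: T_def axis_def if_distrib[of "\<lambda>x. x *\<^sub>R _"] cong: if_cong)
  have "surj T"
  proof -
    have "B \<subseteq> range T" using e T_axis by (metis bij_betw_imp_surj_on image_subsetI rangeI)
    then have "span B \<subseteq> span (range T)" by (rule span_mono)
    also have "\<dots> = range T" using linear_subspace_image[OF T subspace_UNIV] by (simp add: span_eq_iff)
    finally show ?thesis using B(2) by auto
  qed
  then have "inj T" using T by (metis linear_surj_imp_inj)
  define S where "S = inv T"
  have S: "linear S" unfolding S_def using T \<open>inj T\<close> by (rule inj_linear_imp_inv_linear)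
  have TS: "T (S x) = x" for x by (simp add: S_def surj_f_inv_f \<open>surj T\<close>)
  have ST: "S (T y) = y" for y by (simp add: S_def \<open>inj T\<close>)
  have diag: "f (T y) = T (\<chi> i. d i * y $ i)" if "linear f" "\<And>i. f (e i) = d i *\<^sub>R e i" for f d y
  proof -
    interpret linear f by fact
    show ?thesis by (simp add: T_def sum scale that(2) mult.commute)
  qed
  have dil: "dilation A r x = T (\<chi> i. r powr c i * S x $ i)" if "r > 0" for r x
  proof -
    have "linear (dilation A r)"
      using dilation_endomorphism[OF that] by (simp add: lie_algebra_endomorphism_def)
    moreover have "dilation A r (e i) = r powr c i *\<^sub>R e i" for i
    proof -
      \<comment> \<open>On an eigenvector every power of the operator is a scalar, so the operator
        series collapses to the scalar exponential series.\<close>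
      have "((\<lambda>x. ln r *\<^sub>R A x) ^^ k) (e i) = (ln r * c i) ^ k *\<^sub>R e i" for k
        by (induction k) (auto simp: linear_scale[OF linear_A] c mult_ac)
      then have "dilation A r (e i) = (\<Sum>k. ((ln r * c i) ^ k /\<^sub>R fact k) *\<^sub>R e i)"
        by (simp add: dilation_def operator_exp_def divide_inverse)
      also have "\<dots> = (\<Sum>k. (ln r * c i) ^ k /\<^sub>R fact k) *\<^sub>R e i"
        by (rule suminf_scaleR_left[symmetric]) (rule summable_exp_generic)
      also have "\<dots> = r powr c i *\<^sub>R e i"
        using that by (simp add: powr_def mult.commute[of "c i"]) (simp add: exp_def)
      finally show ?thesis .
    qed
    ultimately have "dilation A r (T (S x)) = T (\<chi> i. r powr c i * S x $ i)" by (rule diag)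
    then show ?thesis by (simp add: TS)
  qed
  define Dg where "Dg = (\<lambda>y :: real ^ 'n. \<chi> i. c i * y $ i)"
  have Dg: "linear Dg" by (rule linearI) (auto simp: Dg_def vec_eq_iff algebra_simps)
  have "homogeneous_dimension A = trace (matrix (T \<circ> (Dg \<circ> S)))"
  proof -
    have "A = T \<circ> (Dg \<circ> S)"
      using diag[OF linear_A c, of "S _"] by (simp add: fun_eq_iff TS Dg_def)
    then show ?thesis by (simp add: homogeneous_dimension_def)
  qed
  also have "\<dots> = trace (matrix T ** (matrix Dg ** matrix S))"
    by (simp only: matrix_compose[OF linear_compose[OF S Dg] T] matrix_compose[OF S Dg])
  also have "\<dots> = trace (matrix Dg ** (matrix S ** matrix T))"
    by (metis trace_mul_sym matrix_mul_assoc)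
  also have "matrix S ** matrix T = mat 1"
  proof -
    have "S \<circ> T = id" by (simp add: fun_eq_iff ST)
    then show ?thesis by (simp only: matrix_compose[OF T S, symmetric] matrix_id_mat_1)
  qed
  also have "trace (matrix Dg ** mat 1) = (\<Sum>i\<in>UNIV. c i)"
    by (simp add: trace_def matrix_def Dg_def axis_def)
  finally show thesis using that[OF T S TS ST c_pos dil] by simp
qed

lemma linear_dilation: "r > 0 \<Longrightarrow> linear (dilation A r)"
  using dilation_endomorphism by (simp add: lie_algebra_endomorphism_def)

lemma dilation_one [simp]: "dilation A 1 x = x"
  by (rule dilation_diagonal_form) simp

lemma dilation_dilation: "r > 0 \<Longrightarrow> s > 0 \<Longrightarrow> dilation A r (dilation A s x) = dilation A (r * s) x"
  by (rule dilation_diagonal_form) (simp add: powr_mult mult.assoc)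

lemma dilation_inverse [simp]:
  assumes "r > 0"
  shows "dilation A r (dilation A (1 / r) x) = x" "dilation A (1 / r) (dilation A r x) = x"
  using assms by (simp_all add: dilation_dilation)

lemma dilation_mult: "r > 0 \<Longrightarrow> dilation A r (gmul x y) = gmul (dilation A r x) (dilation A r y)"
  by (rule lie_algebra_endomorphism_imp_group_endomorphism[OF dilation_endomorphism])

lemma dilation_tendsto_zero: "((\<lambda>r. dilation A r x) \<longlongrightarrow> 0) (at_right 0)"
proof (rule dilation_diagonal_form)
  fix T S :: "real ^ 'n \<Rightarrow> real ^ 'n" and c :: "'n \<Rightarrow> real"
  assume T: "linear T" and c: "\<And>i. c i > 0"
    and dil: "\<And>r x. r > 0 \<Longrightarrow> dilation A r x = T (\<chi> i. r powr c i * S x $ i)"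
  have "((\<lambda>r. r powr c i) \<longlongrightarrow> 0 powr c i) (at_right 0)" for i
    by (rule tendsto_powr'[OF _ tendsto_const]) (use c[of i] in \<open>auto simp: eventually_at_right_less intro: eventually_at_rightI[of 0 1]\<close>)
  then have "((\<lambda>r. \<chi> i. r powr c i * S x $ i) \<longlongrightarrow> (\<chi> i. 0)) (at_right 0)"
    by (intro tendsto_vec_lambda tendsto_mult_left_zero) simp
  then have "((\<lambda>r. T (\<chi> i. r powr c i * S x $ i)) \<longlongrightarrow> T (\<chi> i. 0)) (at_right 0)"
    by (rule bounded_linear.tendsto[OF linear_conv_bounded_linear[THEN iffD1, OF T]])
  then have "((\<lambda>r. T (\<chi> i. r powr c i * S x $ i)) \<longlongrightarrow> 0) (at_right 0)"
    using linear_0[OF T] by (simp add: zero_vec_def)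
  moreover have "\<forall>\<^sub>F r in at_right 0. T (\<chi> i. r powr c i * S x $ i) = dilation A r x"
    by (rule eventually_at_rightI[of 0 1]) (auto simp: dil)
  ultimately show ?thesis by (rule Lim_transform_eventually)
qed

lemma continuous_on_dilation_scale: "continuous_on {0<..} (\<lambda>r. dilation A r x)"
proof (rule dilation_diagonal_form)
  fix T S :: "real ^ 'n \<Rightarrow> real ^ 'n" and c :: "'n \<Rightarrow> real"
  assume T: "linear T"
    and dil: "\<And>r x. r > 0 \<Longrightarrow> dilation A r x = T (\<chi> i. r powr c i * S x $ i)"
  have "continuous_on {0<..} (\<lambda>r. T (\<chi> i. r powr c i * S x $ i))"
    by (intro linear_continuous_on_compose[OF _ T] continuous_intros) auto
  then show ?thesis by (rule continuous_on_cong[THEN iffD1, rotated -1]) (auto simp: dil)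
qed

lemma continuous_on_dilation: "r > 0 \<Longrightarrow> continuous_on X (dilation A r)"
  by (simp add: linear_dilation linear_continuous_on linear_linear)

lemma op_det_dilation:
  assumes "r > 0"
  shows "op_det (dilation A r) = r powr homogeneous_dimension A"
proof (rule dilation_diagonal_form)
  fix T S :: "real ^ 'n \<Rightarrow> real ^ 'n" and c :: "'n \<Rightarrow> real"
  assume T: "linear T" and S: "linear S" and TS: "\<And>x. T (S x) = x"
    and dil: "\<And>r x. r > 0 \<Longrightarrow> dilation A r x = T (\<chi> i. r powr c i * S x $ i)"
    and c: "(\<Sum>i\<in>UNIV. c i) = homogeneous_dimension A"
  define Dg where "Dg = (\<lambda>y :: real ^ 'n. \<chi> i. r powr c i * y $ i)"
  have Dg: "linear Dg" by (rule linearI) (auto simp: Dg_def vec_eq_iff algebra_simps)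
  have DgS: "linear (\<lambda>x. Dg (S x))" using linear_compose[OF S Dg] by (simp add: o_def)
  have "dilation A r = (\<lambda>x. T (Dg (S x)))" using dil[OF assms] by (simp add: fun_eq_iff Dg_def)
  then have "op_det (dilation A r) = (op_det T * op_det S) * op_det Dg"
    by (simp add: op_det_compose[OF T DgS] op_det_compose[OF Dg S])
  also have "op_det T * op_det S = 1"
    using op_det_compose[OF T S] by (simp add: TS op_det_id)
  also have "op_det Dg = r powr homogeneous_dimension A"
    using assms by (simp add: Dg_def op_det_diagonal powr_sum[symmetric] c)
  finally show ?thesis by simp
qed

text \<open>
  \<open>dleft\<close> is conjugation-equivariant under dilations, so its determinant is constant along dilation
  orbits, which tend to the identity.
\<close>

lemma op_det_dleft: "op_det (dleft x) = 1"
proof -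
  have scale: "op_det (dleft (dilation A r x)) = op_det (dleft x)" if r: "r > 0" for r
  proof -
    have "dleft (dilation A r x) = (\<lambda>v. dilation A r (dleft x (dilation A (1 / r) v)))"
      using r by (simp add: fun_eq_iff dleft_endomorphism[OF dilation_endomorphism])
    moreover have "linear (\<lambda>v. dleft x (dilation A (1 / r) v))"
      using linear_compose[OF linear_dilation linear_dleft, of "1 / r" x] r by (simp add: o_def)
    ultimately have "op_det (dleft (dilation A r x))
        = op_det (dilation A r) * op_det (dleft x) * op_det (dilation A (1 / r))"
      using r op_det_compose[OF linear_dilation[OF r], of "\<lambda>v. dleft x (dilation A (1 / r) v)"]
        op_det_compose[OF linear_dleft linear_dilation, of "1 / r" x] by simp
    also have "\<dots> = (op_det (dilation A r) * op_det (dilation A (1 / r))) * op_det (dleft x)"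
      by simp
    also have "op_det (dilation A r) * op_det (dilation A (1 / r)) = 1"
      using op_det_compose[OF linear_dilation linear_dilation, of r "1 / r"] r by (simp add: op_det_id)
    finally show ?thesis by simp
  qed
  have "continuous_on UNIV (\<lambda>x. dleft x v)" for v
    by (rule continuous_on_compose2[OF mult_deriv_continuous]) (auto intro!: continuous_intros)
  then have "continuous_on UNIV (\<lambda>x. op_det (dleft x))" by (rule continuous_on_op_det)
  from continuous_on_tendsto_compose[OF this dilation_tendsto_zero[of x]]
  have "((\<lambda>r. op_det (dleft (dilation A r x))) \<longlongrightarrow> op_det (dleft 0)) (at_right 0)" by simp
  moreover have "\<forall>\<^sub>F r in at_right 0. op_det (dleft (dilation A r x)) = op_det (dleft x)"
    by (rule eventually_at_rightI[of 0 1]) (auto simp: scale)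
  ultimately have "((\<lambda>r::real. op_det (dleft x)) \<longlongrightarrow> op_det (dleft 0)) (at_right 0)"
    by (rule Lim_transform_eventually)
  then have "op_det (dleft x) = op_det (dleft 0)"
    by (simp add: tendsto_const_iff)
  then show ?thesis by (simp add: mult_deriv_zero_left op_det_id)
qed

lemma continuous_on_mult_left: "continuous_on UNIV (gmul x)"
  using continuous_on_compose2[OF mult_continuous, of UNIV "\<lambda>y. (x, y)"]
  by (simp add: continuous_on_Pair)

text \<open>The preimage is the image under left translation by \<open>- x\<close>. Its differential
  at \<open>y\<close> factors through the tangent space at the identity as
  \<open>dleft_inv y\<close> followed by \<open>dleft (gmul (- x) y)\<close>, and both have
  determinant one.\<close>

lemma emeasure_lborel_left_translation:
  assumes "S \<in> sets borel"
  shows "emeasure lborel (gmul x -` S) = emeasure lborel S"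
proof -
  have "emeasure lborel (gmul x -` S) = ennreal 1 * emeasure lborel S"
  proof (rule emeasure_lborel_constant_jacobian[where g = "gmul (- x)" and g' = "\<lambda>y v. mult_deriv (- x, y) (0, v)"])
    show "(gmul (- x) has_derivative (\<lambda>v. mult_deriv (- x, y) (0, v))) (at y)" for y
    proof -
      have "((\<lambda>y. (- x, y)) has_derivative (\<lambda>v. (0, v))) (at y)"
        by (auto intro!: derivative_eq_intros)
      from has_derivative_compose[OF this, of "\<lambda>z. gmul (fst z) (snd z)", OF mult_has_derivative]
      show ?thesis by simp
    qed
    show "\<bar>op_det (\<lambda>v. mult_deriv (- x, y) (0, v))\<bar> = 1" for y
    proof -
      have "op_det (dleft y) * op_det (dleft_inv y) = 1"
        using op_det_compose[OF linear_dleft linear_dleft_inv, of y y] by (simp add: dleft_dleft_inv op_det_id)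
      then show ?thesis
        unfolding mult_deriv_right[of "- x" y] op_det_compose[OF linear_dleft linear_dleft_inv]
        by (simp add: op_det_dleft)
    qed
    show "gmul (- x) (gmul x y) = y" "gmul x (gmul (- x) y) = y" for y by simp_all
  qed (use assms continuous_on_mult_left in auto)
  then show ?thesis by simp
qed

lemma emeasure_lborel_dilation:
  assumes "r > 0" and "S \<in> sets borel"
  shows "emeasure lborel (dilation A (1 / r) -` S) = r powr homogeneous_dimension A * emeasure lborel S"
  by (rule emeasure_lborel_constant_jacobian[where g = "dilation A r" and g' = "\<lambda>x. dilation A r"])
    (use assms in \<open>auto simp: op_det_dilation linear_imp_has_derivative linear_dilation continuous_on_dilation\<close>)

lemma distr_lborel_left_translation: "distr lborel borel (gmul x) = lborel"
proof (rule measure_eqI)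
  have [measurable]: "gmul x \<in> borel \<rightarrow>\<^sub>M borel"
    by (rule borel_measurable_continuous_onI[OF continuous_on_mult_left])
  show "emeasure (distr lborel borel (gmul x)) S = emeasure lborel S"
    if "S \<in> sets (distr lborel borel (gmul x))" for S
    using that by (simp add: emeasure_distr emeasure_lborel_left_translation)
qed simp

end

section \<open>The quasi-norm: compact balls, quasi-triangle inequality, volume growth\<close>

locale quasi_normed_homogeneous_group = homogeneous_group gmul ginv A
  for gmul :: "real ^ 'n \<Rightarrow> real ^ 'n \<Rightarrow> real ^ 'n" and ginv A +
  fixes N :: "real ^ 'n \<Rightarrow> real"
  assumes quasi_norm: "homogeneous_quasi_norm ginv A N"
begin

lemma continuous_on_quasi_norm: "continuous_on S N"
  using quasi_norm continuous_on_subset unfolding homogeneous_quasi_norm_def by blast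

lemma quasi_norm_nonneg: "0 \<le> N x"
  and quasi_norm_uminus: "N (- x) = N x"
  and quasi_norm_dilation: "r > 0 \<Longrightarrow> N (dilation A r x) = r * N x"
  and quasi_norm_eq_0_iff: "N x = 0 \<longleftrightarrow> x = 0"
  using quasi_norm ginv_eq_uminus by (auto simp: homogeneous_quasi_norm_def)

text \<open>A point outside the Euclidean unit ball is moved onto the unit sphere by some dilation
  with factor \<open>r \<le> 1\<close>, by the intermediate value theorem along its orbit. There
  \<open>N\<close> is at least its positive minimum, while homogeneity gives at most
  \<open>r\<close>; so \<open>1 / r\<close> is bounded and the point lies in a compact image of an
  interval times the sphere.\<close>

lemma bounded_quasi_norm_ball: "bounded {x. N x \<le> 1}"
proof -
  have "compact (sphere 0 1 :: (real ^ 'n) set)" by (rule compact_sphere)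
  moreover have "sphere 0 1 \<noteq> ({} :: (real ^ 'n) set)" by simp
  ultimately obtain u where u: "u \<in> sphere 0 1" "\<And>x. x \<in> sphere 0 1 \<Longrightarrow> N u \<le> N x"
    using continuous_attains_inf[OF _ _ continuous_on_quasi_norm] by metis
  have "u \<noteq> 0" using u(1) by auto
  then have m: "N u > 0" using quasi_norm_nonneg[of u] quasi_norm_eq_0_iff[of u] by linarith
  have cont: "continuous_on ({1 .. 1 / N u} \<times> sphere 0 1) (\<lambda>z. dilation A (fst z) (snd z))"
  proof (rule dilation_diagonal_form)
    fix T S :: "real ^ 'n \<Rightarrow> real ^ 'n" and c :: "'n \<Rightarrow> real"
    assume T: "linear T" and S: "linear S"
      and dil: "\<And>r x. r > 0 \<Longrightarrow> dilation A r x = T (\<chi> i. r powr c i * S x $ i)"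
    have "continuous_on ({1 .. 1 / N u} \<times> sphere 0 1) (\<lambda>z. T (\<chi> i. fst z powr c i * S (snd z) $ i))"
      by (intro linear_continuous_on_compose[OF _ T] linear_continuous_on_compose[OF _ S] continuous_intros) auto
    then show ?thesis by (rule continuous_on_cong[THEN iffD1, rotated -1]) (auto simp: dil)
  qed
  have "{x. N x \<le> 1} \<subseteq> cball 0 1 \<union> (\<lambda>z. dilation A (fst z) (snd z)) ` ({1 .. 1 / N u} \<times> sphere 0 1)"
  proof
    fix x assume "x \<in> {x. N x \<le> 1}"
    then have x: "N x \<le> 1" by simp
    show "x \<in> cball 0 1 \<union> (\<lambda>z. dilation A (fst z) (snd z)) ` ({1 .. 1 / N u} \<times> sphere 0 1)"
    proof (cases "norm x \<le> 1")
      case False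
      have "((\<lambda>r. norm (dilation A r x)) \<longlongrightarrow> 0) (at_right 0)"
        using dilation_tendsto_zero[of x] tendsto_norm_zero by blast
      then have "\<forall>\<^sub>F r in at_right 0. norm (dilation A r x) < 1"
        by (rule order_tendstoD) simp
      moreover have "\<forall>\<^sub>F r::real in at_right 0. 0 < r \<and> r < 1"
        by (rule eventually_at_rightI[of 0 1]) auto
      ultimately have "\<forall>\<^sub>F r in at_right 0. norm (dilation A r x) < 1 \<and> 0 < r \<and> r < 1"
        by (rule eventually_conj)
      then obtain s where s: "norm (dilation A s x) < 1" "0 < s" "s < 1"
        using eventually_happens trivial_limit_at_right_real by fastforce
      have "\<exists>r\<ge>s. r \<le> 1 \<and> norm (dilation A r x) = 1"
      proof (rule IVT')
        show "continuous_on {s..1} (\<lambda>r. norm (dilation A r x))"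
          by (intro continuous_on_norm continuous_on_subset[OF continuous_on_dilation_scale]) (use s in auto)
      qed (use s False in auto)
      then obtain r where r: "s \<le> r" "r \<le> 1" "norm (dilation A r x) = 1" by blast
      then have "r > 0" using s by simp
      have "N u \<le> N (dilation A r x)" using u r by simp
      also have "\<dots> \<le> r" using x \<open>r > 0\<close> by (simp add: quasi_norm_dilation)
      finally have "1 / r \<le> 1 / N u" using m \<open>r > 0\<close> by (simp add: frac_le)
      then have "(1 / r, dilation A r x) \<in> {1 .. 1 / N u} \<times> sphere 0 1" using r \<open>r > 0\<close> by simp
      moreover have "x = dilation A (fst (1 / r, dilation A r x)) (snd (1 / r, dilation A r x))"
        using \<open>r > 0\<close> by simp
      ultimately show ?thesis by (metis (no_types, lifting) UnI2 image_eqI)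
    qed auto
  qed
  moreover have "compact (cball 0 1 \<union> (\<lambda>z. dilation A (fst z) (snd z)) ` ({1 .. 1 / N u} \<times> sphere 0 1))"
    by (intro compact_Un compact_cball compact_continuous_image[OF cont] compact_Times compact_sphere) simp
  ultimately show ?thesis using bounded_subset compact_imp_bounded by blast
qed

text \<open>Dilations are automorphisms and scale both sides by the same factor, so it is enough to
  bound \<open>N (gmul x y)\<close> on the compact set where
  \<open>N x + N y \<le> 1\<close>.\<close>

lemma quasi_triangle: "\<exists>K>0. \<forall>x y. N (gmul x y) \<le> K * (N x + N y)"
proof -
  define S where "S = {z :: (real ^ 'n) \<times> (real ^ 'n). N (fst z) + N (snd z) \<le> 1}"
  have cN: "continuous_on UNIV (\<lambda>z. N (f z))" if "continuous_on UNIV f" for f :: "(real ^ 'n) \<times> (real ^ 'n) \<Rightarrow> real ^ 'n"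
    by (rule continuous_on_compose2[OF continuous_on_quasi_norm that]) auto
  have "closed S"
    unfolding S_def by (intro closed_Collect_le continuous_intros cN)
  moreover have "S \<subseteq> {x. N x \<le> 1} \<times> {x. N x \<le> 1}"
    using quasi_norm_nonneg by (auto simp: S_def) (smt (verit))+
  then have "bounded S"
    using bounded_subset bounded_Times[OF bounded_quasi_norm_ball bounded_quasi_norm_ball] by blast
  ultimately have "compact S" by (simp add: compact_eq_bounded_closed)
  moreover have "continuous_on S (\<lambda>z. N (gmul (fst z) (snd z)))"
    using continuous_on_subset[OF cN[OF mult_continuous]] by blast
  ultimately have "bounded ((\<lambda>z. N (gmul (fst z) (snd z))) ` S)"
    using compact_continuous_image compact_imp_bounded by blast
  then obtain K where K: "K > 0" "\<And>z. z \<in> S \<Longrightarrow> \<bar>N (gmul (fst z) (snd z))\<bar> \<le> K"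
    unfolding bounded_pos by auto
  have "N (gmul x y) \<le> K * (N x + N y)" for x y
  proof (cases "N x + N y = 0")
    case True
    then have "N x = 0" "N y = 0" using quasi_norm_nonneg[of x] quasi_norm_nonneg[of y] by linarith+
    then have "x = 0" "y = 0" by (simp_all add: quasi_norm_eq_0_iff)
    moreover have "N 0 = 0" by (simp add: quasi_norm_eq_0_iff)
    ultimately show ?thesis by simp
  next
    case False
    define r where "r = 1 / (N x + N y)"
    have "N x + N y > 0" using False quasi_norm_nonneg[of x] quasi_norm_nonneg[of y] by linarith
    then have r: "r > 0" by (simp add: r_def)
    have "r * N (gmul x y) = N (gmul (dilation A r x) (dilation A r y))"
      using r by (simp add: dilation_mult[symmetric] quasi_norm_dilation)
    also have "\<dots> \<le> K"
    proof -
      have "(dilation A r x, dilation A r y) \<in> S"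
        using r False by (simp add: S_def quasi_norm_dilation r_def field_simps)
      from K(2)[OF this] show ?thesis by simp
    qed
    finally show ?thesis using \<open>N x + N y > 0\<close> by (simp add: r_def field_simps)
  qed
  with K(1) show ?thesis by blast
qed

lemma emeasure_quasi_norm_ball:
  "\<exists>V\<ge>0. \<forall>r>0. emeasure lborel {x. N x < r} = ennreal (V * r powr homogeneous_dimension A)"
proof -
  have sets: "{x. N x < r} \<in> sets borel" for r
    by (intro borel_open open_Collect_less continuous_on_quasi_norm continuous_on_const)
  have "bounded {x. N x < 1}"
    by (rule bounded_subset[OF bounded_quasi_norm_ball]) auto
  then have "emeasure lborel {x. N x < 1} < \<infinity>" by (rule emeasure_bounded_finite)
  then obtain V where V: "V \<ge> 0" "emeasure lborel {x. N x < 1} = ennreal V"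
    by (metis ennreal_cases infinity_ennreal_def less_irrefl)
  have "emeasure lborel {x. N x < r} = ennreal (V * r powr homogeneous_dimension A)" if "r > 0" for r
  proof -
    have "{x. N x < r} = dilation A (1 / r) -` {x. N x < 1}"
      using that by (simp add: quasi_norm_dilation vimage_def)
    then show ?thesis
      using emeasure_lborel_dilation[OF that sets[of 1]] V
      by (simp add: ennreal_mult[symmetric] mult.commute)
  qed
  with V(1) show ?thesis by blast
qed

end

section \<open>Riesz potentials on quasi-metric measure spaces\<close>

lemma nn_integral_powr_0_to:
  fixes e c :: real
  assumes "e > 0" and "c \<ge> 0"
  shows "(\<integral>\<^sup>+t. ennreal (t powr (e - 1)) * indicator {0..c} t \<partial>lborel) = ennreal (c powr e / e)"
  using nn_integral_has_integral_lebesgue'[OF _ has_integral_powr_from_0[of "e - 1" c]] assms by simp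

lemma nn_integral_powr_to_inf:
  fixes e c :: real
  assumes "e > 0" and "c > 0"
  shows "(\<integral>\<^sup>+t. ennreal (t powr (- e - 1)) * indicator {c..} t \<partial>lborel) = ennreal (c powr (- e) / e)"
  using nn_integral_has_integral_lebesgue'[OF _ has_integral_powr_to_inf[of "- e - 1" c]] assms by simp

text \<open>The free scale \<open>l\<close> allows the two terms to be balanced, so this takes the
  place of Hoelder's inequality below while leaving a sum whose terms can be estimated separately.
  The factors \<open>1 / s\<close> and its conjugate are at most 1 and are dropped.\<close>

lemma Young_powr:
  fixes u v s l :: real
  assumes "u \<ge> 0" and "v \<ge> 0" and "s > 1" and "l > 0"
  shows "u * v \<le> l powr s * u powr s + l powr (- (s / (s - 1))) * v powr (s / (s - 1))"
proof -
  define s' where "s' = s / (s - 1)"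
  have s': "s' > 1" "1 / s + 1 / s' = 1" using \<open>s > 1\<close> by (auto simp: s'_def field_simps)
  have "u * v = (l * u) * (v / l)" using \<open>l > 0\<close> by simp
  also have "\<dots> \<le> (l * u) powr s / s + (v / l) powr s' / s'"
    using assms s' by (intro Youngs_inequality) auto
  also have "\<dots> \<le> (l * u) powr s + (v / l) powr s'"
  proof -
    have "x / k \<le> x" if "x \<ge> 0" "k > 1" for x k :: real
      using that by (simp add: pos_divide_le_eq mult_le_cancel_left1)
    then show ?thesis using \<open>s > 1\<close> s' by (intro add_mono) auto
  qed
  also have "\<dots> = l powr s * u powr s + l powr (- s') * v powr s'"
    using assms by (simp add: powr_mult powr_divide powr_minus_divide)
  finally show ?thesis by (simp add: s'_def)
qed

section \<open>Integrals of powers of a quasi-metric\<close>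

locale quasi_metric_measure =
  fixes M :: "'a measure" and d :: "'a \<Rightarrow> 'a \<Rightarrow> real" and z0 :: 'a and Q V K :: real
  assumes sigma_finite: "sigma_finite_measure M"
    and space_M: "space M = UNIV"
    and measurable_d: "(\<lambda>z. d (fst z) (snd z)) \<in> borel_measurable (M \<Otimes>\<^sub>M M)"
    and d_nonneg: "0 \<le> d x y"
    and d_sym: "d x y = d y x"
    and d_triangle: "d x z \<le> K * (d x y + d y z)"
    and K_pos: "K > 0" and V_nonneg: "V \<ge> 0" and Q_pos: "Q > 0"
    and ball_volume: "r > 0 \<Longrightarrow> emeasure M {y. d x y < r} \<le> ennreal (V * r powr Q)"
begin

abbreviation radius :: "'a \<Rightarrow> real" where
  "radius \<equiv> d z0"

lemma pair_M_lborel: "pair_sigma_finite M (lborel :: real measure)"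
  by (intro pair_sigma_finite.intro sigma_finite sigma_finite_lborel)

lemma pair_M_M: "pair_sigma_finite M M"
  by (intro pair_sigma_finite.intro sigma_finite)

lemma measurable_d_compose [measurable (raw)]:
  assumes "f \<in> L \<rightarrow>\<^sub>M M" and "g \<in> L \<rightarrow>\<^sub>M M"
  shows "(\<lambda>z. d (f z) (g z)) \<in> borel_measurable L"
  using measurable_compose[OF measurable_Pair[OF assms] measurable_d] by simp

lemma measurable_const_M [measurable (raw)]: "(\<lambda>z. x) \<in> L \<rightarrow>\<^sub>M M"
  by (simp add: space_M)

lemma sets_Collect_M: "Measurable.pred M P \<Longrightarrow> {y. P y} \<in> sets M"
  by (simp add: pred_def space_M)

lemma sets_ball [measurable]: "{y. d x y < r} \<in> sets M"
  by (rule sets_Collect_M) measurable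

lemma d_le_triangle: "d x z \<le> 2 * K * max (d x y) (d y z)"
proof -
  have "d x z \<le> K * (d x y + d y z)" by (rule d_triangle)
  also have "\<dots> \<le> K * (2 * max (d x y) (d y z))"
    using K_pos by (intro mult_left_mono) auto
  finally show ?thesis by (simp add: mult_ac)
qed

lemma AE_d_pos: "AE y in M. d x y > 0"
proof -
  have "emeasure M {y. d x y = 0} \<le> ennreal e" if "e > 0" for e
  proof -
    \<comment> \<open>Solves \<open>(V + 1) * r powr Q = e\<close>; the added 1 keeps the divisor
      positive.\<close>
    define r where "r = (e / (V + 1)) powr (1 / Q)"
    have r: "r > 0" using V_nonneg that by (auto simp: r_def)
    have "emeasure M {y. d x y = 0} \<le> emeasure M {y. d x y < r}"
      using r by (intro emeasure_mono sets_ball) auto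
    also have "\<dots> \<le> ennreal (V * r powr Q)" by (rule ball_volume[OF r])
    also have "V * r powr Q \<le> e"
      using V_nonneg Q_pos that by (simp add: r_def powr_powr field_simps)
    finally show ?thesis by (simp add: ennreal_leI)
  qed
  then have "emeasure M {y. d x y = 0} = 0"
    by (metis ennreal_le_epsilon add_0 le_zero_eq)
  then have "AE y in M. \<not> d x y = 0"
    by (intro AE_I[where N = "{y. d x y = 0}"] sets_Collect_M) (auto, measurable)
  then show ?thesis using d_nonneg by (auto simp: less_le elim: eventually_mono)
qed

text \<open>Layer cake: \<open>u powr (- s)\<close> is the integral of
  \<open>s * t powr (- s - 1)\<close> over \<open>t \<ge> u\<close>. After Fubini only volumes of
  balls remain, so the constant is uniform in the centre.\<close>

lemma nn_integral_ball_powr: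
  assumes "0 < s" and "s < Q"
  shows "\<exists>C\<ge>0. \<forall>x. \<forall>r>0. (\<integral>\<^sup>+y. ennreal (d x y powr (- s)) * indicator {y. d x y < r} y \<partial>M)
    \<le> ennreal (C * r powr (Q - s))"
proof (intro exI conjI allI impI)
  define C where "C = s * V * (2 powr Q / (Q - s) + 1 / s)"
  show "C \<ge> 0" using assms V_nonneg by (simp add: C_def)
  fix x and r :: real assume r: "r > 0"
  have "(\<integral>\<^sup>+y. ennreal (d x y powr (- s)) * indicator {y. d x y < r} y \<partial>M)
    \<le> (\<integral>\<^sup>+y. (\<integral>\<^sup>+t. ennreal (s * t powr (- s - 1)) * indicator {t. 0 < t \<and> d x y \<le> t \<and> d x y < r} t \<partial>lborel) \<partial>M)"
  proof (intro nn_integral_mono)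
    fix y
    show "ennreal (d x y powr (- s)) * indicator {y. d x y < r} y
      \<le> (\<integral>\<^sup>+t. ennreal (s * t powr (- s - 1)) * indicator {t. 0 < t \<and> d x y \<le> t \<and> d x y < r} t \<partial>lborel)"
    proof (cases "0 < d x y \<and> d x y < r")
      case True
      have "ennreal (d x y powr (- s)) = ennreal s * ennreal (d x y powr (- s) / s)"
        using assms by (simp add: ennreal_mult[symmetric])
      also have "\<dots> = ennreal s * (\<integral>\<^sup>+t. ennreal (t powr (- s - 1)) * indicator {d x y..} t \<partial>lborel)"
        using True assms by (simp add: nn_integral_powr_to_inf)
      also have "\<dots> = (\<integral>\<^sup>+t. ennreal (s * t powr (- s - 1)) * indicator {d x y..} t \<partial>lborel)"
        using assms by (simp add: nn_integral_cmult[symmetric] ennreal_mult mult.assoc)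
      also have "\<dots> = (\<integral>\<^sup>+t. ennreal (s * t powr (- s - 1)) * indicator {t. 0 < t \<and> d x y \<le> t \<and> d x y < r} t \<partial>lborel)"
        using True by (intro nn_integral_cong) (auto simp: indicator_def)
      finally show ?thesis using True by simp
    next
      case False
      \<comment> \<open>At distance 0 the integrand is 0, by the convention for
        \<open>0 powr\<close>.\<close>
      then have "ennreal (d x y powr (- s)) * indicator {y. d x y < r} y = 0"
        using d_nonneg[of x y] by (auto simp: indicator_def)
      then show ?thesis by (simp only: zero_le)
    qed
  qed
  also have "\<dots> = (\<integral>\<^sup>+t. (\<integral>\<^sup>+y. ennreal (s * t powr (- s - 1)) * indicator {t. 0 < t \<and> d x y \<le> t \<and> d x y < r} t \<partial>M) \<partial>lborel)"
    by (rule pair_sigma_finite.Fubini'[OF pair_M_lborel, symmetric]) measurable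
  \<comment> \<open>Up to level \<open>r\<close> the ball of radius \<open>2 * t\<close> gives
    \<open>t powr (Q - s - 1)\<close>, integrable at 0 because \<open>s < Q\<close>; beyond
    \<open>r\<close> the volume no longer grows. Doubling the radius turns the condition
    \<open>d x y \<le> t\<close> into membership in an open ball.\<close>
  also have "\<dots> \<le> (\<integral>\<^sup>+t. ennreal (s * V) * (ennreal (2 powr Q) * (ennreal (t powr ((Q - s) - 1)) * indicator {0..r} t)
      + ennreal (r powr Q) * (ennreal (t powr (- s - 1)) * indicator {r..} t)) \<partial>lborel)"
  proof (intro nn_integral_mono)
    fix t :: real
    have "(\<integral>\<^sup>+y. ennreal (s * t powr (- s - 1)) * indicator {t. 0 < t \<and> d x y \<le> t \<and> d x y < r} t \<partial>M)
      \<le> (\<integral>\<^sup>+y. ennreal (s * t powr (- s - 1)) * indicator {0<..} t * indicator {y. d x y < min (2 * t) r} y \<partial>M)"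
      by (intro nn_integral_mono) (auto simp: indicator_def)
    also have "\<dots> = ennreal (s * t powr (- s - 1)) * indicator {0<..} t * emeasure M {y. d x y < min (2 * t) r}"
      by (rule nn_integral_cmult_indicator) (rule sets_ball)
    also have "\<dots> \<le> ennreal (s * t powr (- s - 1)) * indicator {0<..} t * ennreal (V * (min (2 * t) r) powr Q)"
    proof (cases "t > 0")
      case True
      then show ?thesis using r by (intro mult_left_mono ball_volume) auto
    qed simp
    also have "\<dots> \<le> ennreal (s * V) * (ennreal (2 powr Q) * (ennreal (t powr ((Q - s) - 1)) * indicator {0..r} t)
      + ennreal (r powr Q) * (ennreal (t powr (- s - 1)) * indicator {r..} t))"
    proof (cases "t > 0")
      case t: True
      have "s * t powr (- s - 1) * (V * (min (2 * t) r) powr Q)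
         \<le> s * V * (2 powr Q * (t powr ((Q - s) - 1) * indicator {0..r} t) + r powr Q * (t powr (- s - 1) * indicator {r..} t))"
      proof (cases "t \<le> r")
        case True
        have "(min (2 * t) r) powr Q \<le> (2 * t) powr Q" using t r Q_pos by (intro powr_mono2) auto
        also have "\<dots> = 2 powr Q * t powr Q" using t by (simp add: powr_mult)
        finally have "t powr (- s - 1) * (min (2 * t) r) powr Q \<le> t powr (- s - 1) * (2 powr Q * t powr Q)"
          by (intro mult_left_mono) auto
        also have "\<dots> = 2 powr Q * t powr ((Q - s) - 1)"
          using t by (simp add: mult.left_commute powr_add[symmetric]) (simp add: algebra_simps)
        finally have *: "t powr (- s - 1) * (min (2 * t) r) powr Q \<le> 2 powr Q * t powr ((Q - s) - 1) + r powr Q * (t powr (- s - 1) * indicator {r..} t)"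
          by (smt (verit) indicator_pos_le mult_nonneg_nonneg powr_ge_zero)
        have "s * V * (t powr (- s - 1) * (min (2 * t) r) powr Q) \<le> s * V * (2 powr Q * t powr ((Q - s) - 1) + r powr Q * (t powr (- s - 1) * indicator {r..} t))"
          by (intro mult_left_mono *) (use assms V_nonneg in auto)
        then show ?thesis using t True by (simp add: mult_ac)
      next
        case False
        have "(min (2 * t) r) powr Q = r powr Q" using False t by (simp add: min_def)
        then show ?thesis using False by (simp add: mult_ac)
      qed
      then have "ennreal (s * t powr (- s - 1) * (V * (min (2 * t) r) powr Q))
         \<le> ennreal (s * V * (2 powr Q * (t powr ((Q - s) - 1) * indicator {0..r} t) + r powr Q * (t powr (- s - 1) * indicator {r..} t)))"
        by (rule ennreal_leI)
      then show ?thesis using t assms V_nonneg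
        by (simp add: ennreal_mult ennreal_plus ennreal_indicator)
    qed simp
    finally show "(\<integral>\<^sup>+y. ennreal (s * t powr (- s - 1)) * indicator {t. 0 < t \<and> d x y \<le> t \<and> d x y < r} t \<partial>M)
      \<le> ennreal (s * V) * (ennreal (2 powr Q) * (ennreal (t powr ((Q - s) - 1)) * indicator {0..r} t)
      + ennreal (r powr Q) * (ennreal (t powr (- s - 1)) * indicator {r..} t))" .
  qed
  also have "\<dots> = ennreal (s * V) * (ennreal (2 powr Q) * ennreal (r powr (Q - s) / (Q - s))
      + ennreal (r powr Q) * ennreal (r powr (- s) / s))"
    using assms r by (simp add: nn_integral_cmult nn_integral_add nn_integral_powr_0_to nn_integral_powr_to_inf
        del: ennreal_mult'' )
  also have "\<dots> = ennreal (s * V * (2 powr Q * (r powr (Q - s) / (Q - s)) + r powr Q * (r powr (- s) / s)))"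
    using assms V_nonneg by (simp add: ennreal_mult[symmetric] ennreal_plus[symmetric] del: ennreal_plus)
  also have "s * V * (2 powr Q * (r powr (Q - s) / (Q - s)) + r powr Q * (r powr (- s) / s))
    = s * V * (2 powr Q / (Q - s) + 1 / s) * r powr (Q - s)"
  proof -
    have "r powr Q * (r powr (- s) / s) = r powr (Q - s) / s" by (simp add: powr_add[symmetric])
    note * = this
    show ?thesis by (simp only: *) (simp add: algebra_simps)
  qed
  finally show "(\<integral>\<^sup>+y. ennreal (d x y powr (- s)) * indicator {y. d x y < r} y \<partial>M)
    \<le> ennreal (C * r powr (Q - s))" by (simp add: C_def)
qed

text \<open>The same layer cake: a level below \<open>r\<close> meets no point at distance at least
  \<open>r\<close>, and on the remaining levels \<open>t powr (Q - s - 1)\<close> is integrable at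
  infinity because \<open>Q < s\<close>.\<close>

lemma nn_integral_tail_powr:
  assumes "Q < s"
  shows "\<exists>C\<ge>0. \<forall>x. \<forall>r>0. (\<integral>\<^sup>+y. ennreal (d x y powr (- s)) * indicator {y. r \<le> d x y} y \<partial>M)
    \<le> ennreal (C * r powr (Q - s))"
proof (intro exI conjI allI impI)
  have s: "s > 0" using Q_pos assms by simp
  define C where "C = s * V * 2 powr Q / (s - Q)"
  show "C \<ge> 0" using s assms V_nonneg by (simp add: C_def)
  fix x and r :: real assume r: "r > 0"
  have "(\<integral>\<^sup>+y. ennreal (d x y powr (- s)) * indicator {y. r \<le> d x y} y \<partial>M)
    \<le> (\<integral>\<^sup>+y. (\<integral>\<^sup>+t. ennreal (s * t powr (- s - 1)) * indicator {t. r \<le> d x y \<and> d x y \<le> t} t \<partial>lborel) \<partial>M)"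
  proof (intro nn_integral_mono)
    fix y
    show "ennreal (d x y powr (- s)) * indicator {y. r \<le> d x y} y
      \<le> (\<integral>\<^sup>+t. ennreal (s * t powr (- s - 1)) * indicator {t. r \<le> d x y \<and> d x y \<le> t} t \<partial>lborel)"
    proof (cases "r \<le> d x y")
      case True
      then have "0 < d x y" using r by simp
      have "ennreal (d x y powr (- s)) = ennreal s * ennreal (d x y powr (- s) / s)"
        using s by (simp add: ennreal_mult[symmetric])
      also have "\<dots> = ennreal s * (\<integral>\<^sup>+t. ennreal (t powr (- s - 1)) * indicator {d x y..} t \<partial>lborel)"
        using \<open>0 < d x y\<close> s by (simp add: nn_integral_powr_to_inf)
      also have "\<dots> = (\<integral>\<^sup>+t. ennreal (s * t powr (- s - 1)) * indicator {d x y..} t \<partial>lborel)"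
        using s by (simp add: nn_integral_cmult[symmetric] ennreal_mult mult.assoc)
      also have "\<dots> = (\<integral>\<^sup>+t. ennreal (s * t powr (- s - 1)) * indicator {t. r \<le> d x y \<and> d x y \<le> t} t \<partial>lborel)"
        using True by (intro nn_integral_cong) (auto simp: indicator_def)
      finally show ?thesis using True by simp
    qed simp
  qed
  also have "\<dots> = (\<integral>\<^sup>+t. (\<integral>\<^sup>+y. ennreal (s * t powr (- s - 1)) * indicator {t. r \<le> d x y \<and> d x y \<le> t} t \<partial>M) \<partial>lborel)"
    by (rule pair_sigma_finite.Fubini'[OF pair_M_lborel, symmetric]) measurable
  also have "\<dots> \<le> (\<integral>\<^sup>+t. ennreal (s * V * 2 powr Q) * (ennreal (t powr (- (s - Q) - 1)) * indicator {r..} t) \<partial>lborel)"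
  proof (intro nn_integral_mono)
    fix t :: real
    show "(\<integral>\<^sup>+y. ennreal (s * t powr (- s - 1)) * indicator {t. r \<le> d x y \<and> d x y \<le> t} t \<partial>M)
      \<le> ennreal (s * V * 2 powr Q) * (ennreal (t powr (- (s - Q) - 1)) * indicator {r..} t)"
    proof (cases "r \<le> t")
      case True
      then have t: "t > 0" using r by simp
      have "(\<integral>\<^sup>+y. ennreal (s * t powr (- s - 1)) * indicator {t. r \<le> d x y \<and> d x y \<le> t} t \<partial>M)
        \<le> (\<integral>\<^sup>+y. ennreal (s * t powr (- s - 1)) * indicator {y. d x y < 2 * t} y \<partial>M)"
        using t by (intro nn_integral_mono) (auto simp: indicator_def)
      also have "\<dots> = ennreal (s * t powr (- s - 1)) * emeasure M {y. d x y < 2 * t}"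
        by (rule nn_integral_cmult_indicator) (rule sets_ball)
      also have "\<dots> \<le> ennreal (s * t powr (- s - 1)) * ennreal (V * (2 * t) powr Q)"
        using t by (intro mult_left_mono ball_volume) auto
      also have "\<dots> = ennreal (s * V * 2 powr Q * (t powr (- s - 1) * t powr Q))"
        using t s V_nonneg by (simp add: ennreal_mult[symmetric] powr_mult mult_ac)
      also have "t powr (- s - 1) * t powr Q = t powr (- (s - Q) - 1)"
        using t by (simp add: powr_add[symmetric] algebra_simps)
      finally show ?thesis using True s V_nonneg by (simp add: ennreal_mult)
    next
      case False
      then have "indicator {t. r \<le> d x y \<and> d x y \<le> t} t = (0 :: ennreal)" for y
        by (auto simp: indicator_def)
      then show ?thesis by simp
    qed
  qed
  also have "\<dots> = ennreal (s * V * 2 powr Q) * ennreal (r powr (- (s - Q)) / (s - Q))"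
    using nn_integral_powr_to_inf[of "s - Q" r] assms r by (simp add: nn_integral_cmult)
  also have "\<dots> = ennreal (C * r powr (Q - s))"
    using assms s V_nonneg by (simp add: ennreal_mult[symmetric] C_def)
  finally show "(\<integral>\<^sup>+y. ennreal (d x y powr (- s)) * indicator {y. r \<le> d x y} y \<partial>M)
    \<le> ennreal (C * r powr (Q - s))" .
qed

text \<open>The product of the two negative powers is at most the power with exponent
  \<open>- (\<alpha> + b)\<close> of the smaller distance. If that is \<open>radius x\<close>, then
  \<open>x\<close> also lies in the \<open>r\<close>-ball around the base point, so two integrals
  with a single pole suffice, wherever \<open>y\<close> is.\<close>

lemma nn_integral_ball_two_weights:
  assumes "0 < \<alpha>" and "0 \<le> b" and "\<alpha> + b < Q"
  shows "\<exists>C\<ge>0. \<forall>y. \<forall>r>0.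
    (\<integral>\<^sup>+x. ennreal (d x y powr (- \<alpha>) * radius x powr (- b)) * indicator {x. d x y < r} x \<partial>M)
    \<le> ennreal (C * r powr (Q - \<alpha> - b))"
proof -
  obtain C where C: "C \<ge> 0" "\<And>x r. r > 0 \<Longrightarrow>
    (\<integral>\<^sup>+y. ennreal (d x y powr (- (\<alpha> + b))) * indicator {y. d x y < r} y \<partial>M) \<le> ennreal (C * r powr (Q - (\<alpha> + b)))"
    using nn_integral_ball_powr[of "\<alpha> + b"] assms by auto
  have "(\<integral>\<^sup>+x. ennreal (d x y powr (- \<alpha>) * radius x powr (- b)) * indicator {x. d x y < r} x \<partial>M)
    \<le> ennreal (2 * C * r powr (Q - \<alpha> - b))" if r: "r > 0" for y r
  proof -
    have "(\<integral>\<^sup>+x. ennreal (d x y powr (- \<alpha>) * radius x powr (- b)) * indicator {x. d x y < r} x \<partial>M)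
      \<le> (\<integral>\<^sup>+x. ennreal (d y x powr (- (\<alpha> + b))) * indicator {x. d y x < r} x
          + ennreal (radius x powr (- (\<alpha> + b))) * indicator {x. radius x < r} x \<partial>M)"
    proof (intro nn_integral_mono)
      fix x
      define u where "u = d y x"
      define v where "v = radius x"
      have u: "u \<ge> 0" "v \<ge> 0" by (auto simp: u_def v_def d_nonneg)
      have "u powr (- \<alpha>) * v powr (- b) \<le> u powr (- (\<alpha> + b))" if "u \<le> v" "0 < u"
      proof -
        have "u powr (- \<alpha>) * v powr (- b) \<le> u powr (- \<alpha>) * u powr (- b)"
          using that assms by (intro mult_left_mono powr_mono2') auto
        then show ?thesis using that by (simp add: powr_add[symmetric])
      qed
      moreover have "u powr (- \<alpha>) * v powr (- b) \<le> v powr (- (\<alpha> + b))" if "v < u" "0 < v"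
      proof -
        have "u powr (- \<alpha>) * v powr (- b) \<le> v powr (- \<alpha>) * v powr (- b)"
          using that assms by (intro mult_right_mono powr_mono2') auto
        then show ?thesis using that by (simp add: powr_add[symmetric])
      qed
      moreover have "u powr (- \<alpha>) * v powr (- b) = 0" if "u = 0 \<or> v = 0" using that by auto
      ultimately have "u powr (- \<alpha>) * v powr (- b) * indicator {..<r} u
        \<le> u powr (- (\<alpha> + b)) * indicator {..<r} u + v powr (- (\<alpha> + b)) * indicator {..<r} v"
        using u by (cases "u \<le> v"; cases "u = 0 \<or> v = 0") (auto simp: indicator_def add_increasing add_increasing2)
      from ennreal_leI[OF this]
      have "ennreal (u powr (- \<alpha>) * v powr (- b)) * indicator {..<r} u
        \<le> ennreal (u powr (- (\<alpha> + b))) * indicator {..<r} u + ennreal (v powr (- (\<alpha> + b))) * indicator {..<r} v"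
        by (simp add: ennreal_mult ennreal_indicator)
      then show "ennreal (d x y powr (- \<alpha>) * radius x powr (- b)) * indicator {x. d x y < r} x
        \<le> ennreal (d y x powr (- (\<alpha> + b))) * indicator {x. d y x < r} x
          + ennreal (radius x powr (- (\<alpha> + b))) * indicator {x. radius x < r} x"
        by (simp add: u_def v_def indicator_def d_sym[of x y])
    qed
    also have "\<dots> \<le> ennreal (C * r powr (Q - (\<alpha> + b))) + ennreal (C * r powr (Q - (\<alpha> + b)))"
      by (subst nn_integral_add) (auto intro!: add_mono C(2) r simp del: minus_add_distrib)
    also have "\<dots> = ennreal (2 * C * r powr (Q - \<alpha> - b))"
      using C(1) by (simp add: ennreal_plus[symmetric] diff_diff_eq del: ennreal_plus)
    finally show ?thesis .
  qed
  then show ?thesis using C(1) by (intro exI[of _ "2 * C"]) auto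
qed

text \<open>The composition rule for Riesz kernels: each pole is integrable by itself, the joint
  decay makes infinity integrable, and the distance between the poles is the only remaining
  scale.\<close>

lemma nn_integral_two_poles:
  assumes "0 < \<alpha>" and "\<alpha> < Q" and "0 < \<beta>" and "\<beta> < Q" and "Q < \<alpha> + \<beta>"
  shows "\<exists>C\<ge>0. \<forall>x. radius x > 0 \<longrightarrow>
    (\<integral>\<^sup>+y. ennreal (d x y powr (- \<alpha>) * radius y powr (- \<beta>)) \<partial>M)
    \<le> ennreal (C * radius x powr (Q - \<alpha> - \<beta>))"
proof -
  obtain C1 where C1: "C1 \<ge> 0" "\<And>x r. r > 0 \<Longrightarrow>
    (\<integral>\<^sup>+y. ennreal (d x y powr (- \<alpha>)) * indicator {y. d x y < r} y \<partial>M) \<le> ennreal (C1 * r powr (Q - \<alpha>))"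
    using nn_integral_ball_powr[of \<alpha>] assms by auto
  obtain C2 where C2: "C2 \<ge> 0" "\<And>x r. r > 0 \<Longrightarrow>
    (\<integral>\<^sup>+y. ennreal (d x y powr (- \<beta>)) * indicator {y. d x y < r} y \<partial>M) \<le> ennreal (C2 * r powr (Q - \<beta>))"
    using nn_integral_ball_powr[of \<beta>] assms by auto
  obtain C3 where C3: "C3 \<ge> 0" "\<And>x r. r > 0 \<Longrightarrow>
    (\<integral>\<^sup>+y. ennreal (d x y powr (- (\<alpha> + \<beta>))) * indicator {y. r \<le> d x y} y \<partial>M) \<le> ennreal (C3 * r powr (Q - (\<alpha> + \<beta>)))"
    using nn_integral_tail_powr[of "\<alpha> + \<beta>"] assms by auto
  define C where "C = (C1 + C2 + 2 * C3) * (1 / (2 * K)) powr (Q - \<alpha> - \<beta>)"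
  have "(\<integral>\<^sup>+y. ennreal (d x y powr (- \<alpha>) * radius y powr (- \<beta>)) \<partial>M)
    \<le> ennreal (C * radius x powr (Q - \<alpha> - \<beta>))" if x: "radius x > 0" for x
  proof -
    \<comment> \<open>By the quasi-triangle inequality no point is closer than this to both
      poles.\<close>
    define r where "r = radius x / (2 * K)"
    have r: "r > 0" using x K_pos by (simp add: r_def)
    have "(\<integral>\<^sup>+y. ennreal (d x y powr (- \<alpha>) * radius y powr (- \<beta>)) \<partial>M)
      \<le> (\<integral>\<^sup>+y. (ennreal (r powr (- \<beta>)) * (ennreal (d x y powr (- \<alpha>)) * indicator {y. d x y < r} y)
          + ennreal (r powr (- \<alpha>)) * (ennreal (radius y powr (- \<beta>)) * indicator {y. radius y < r} y))
          + (ennreal (d x y powr (- (\<alpha> + \<beta>))) * indicator {y. r \<le> d x y} y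
          + ennreal (radius y powr (- (\<alpha> + \<beta>))) * indicator {y. r \<le> radius y} y) \<partial>M)"
    proof (intro nn_integral_mono)
      fix y
      define u where "u = d x y"
      define v where "v = radius y"
      have u: "u \<ge> 0" "v \<ge> 0" by (auto simp: u_def v_def d_nonneg)
      have "radius x \<le> 2 * K * max v u"
        using d_le_triangle[of z0 x y] by (simp add: u_def v_def d_sym[of y x])
      then have max: "r \<le> max v u" using K_pos by (simp add: r_def field_simps)
      have *: "u powr (- \<alpha>) * v powr (- \<beta>) \<le> (r powr (- \<beta>) * (u powr (- \<alpha>) * indicator {y. y < r} u)
          + r powr (- \<alpha>) * (v powr (- \<beta>) * indicator {y. y < r} v))
          + (u powr (- (\<alpha> + \<beta>)) * indicator {y. r \<le> y} u + v powr (- (\<alpha> + \<beta>)) * indicator {y. r \<le> y} v)"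
        (is "?L \<le> (?A + ?B) + (?C + ?D)")
      proof -
        have nonneg: "?A \<ge> 0" "?B \<ge> 0" "?C \<ge> 0" "?D \<ge> 0" by auto
        \<comment> \<open>Close to one pole, the factor of the other is at most a power of
          \<open>r\<close>. Away from both, both factors are compared with the smaller distance,
          which leads to a tail of exponent \<open>\<alpha> + \<beta> > Q\<close>.\<close>
        consider "v \<le> u" "v < r" | "v \<le> u" "r \<le> v" | "u < v" "u < r" | "u < v" "r \<le> u" by linarith
        then show ?thesis
        proof cases
          case 1
          then have "r \<le> u" using max by auto
          then have "u powr (- \<alpha>) * v powr (- \<beta>) \<le> r powr (- \<alpha>) * v powr (- \<beta>)"
            using r assms by (intro mult_right_mono powr_mono2') auto
          then have "?L \<le> ?B" using 1 by simp
          then show ?thesis using nonneg by linarith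
        next
          case 2
          then have "u powr (- \<alpha>) * v powr (- \<beta>) \<le> v powr (- \<alpha>) * v powr (- \<beta>)"
            using r assms by (intro mult_right_mono powr_mono2') auto
          then have "?L \<le> ?D" using 2 r by (simp add: powr_add[symmetric])
          then show ?thesis using nonneg by linarith
        next
          case 3
          then have "r \<le> v" using max by auto
          then have "u powr (- \<alpha>) * v powr (- \<beta>) \<le> u powr (- \<alpha>) * r powr (- \<beta>)"
            using r assms by (intro mult_left_mono powr_mono2') auto
          then have "?L \<le> ?A" using 3 by (simp add: mult_ac)
          then show ?thesis using nonneg by linarith
        next
          case 4
          then have "u powr (- \<alpha>) * v powr (- \<beta>) \<le> u powr (- \<alpha>) * u powr (- \<beta>)"
            using r assms by (intro mult_left_mono powr_mono2') auto
          then have "?L \<le> ?C" using 4 r by (simp add: powr_add[symmetric])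
          then show ?thesis using nonneg by linarith
        qed
      qed
      have e: "ennreal (indicator {y. y < r} u) = indicator {y. d x y < r} y"
        "ennreal (indicator {y. y < r} v) = indicator {y. radius y < r} y"
        "ennreal (indicator {y. r \<le> y} u) = indicator {y. r \<le> d x y} y"
        "ennreal (indicator {y. r \<le> y} v) = indicator {y. r \<le> radius y} y"
        by (auto simp: u_def v_def indicator_def)
      from ennreal_leI[OF *]
      show "ennreal (d x y powr (- \<alpha>) * radius y powr (- \<beta>))
        \<le> (ennreal (r powr (- \<beta>)) * (ennreal (d x y powr (- \<alpha>)) * indicator {y. d x y < r} y)
          + ennreal (r powr (- \<alpha>)) * (ennreal (radius y powr (- \<beta>)) * indicator {y. radius y < r} y))
          + (ennreal (d x y powr (- (\<alpha> + \<beta>))) * indicator {y. r \<le> d x y} y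
          + ennreal (radius y powr (- (\<alpha> + \<beta>))) * indicator {y. r \<le> radius y} y)"
        by (simp add: ennreal_mult e) (simp add: u_def v_def)
    qed
    also have "\<dots> \<le> (ennreal (r powr (- \<beta>)) * ennreal (C1 * r powr (Q - \<alpha>))
        + ennreal (r powr (- \<alpha>)) * ennreal (C2 * r powr (Q - \<beta>)))
        + (ennreal (C3 * r powr (Q - (\<alpha> + \<beta>))) + ennreal (C3 * r powr (Q - (\<alpha> + \<beta>))))"
    proof -
      have [measurable]: "{y. r \<le> d x y} \<in> sets M" for x by (rule sets_Collect_M) measurable
      show ?thesis
        by (simp add: nn_integral_add nn_integral_cmult del: ennreal_mult'' minus_add_distrib)
          (intro add_mono mult_left_mono C1(2) C2(2) C3(2) r; simp)
    qed
    also have "\<dots> = ennreal (r powr (- \<beta>) * (C1 * r powr (Q - \<alpha>)) + r powr (- \<alpha>) * (C2 * r powr (Q - \<beta>))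
        + (C3 * r powr (Q - (\<alpha> + \<beta>)) + C3 * r powr (Q - (\<alpha> + \<beta>))))"
      using C1(1) C2(1) C3(1)
      by (simp add: ennreal_mult[symmetric] ennreal_plus[symmetric] del: ennreal_plus)
    also have "r powr (- \<beta>) * (C1 * r powr (Q - \<alpha>)) + r powr (- \<alpha>) * (C2 * r powr (Q - \<beta>))
        + (C3 * r powr (Q - (\<alpha> + \<beta>)) + C3 * r powr (Q - (\<alpha> + \<beta>))) = (C1 + C2 + 2 * C3) * r powr (Q - \<alpha> - \<beta>)"
    proof -
      define P where "P = r powr (Q - \<alpha> - \<beta>)"
      have "r powr (- \<beta>) * r powr (Q - \<alpha>) = P" "r powr (- \<alpha>) * r powr (Q - \<beta>) = P"
        "r powr (Q - (\<alpha> + \<beta>)) = P"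
        by (simp_all add: P_def powr_add[symmetric] algebra_simps)
      then have "r powr (- \<beta>) * (C1 * r powr (Q - \<alpha>)) = C1 * P"
        "r powr (- \<alpha>) * (C2 * r powr (Q - \<beta>)) = C2 * P" "r powr (Q - (\<alpha> + \<beta>)) = P"
        by (simp_all add: mult.left_commute)
      note * = this
      show ?thesis by (simp only: * P_def[symmetric]) (simp add: algebra_simps)
    qed
    also have "\<dots> = C * radius x powr (Q - \<alpha> - \<beta>)"
    proof -
      have "r powr (Q - \<alpha> - \<beta>) = (1 / (2 * K)) powr (Q - \<alpha> - \<beta>) * radius x powr (Q - \<alpha> - \<beta>)"
        using x K_pos by (simp add: r_def flip: powr_mult)
      then show ?thesis by (simp add: C_def)
    qed
    finally show ?thesis .
  qed
  moreover have "C \<ge> 0" using C1(1) C2(1) C3(1) by (simp add: C_def)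
  ultimately show ?thesis by blast
qed

end

section \<open>Riesz potentials: far part, near part, and the case of equal exponents\<close>

context quasi_metric_measure
begin

lemmas measurable_nn_integral_M [measurable (raw)] =
  sigma_finite_measure.borel_measurable_nn_integral[OF sigma_finite]

text \<open>The Riesz potential of order \<open>a\<close>, valued in \<open>ennreal\<close> so that
  it makes sense before any finiteness is known.\<close>

definition potential :: "real \<Rightarrow> ('a \<Rightarrow> real) \<Rightarrow> 'a \<Rightarrow> ennreal" where
  "potential a f x = (\<integral>\<^sup>+y. ennreal (f y * d x y powr (a - Q)) \<partial>M)"

lemma measurable_potential [measurable]:
  assumes [measurable]: "f \<in> borel_measurable M"
  shows "potential a f \<in> borel_measurable M"
  unfolding potential_def by measurable

text \<open>The conjugate exponent turns the kernel into the power \<open>- s\<close> of the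
  distance, and \<open>s > Q\<close>, convergence of the tail, is equivalent to
  \<open>a < Q / p\<close>.\<close>

lemma potential_far:
  assumes "1 < p" and "0 < a" and "a < Q / p"
  shows "\<exists>C\<ge>0. \<forall>f \<in> borel_measurable M. (\<forall>y. 0 \<le> f y) \<longrightarrow> (\<integral>\<^sup>+y. ennreal (f y powr p) \<partial>M) \<le> 1 \<longrightarrow>
    (\<forall>x. \<forall>r>0. (\<integral>\<^sup>+y. ennreal (f y * d x y powr (a - Q)) * indicator {y. r \<le> d x y} y \<partial>M)
      \<le> ennreal (C * r powr (- (Q / p - a))))"
proof -
  define p' where "p' = p / (p - 1)"
  define s where "s = (Q - a) * p'"
  define \<kappa> where "\<kappa> = Q / p - a"
  have ap: "a * p < Q" using assms by (simp add: field_simps)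
  have "Q < s" using assms ap Q_pos by (simp add: s_def p'_def field_simps)
  from nn_integral_tail_powr[OF this] obtain C where C: "C \<ge> 0" "\<And>x r. r > 0 \<Longrightarrow>
    (\<integral>\<^sup>+y. ennreal (d x y powr (- s)) * indicator {y. r \<le> d x y} y \<partial>M) \<le> ennreal (C * r powr (Q - s))"
    by auto
  have "(\<integral>\<^sup>+y. ennreal (f y * d x y powr (a - Q)) * indicator {y. r \<le> d x y} y \<partial>M)
      \<le> ennreal ((1 + C) * r powr (- \<kappa>))"
    if [measurable]: "f \<in> borel_measurable M" and f: "\<And>y. 0 \<le> f y" "(\<integral>\<^sup>+y. ennreal (f y powr p) \<partial>M) \<le> 1" and r: "r > 0"
    for f x r
  proof -
    \<comment> \<open>The balancing scale: both \<open>l powr p\<close> and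
      \<open>l powr (- p') * r powr (Q - s)\<close> become
      \<open>r powr (- \<kappa>)\<close>.\<close>
    define l where "l = r powr (- \<kappa> / p)"
    have l: "l > 0" using r by (simp add: l_def)
    have [measurable]: "{y. r \<le> d x y} \<in> sets M" by (rule sets_Collect_M) measurable
    have "(\<integral>\<^sup>+y. ennreal (f y * d x y powr (a - Q)) * indicator {y. r \<le> d x y} y \<partial>M)
      \<le> (\<integral>\<^sup>+y. ennreal (l powr p) * ennreal (f y powr p)
          + ennreal (l powr (- p')) * (ennreal (d x y powr (- s)) * indicator {y. r \<le> d x y} y) \<partial>M)"
    proof (intro nn_integral_mono)
      fix y
      have "f y * d x y powr (a - Q) \<le> l powr p * f y powr p + l powr (- p') * (d x y powr (a - Q)) powr p'"
        unfolding p'_def using f(1) l assms by (intro Young_powr) auto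
      also have "(d x y powr (a - Q)) powr p' = d x y powr (- s)"
        by (simp add: powr_powr s_def algebra_simps)
      finally have "ennreal (f y * d x y powr (a - Q))
        \<le> ennreal (l powr p) * ennreal (f y powr p) + ennreal (l powr (- p')) * ennreal (d x y powr (- s))"
        by (simp add: ennreal_mult[symmetric] ennreal_plus[symmetric] ennreal_leI del: ennreal_plus)
      then show "ennreal (f y * d x y powr (a - Q)) * indicator {y. r \<le> d x y} y
        \<le> ennreal (l powr p) * ennreal (f y powr p)
          + ennreal (l powr (- p')) * (ennreal (d x y powr (- s)) * indicator {y. r \<le> d x y} y)"
        by (cases "r \<le> d x y") auto
    qed
    also have "\<dots> = ennreal (l powr p) * (\<integral>\<^sup>+y. ennreal (f y powr p) \<partial>M)
        + ennreal (l powr (- p')) * (\<integral>\<^sup>+y. ennreal (d x y powr (- s)) * indicator {y. r \<le> d x y} y \<partial>M)"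
      by (simp add: nn_integral_add nn_integral_cmult)
    also have "\<dots> \<le> ennreal (l powr p) * 1 + ennreal (l powr (- p')) * ennreal (C * r powr (Q - s))"
      by (intro add_mono mult_left_mono f(2) C(2) r) auto
    also have "\<dots> = ennreal (l powr p + C * (l powr (- p') * r powr (Q - s)))"
      using C(1) by (simp add: ennreal_mult[symmetric] ennreal_plus[symmetric] mult_ac del: ennreal_plus)
    also have "l powr p = r powr (- \<kappa>)" using assms by (simp add: l_def powr_powr)
    also have "l powr (- p') * r powr (Q - s) = r powr (- \<kappa>)"
    proof -
      have "- \<kappa> / p * - p' + (Q - s) = - \<kappa>"
      proof -
        have "- \<kappa> / p * - p' = \<kappa> / (p - 1)" using assms by (simp add: p'_def)
        moreover have "\<kappa> / (p - 1) + (Q - s) = (\<kappa> + Q * (p - 1) - (Q - a) * p) / (p - 1)"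
          using assms by (simp add: s_def p'_def add_divide_distrib diff_divide_distrib)
        moreover have "\<kappa> + Q * (p - 1) - (Q - a) * p = - \<kappa> * (p - 1)"
          using assms by (simp add: \<kappa>_def field_simps)
        ultimately show ?thesis using assms by simp
      qed
      then show ?thesis by (simp add: l_def powr_powr powr_add[symmetric])
    qed
    finally show ?thesis by (simp add: algebra_simps)
  qed
  then show ?thesis using C(1) unfolding \<kappa>_def by (intro exI[of _ "1 + C"]) auto
qed

text \<open>The kernel is split into the powers \<open>- \<alpha> / s\<close> and \<open>- t\<close>
  of the distance. By Young's inequality the second, raised to the conjugate exponent, integrates
  near the pole to a constant of size \<open>r powr (- \<kappa>)\<close>; the first stays with
  \<open>g\<close>, and its \<open>s\<close>-th power is integrated against the weight by Fubini. A
  level set argument can absorb the constant, so only \<open>G\<close> needs an integral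
  bound.\<close>

lemma potential_near:
  assumes "1 < s" and "1 < p" and "0 < a" and "a < Q" and "0 \<le> b" and "b < Q" and "b < a * s"
    and \<kappa>: "\<kappa> = Q / p - a"
  shows "\<exists>C\<ge>0. \<exists>D\<ge>0. \<forall>g \<in> borel_measurable M. \<forall>r>0. (\<forall>y. 0 \<le> g y) \<longrightarrow>
    (\<exists>G \<in> borel_measurable M.
      (\<forall>x. (\<integral>\<^sup>+y. ennreal (g y * d x y powr (a - Q)) * indicator {y. d x y < r} y \<partial>M)
        \<le> G x + ennreal (C * r powr (- \<kappa>))) \<and>
      (\<integral>\<^sup>+x. G x * ennreal (radius x powr (- b)) \<partial>M)
        \<le> ennreal (D * r powr (Q * (s - p) / p + (Q - b) - \<kappa>)) * (\<integral>\<^sup>+y. ennreal (g y powr s) \<partial>M))"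
proof -
  \<comment> \<open>The four demands on \<alpha>: positivity and \<open>\<alpha> + b < Q\<close> for
    the integral with two weights, \<open>Q - a * s < \<alpha>\<close> for
    \<open>\<gamma> < Q\<close>, and \<open>\<alpha> < s * (Q - a)\<close> for \<open>t > 0\<close>.
    The hypothesis \<open>b < a * s\<close> is what reconciles the second with the third.\<close>
  have "max 0 (Q - a * s) < min (Q - b) (s * (Q - a))"
  proof -
    have "Q * 1 < Q * s" using Q_pos assms by (intro mult_strict_left_mono) auto
    then show ?thesis
      unfolding max_less_iff_conj min_less_iff_conj using assms by (simp add: algebra_simps)
  qed
  then obtain \<alpha> where "max 0 (Q - a * s) < \<alpha>" "\<alpha> < min (Q - b) (s * (Q - a))"
    using dense by blast
  then have \<alpha>: "0 < \<alpha>" "Q - a * s < \<alpha>" "\<alpha> + b < Q" "\<alpha> < s * (Q - a)" by auto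
  define s' where "s' = s / (s - 1)"
  define t where "t = Q - a - \<alpha> / s"
  define \<gamma> where "\<gamma> = t * s'"
  have "0 < t" using \<alpha> assms by (simp add: t_def field_simps)
  then have "0 < \<gamma>" using assms by (simp add: \<gamma>_def s'_def)
  moreover have \<gamma>_eq: "\<gamma> = (s * (Q - a) - \<alpha>) / (s - 1)"
    using assms by (simp add: \<gamma>_def s'_def t_def divide_simps)
  then have "\<gamma> < Q" using \<alpha> assms by (simp add: pos_divide_less_eq algebra_simps)
  ultimately obtain C where C: "C \<ge> 0" "\<And>x r. r > 0 \<Longrightarrow>
    (\<integral>\<^sup>+y. ennreal (d x y powr (- \<gamma>)) * indicator {y. d x y < r} y \<partial>M) \<le> ennreal (C * r powr (Q - \<gamma>))"
    using nn_integral_ball_powr[of \<gamma>] by auto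
  obtain D where D: "D \<ge> 0" "\<And>y r. r > 0 \<Longrightarrow>
    (\<integral>\<^sup>+x. ennreal (d x y powr (- \<alpha>) * radius x powr (- b)) * indicator {x. d x y < r} x \<partial>M)
    \<le> ennreal (D * r powr (Q - \<alpha> - b))"
    using nn_integral_ball_two_weights[OF \<alpha>(1) \<open>0 \<le> b\<close> \<alpha>(3)] by auto
  \<comment> \<open>Determined by the requirement that, with \<open>l powr s = r powr m\<close>, the
    second Young term be of size \<open>r powr (- \<kappa>)\<close>.\<close>
  define m where "m = Q * (s - p) / p + \<alpha> - \<kappa>"
  have "\<exists>G \<in> borel_measurable M.
      (\<forall>x. (\<integral>\<^sup>+y. ennreal (g y * d x y powr (a - Q)) * indicator {y. d x y < r} y \<partial>M)
        \<le> G x + ennreal (C * r powr (- \<kappa>))) \<and>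
      (\<integral>\<^sup>+x. G x * ennreal (radius x powr (- b)) \<partial>M)
        \<le> ennreal (D * r powr (Q * (s - p) / p + (Q - b) - \<kappa>)) * (\<integral>\<^sup>+y. ennreal (g y powr s) \<partial>M)"
    if [measurable]: "g \<in> borel_measurable M" and r: "r > 0" and g: "\<And>y. 0 \<le> g y" for g r
  proof (intro bexI conjI allI)
    define l where "l = r powr (m / s)"
    have l: "l > 0" using r by (simp add: l_def)
    let ?G = "\<lambda>x. \<integral>\<^sup>+y. ennreal (r powr m) * (ennreal (g y powr s) * (ennreal (d x y powr (- \<alpha>)) * indicator {y. d x y < r} y)) \<partial>M"
    show [measurable]: "?G \<in> borel_measurable M" by measurable
    show "(\<integral>\<^sup>+y. ennreal (g y * d x y powr (a - Q)) * indicator {y. d x y < r} y \<partial>M)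
        \<le> ?G x + ennreal (C * r powr (- \<kappa>))" for x
    proof -
      have "(\<integral>\<^sup>+y. ennreal (g y * d x y powr (a - Q)) * indicator {y. d x y < r} y \<partial>M)
        \<le> (\<integral>\<^sup>+y. ennreal (r powr m) * (ennreal (g y powr s) * (ennreal (d x y powr (- \<alpha>)) * indicator {y. d x y < r} y))
          + ennreal (l powr (- s')) * (ennreal (d x y powr (- \<gamma>)) * indicator {y. d x y < r} y) \<partial>M)"
      proof (intro nn_integral_mono)
        fix y
        show "ennreal (g y * d x y powr (a - Q)) * indicator {y. d x y < r} y
          \<le> ennreal (r powr m) * (ennreal (g y powr s) * (ennreal (d x y powr (- \<alpha>)) * indicator {y. d x y < r} y))
          + ennreal (l powr (- s')) * (ennreal (d x y powr (- \<gamma>)) * indicator {y. d x y < r} y)"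
        proof (cases "0 < d x y \<and> d x y < r")
          case True
          have "g y * d x y powr (a - Q) = (g y * d x y powr (- \<alpha> / s)) * d x y powr (- t)"
            by (simp add: t_def mult.assoc powr_add[symmetric])
          also have "\<dots> \<le> l powr s * (g y * d x y powr (- \<alpha> / s)) powr s + l powr (- s') * (d x y powr (- t)) powr s'"
            unfolding s'_def using g l assms by (intro Young_powr) auto
          also have "(d x y powr (- t)) powr s' = d x y powr (- \<gamma>)"
            by (simp add: powr_powr \<gamma>_def)
          also have "(g y * d x y powr (- \<alpha> / s)) powr s = g y powr s * d x y powr (- \<alpha>)"
            using assms g by (simp add: powr_mult powr_powr)
          also have "l powr s = r powr m" using assms by (simp add: l_def powr_powr)
          finally show ?thesis using True
            by (simp add: ennreal_mult[symmetric] ennreal_plus[symmetric] ennreal_leI del: ennreal_plus)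
        next
          case False
          then have "ennreal (g y * d x y powr (a - Q)) * indicator {y. d x y < r} y = 0"
            using d_nonneg[of x y] by (auto simp: indicator_def)
          then show ?thesis by (simp only: zero_le)
        qed
      qed
      also have "\<dots> = ?G x + ennreal (l powr (- s')) * (\<integral>\<^sup>+y. ennreal (d x y powr (- \<gamma>)) * indicator {y. d x y < r} y \<partial>M)"
        by (simp add: nn_integral_add nn_integral_cmult)
      also have "\<dots> \<le> ?G x + ennreal (l powr (- s')) * ennreal (C * r powr (Q - \<gamma>))"
        by (intro add_left_mono mult_left_mono C(2) r) auto
      also have "ennreal (l powr (- s')) * ennreal (C * r powr (Q - \<gamma>)) = ennreal (C * (l powr (- s') * r powr (Q - \<gamma>)))"
        using C(1) by (simp add: ennreal_mult[symmetric] mult_ac)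
      also have "l powr (- s') * r powr (Q - \<gamma>) = r powr (- \<kappa>)"
      proof -
        have "m / s * - s' + (Q - \<gamma>) = - \<kappa>"
        proof -
          have "Q * (s - p) / p = s * (\<kappa> + a) - Q" using assms by (simp add: \<kappa> field_simps)
          then have "m + (s * (Q - a) - \<alpha>) = (s - 1) * (\<kappa> + Q)"
            by (simp add: m_def algebra_simps)
          moreover have "m / s * - s' + (Q - \<gamma>) = Q - (m + (s * (Q - a) - \<alpha>)) / (s - 1)"
            using assms by (simp add: s'_def \<gamma>_eq add_divide_distrib)
          ultimately show ?thesis using assms by simp
        qed
        then show ?thesis by (simp add: l_def powr_powr powr_add[symmetric])
      qed
      finally show ?thesis .
    qed
    have "(\<integral>\<^sup>+x. ?G x * ennreal (radius x powr (- b)) \<partial>M)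
      = (\<integral>\<^sup>+x. (\<integral>\<^sup>+y. ennreal (r powr m) * (ennreal (g y powr s) *
          (ennreal (d x y powr (- \<alpha>) * radius x powr (- b)) * indicator {x. d x y < r} x)) \<partial>M) \<partial>M)"
    proof (intro nn_integral_cong)
      fix x
      show "?G x * ennreal (radius x powr (- b)) = (\<integral>\<^sup>+y. ennreal (r powr m) * (ennreal (g y powr s) *
          (ennreal (d x y powr (- \<alpha>) * radius x powr (- b)) * indicator {x. d x y < r} x)) \<partial>M)"
        by (subst nn_integral_multc[symmetric])
          (auto intro!: nn_integral_cong simp: ennreal_mult mult_ac indicator_def)
    qed
    also have "\<dots> = (\<integral>\<^sup>+y. (\<integral>\<^sup>+x. ennreal (r powr m) * (ennreal (g y powr s) *
          (ennreal (d x y powr (- \<alpha>) * radius x powr (- b)) * indicator {x. d x y < r} x)) \<partial>M) \<partial>M)"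
      by (rule pair_sigma_finite.Fubini'[OF pair_M_M, symmetric]) measurable
    also have "\<dots> = (\<integral>\<^sup>+y. ennreal (r powr m) * (ennreal (g y powr s) *
          (\<integral>\<^sup>+x. ennreal (d x y powr (- \<alpha>) * radius x powr (- b)) * indicator {x. d x y < r} x \<partial>M)) \<partial>M)"
    proof -
      have [measurable]: "{x. d x y < r} \<in> sets M" for y by (rule sets_Collect_M) measurable
      show ?thesis by (simp add: nn_integral_cmult)
    qed
    also have "\<dots> \<le> (\<integral>\<^sup>+y. ennreal (r powr m) * (ennreal (g y powr s) * ennreal (D * r powr (Q - \<alpha> - b))) \<partial>M)"
      by (intro nn_integral_mono mult_left_mono D(2) r) auto
    also have "\<dots> = ennreal (D * (r powr m * r powr (Q - \<alpha> - b))) * (\<integral>\<^sup>+y. ennreal (g y powr s) \<partial>M)"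
      using D(1) by (simp add: nn_integral_cmult[symmetric] ennreal_mult mult_ac)
    also have "r powr m * r powr (Q - \<alpha> - b) = r powr (Q * (s - p) / p + (Q - b) - \<kappa>)"
    proof -
      have "m + (Q - \<alpha> - b) = Q * (s - p) / p + (Q - b) - \<kappa>" by (simp add: m_def)
      then show ?thesis by (simp only: powr_add[symmetric])
    qed
    finally show "(\<integral>\<^sup>+x. ?G x * ennreal (radius x powr (- b)) \<partial>M)
        \<le> ennreal (D * r powr (Q * (s - p) / p + (Q - b) - \<kappa>)) * (\<integral>\<^sup>+y. ennreal (g y powr s) \<partial>M)" .
  qed
  then show ?thesis using C(1) D(1) by blast
qed

text \<open>
  Schur's test with the weight \<open>radius powr (- \<sigma>)\<close>. Quantifying over the reals \<open>w\<close> below the potential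
  makes sense of its \<open>p\<close>-th power without assuming that it is finite: where the potential is infinite,
  the majorant \<open>\<Phi>\<close> is forced to be infinite as well (off the base point).
\<close>

lemma potential_bound_diagonal:
  assumes "1 < p" and "0 < a" and "a < Q / p"
  shows "\<exists>C\<ge>0. \<forall>f \<in> borel_measurable M. (\<forall>y. 0 \<le> f y) \<longrightarrow> (\<integral>\<^sup>+y. ennreal (f y powr p) \<partial>M) \<le> 1 \<longrightarrow>
    (\<exists>\<Phi> \<in> borel_measurable M. (\<integral>\<^sup>+x. \<Phi> x \<partial>M) \<le> ennreal C \<and>
      (\<forall>x w. 0 \<le> w \<longrightarrow> ennreal w \<le> potential a f x \<longrightarrow> ennreal (w powr p * radius x powr (- (a * p))) \<le> \<Phi> x))"
proof -
  define p' where "p' = p / (p - 1)"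
  have p': "p' > 1" using assms by (simp add: p'_def)
  have ap: "a * p < Q" using assms by (simp add: field_simps)
  have "a * 1 < a * p" using assms by (intro mult_strict_left_mono) auto
  then have aQ: "a < Q" using ap by simp
  \<comment> \<open>Both test integrals must converge: the first asks for
    \<open>a < \<sigma> * p' < Q\<close>, the second for \<open>a + \<sigma> * p < Q\<close>. A
    common \<sigma> exists because \<open>a * p < Q\<close>.\<close>
  have "a / p' < min (Q / p') ((Q - a) / p)"
  proof -
    have "a / p' < Q / p'" using aQ p' by (intro divide_strict_right_mono) auto
    moreover have "a / p' = a * (p - 1) / p" by (simp add: p'_def)
    moreover have "a * (p - 1) / p < (Q - a) / p"
      using ap assms by (intro divide_strict_right_mono) (auto simp: algebra_simps)
    ultimately show ?thesis by simp
  qed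
  then obtain \<sigma> where "a / p' < \<sigma>" "\<sigma> < min (Q / p') ((Q - a) / p)" using dense by blast
  then have \<sigma>: "a < \<sigma> * p'" "\<sigma> * p' < Q" "\<sigma> * p < Q - a"
    using p' assms by (simp_all add: field_simps)
  have "0 < \<sigma> * p'" using \<sigma> assms by simp
  then have \<sigma>0: "0 < \<sigma>" using p' by (simp add: zero_less_mult_iff)
  obtain C1 where C1: "C1 \<ge> 0" "\<And>x. radius x > 0 \<Longrightarrow>
    (\<integral>\<^sup>+y. ennreal (d x y powr (- (Q - a)) * radius y powr (- (\<sigma> * p'))) \<partial>M)
    \<le> ennreal (C1 * radius x powr (Q - (Q - a) - \<sigma> * p'))"
    using nn_integral_two_poles[of "Q - a" "\<sigma> * p'"] \<sigma> aQ assms by auto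
  obtain C2 where C2: "C2 \<ge> 0" "\<And>x. radius x > 0 \<Longrightarrow>
    (\<integral>\<^sup>+y. ennreal (d x y powr (- (Q - a)) * radius y powr (- (a + \<sigma> * p))) \<partial>M)
    \<le> ennreal (C2 * radius x powr (Q - (Q - a) - (a + \<sigma> * p)))"
    using nn_integral_two_poles[of "Q - a" "a + \<sigma> * p"] \<sigma> \<sigma>0 aQ assms by auto
  \<comment> \<open>The added 1 makes \<open>B\<close> below positive, as the choice of
    \<open>l\<close> requires.\<close>
  define C3 where "C3 = C1 + 1"
  have C3: "C3 > 0" using C1 by (simp add: C3_def)
  define E where "E = 2 powr p * C3 powr (p - 1)"
  have "\<exists>\<Phi> \<in> borel_measurable M. (\<integral>\<^sup>+x. \<Phi> x \<partial>M) \<le> ennreal (E * C2) \<and>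
      (\<forall>x w. 0 \<le> w \<longrightarrow> ennreal w \<le> potential a f x \<longrightarrow> ennreal (w powr p * radius x powr (- (a * p))) \<le> \<Phi> x)"
    if [measurable]: "f \<in> borel_measurable M" and f: "\<And>y. 0 \<le> f y" "(\<integral>\<^sup>+y. ennreal (f y powr p) \<partial>M) \<le> 1" for f
  proof (intro bexI conjI allI impI)
    let ?A = "\<lambda>x. \<integral>\<^sup>+y. ennreal (f y powr p * radius y powr (\<sigma> * p)) * ennreal (d x y powr (- (Q - a))) \<partial>M"
    let ?\<Phi> = "\<lambda>x. ennreal (E * radius x powr (- (a + \<sigma> * p))) * ?A x"
    show [measurable]: "?\<Phi> \<in> borel_measurable M" by measurable
    show "ennreal (w powr p * radius x powr (- (a * p))) \<le> ?\<Phi> x"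
      if w: "0 \<le> w" "ennreal w \<le> potential a f x" for x w
    proof (cases "w = 0 \<or> radius x = 0")
      case False
      then have w0: "w > 0" and x: "radius x > 0" using w d_nonneg[of z0 x] by auto
      define B where "B = C3 * radius x powr (a - \<sigma> * p')"
      have B: "B > 0" using C3 x by (simp add: B_def)
      have Young: "potential a f x \<le> ennreal (l powr p) * ?A x + ennreal (l powr (- p') * B)" if l: "l > 0" for l
      proof -
        have "potential a f x \<le> (\<integral>\<^sup>+y. ennreal (l powr p) * (ennreal (f y powr p * radius y powr (\<sigma> * p)) * ennreal (d x y powr (- (Q - a))))
            + ennreal (l powr (- p')) * ennreal (d x y powr (- (Q - a)) * radius y powr (- (\<sigma> * p'))) \<partial>M)"
          unfolding potential_def
        proof (intro nn_integral_mono_AE)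
          show "AE y in M. ennreal (f y * d x y powr (a - Q)) \<le> ennreal (l powr p) * (ennreal (f y powr p * radius y powr (\<sigma> * p)) * ennreal (d x y powr (- (Q - a))))
            + ennreal (l powr (- p')) * ennreal (d x y powr (- (Q - a)) * radius y powr (- (\<sigma> * p')))"
            using AE_d_pos[of z0]
          proof (rule AE_mp, intro AE_I2 impI)
            fix y assume y: "radius y > 0"
            define k where "k = d x y powr (a - Q)"
            have k: "k \<ge> 0" by (simp add: k_def)
            have pp: "1 / p + 1 / p' = 1" using assms by (simp add: p'_def field_simps)
            \<comment> \<open>Schur's splitting: the kernel is distributed over conjugate exponents,
              and the test weight is multiplied into one factor and divided out of the
              other.\<close>
            have "f y * k = (f y * k powr (1 / p) * radius y powr \<sigma>) * (k powr (1 / p') * radius y powr (- \<sigma>))"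
            proof -
              have "(f y * k powr (1 / p) * radius y powr \<sigma>) * (k powr (1 / p') * radius y powr (- \<sigma>))
                = f y * (k powr (1 / p) * k powr (1 / p')) * (radius y powr \<sigma> * radius y powr (- \<sigma>))"
                by (simp only: mult_ac)
              also have "k powr (1 / p) * k powr (1 / p') = k"
                using k by (simp add: powr_add[symmetric] pp)
              also have "radius y powr \<sigma> * radius y powr (- \<sigma>) = 1"
                using y by (simp add: powr_add[symmetric])
              finally show ?thesis unfolding mult_1_right by (rule sym)
            qed
            also have "\<dots> \<le> l powr p * (f y * k powr (1 / p) * radius y powr \<sigma>) powr p
                + l powr (- p') * (k powr (1 / p') * radius y powr (- \<sigma>)) powr p'"
              unfolding p'_def using f(1) l assms by (intro Young_powr) auto
            also have "(f y * k powr (1 / p) * radius y powr \<sigma>) powr p = f y powr p * radius y powr (\<sigma> * p) * k"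
              using f(1)[of y] k assms by (simp add: powr_mult powr_powr mult_ac)
            also have "(k powr (1 / p') * radius y powr (- \<sigma>)) powr p' = k * radius y powr (- (\<sigma> * p'))"
              using k p' by (simp add: powr_mult powr_powr)
            finally show "ennreal (f y * d x y powr (a - Q)) \<le> ennreal (l powr p) * (ennreal (f y powr p * radius y powr (\<sigma> * p)) * ennreal (d x y powr (- (Q - a))))
              + ennreal (l powr (- p')) * ennreal (d x y powr (- (Q - a)) * radius y powr (- (\<sigma> * p')))"
              using k by (simp add: k_def ennreal_mult[symmetric] ennreal_plus[symmetric] ennreal_leI del: ennreal_plus)
          qed
        qed
        also have "\<dots> = ennreal (l powr p) * ?A x + ennreal (l powr (- p')) *
            (\<integral>\<^sup>+y. ennreal (d x y powr (- (Q - a)) * radius y powr (- (\<sigma> * p'))) \<partial>M)"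
          by (simp add: nn_integral_add nn_integral_cmult)
        also have "\<dots> \<le> ennreal (l powr p) * ?A x + ennreal (l powr (- p')) * ennreal B"
        proof (intro add_left_mono mult_left_mono)
          show "(\<integral>\<^sup>+y. ennreal (d x y powr (- (Q - a)) * radius y powr (- (\<sigma> * p'))) \<partial>M) \<le> ennreal B"
            using C1(2)[OF x] by (rule order_trans) (auto simp: B_def C3_def intro!: ennreal_leI mult_right_mono)
        qed simp
        finally show ?thesis using B by (simp add: ennreal_mult)
      qed
      \<comment> \<open>Makes the second Young term equal to \<open>w / 2\<close>. As
        \<open>w\<close> is a real number, this half can be subtracted even when the potential is
        infinite.\<close>
      define l where "l = (2 * B / w) powr (1 / p')"
      have l: "l > 0" using B w0 by (simp add: l_def)
      have lB: "l powr (- p') * B = w / 2"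
        using B w0 p' by (simp add: l_def powr_powr powr_minus field_simps)
      have w_le: "ennreal w \<le> ennreal (l powr p) * ?A x + ennreal (w / 2)"
        using order_trans[OF w(2) Young[OF l]] unfolding lB .
      have "ennreal (w / 2) \<le> ennreal (l powr p) * ?A x"
      proof (cases "?A x" rule: ennreal_cases)
        case (real A)
        then show ?thesis
          using w_le w0 unfolding real(2) by (simp add: ennreal_mult[symmetric] ennreal_plus[symmetric] ennreal_le_iff del: ennreal_plus)
      next
        case top
        then show ?thesis using l by (simp add: ennreal_mult_top)
      qed
      then have "ennreal (2 * w powr (p - 1) * radius x powr (- (a * p))) * ennreal (w / 2)
        \<le> ennreal (2 * w powr (p - 1) * radius x powr (- (a * p))) * (ennreal (l powr p) * ?A x)"
        by (rule mult_left_mono) simp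
      also have "\<dots> = ennreal (2 * w powr (p - 1) * radius x powr (- (a * p)) * l powr p) * ?A x"
        by (simp add: ennreal_mult mult.assoc)
      also have "2 * w powr (p - 1) * radius x powr (- (a * p)) * l powr p = E * radius x powr (- (a + \<sigma> * p))"
      proof -
        have "l powr p = (2 * B / w) powr (p - 1)"
          using assms by (simp add: l_def powr_powr p'_def)
        also have "\<dots> = 2 powr (p - 1) * C3 powr (p - 1) * radius x powr ((a - \<sigma> * p') * (p - 1)) / w powr (p - 1)"
          using C3 x w0 by (simp add: B_def powr_mult powr_divide powr_powr)
        also have "(a - \<sigma> * p') * (p - 1) = a * p - a - \<sigma> * p"
          using assms by (simp add: p'_def field_simps)
        finally have "2 * w powr (p - 1) * radius x powr (- (a * p)) * l powr p
          = (2 powr 1 * 2 powr (p - 1)) * C3 powr (p - 1) * (radius x powr (- (a * p)) * radius x powr (a * p - a - \<sigma> * p))"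
          using w0 by simp
        also have "\<dots> = E * radius x powr (- (a + \<sigma> * p))"
          by (simp only: powr_add[symmetric]) (simp add: E_def)
        finally show ?thesis .
      qed
      also have "ennreal (2 * w powr (p - 1) * radius x powr (- (a * p))) * ennreal (w / 2)
        = ennreal (w powr p * radius x powr (- (a * p)))"
      proof -
        have "w powr (p - 1) * w = w powr p" using w0 by (simp add: powr_mult_base' powr_diff)
        then show ?thesis using w0 by (simp add: ennreal_mult[symmetric] mult_ac)
      qed
      finally show ?thesis .
    qed auto
    \<comment> \<open>The other half of Schur's test: after Fubini the integral over
      \<open>x\<close> has poles at \<open>y\<close> and at the base point, and it returns the power
      \<open>- (\<sigma> * p)\<close> of \<open>radius y\<close>, which cancels the weight attached
      to \<open>f\<close>.\<close>
    have "(\<integral>\<^sup>+x. ?\<Phi> x \<partial>M) = (\<integral>\<^sup>+x. (\<integral>\<^sup>+y. ennreal (E * (f y powr p * radius y powr (\<sigma> * p))) *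
        ennreal (d y x powr (- (Q - a)) * radius x powr (- (a + \<sigma> * p))) \<partial>M) \<partial>M)"
    proof (intro nn_integral_cong)
      fix x
      have E: "E \<ge> 0" by (simp add: E_def)
      show "?\<Phi> x = (\<integral>\<^sup>+y. ennreal (E * (f y powr p * radius y powr (\<sigma> * p))) *
        ennreal (d y x powr (- (Q - a)) * radius x powr (- (a + \<sigma> * p))) \<partial>M)"
        using E by (subst nn_integral_cmult[symmetric])
          (auto simp: ennreal_mult[symmetric] mult_ac d_sym[of x] intro!: nn_integral_cong)
    qed
    also have "\<dots> = (\<integral>\<^sup>+y. (\<integral>\<^sup>+x. ennreal (E * (f y powr p * radius y powr (\<sigma> * p))) *
        ennreal (d y x powr (- (Q - a)) * radius x powr (- (a + \<sigma> * p))) \<partial>M) \<partial>M)"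
      by (rule pair_sigma_finite.Fubini'[OF pair_M_M, symmetric]) measurable
    also have "\<dots> = (\<integral>\<^sup>+y. ennreal (E * (f y powr p * radius y powr (\<sigma> * p))) *
        (\<integral>\<^sup>+x. ennreal (d y x powr (- (Q - a)) * radius x powr (- (a + \<sigma> * p))) \<partial>M) \<partial>M)"
      by (rule nn_integral_cong, rule nn_integral_cmult, measurable)
    also have "\<dots> \<le> (\<integral>\<^sup>+y. ennreal (E * C2) * ennreal (f y powr p) \<partial>M)"
    proof (rule nn_integral_mono_AE, rule AE_mp[OF AE_d_pos[of z0]], rule AE_I2, rule impI)
      fix y assume y: "radius y > 0"
      have E: "E \<ge> 0" by (simp add: E_def)
      have "ennreal (E * (f y powr p * radius y powr (\<sigma> * p))) *
        (\<integral>\<^sup>+x. ennreal (d y x powr (- (Q - a)) * radius x powr (- (a + \<sigma> * p))) \<partial>M)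
        \<le> ennreal (E * (f y powr p * radius y powr (\<sigma> * p))) * ennreal (C2 * radius y powr (Q - (Q - a) - (a + \<sigma> * p)))"
        by (intro mult_left_mono C2(2) y) simp
      also have "\<dots> = ennreal (E * C2 * f y powr p * (radius y powr (\<sigma> * p) * radius y powr (- (\<sigma> * p))))"
        using E C2(1) by (simp add: ennreal_mult[symmetric] mult_ac)
      also have "radius y powr (\<sigma> * p) * radius y powr (- (\<sigma> * p)) = 1"
        using y by (simp add: powr_add[symmetric])
      finally show "ennreal (E * (f y powr p * radius y powr (\<sigma> * p))) *
        (\<integral>\<^sup>+x. ennreal (d y x powr (- (Q - a)) * radius x powr (- (a + \<sigma> * p))) \<partial>M)
        \<le> ennreal (E * C2) * ennreal (f y powr p)"
        using E C2(1) by (simp add: ennreal_mult)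
    qed
    also have "\<dots> = ennreal (E * C2) * (\<integral>\<^sup>+y. ennreal (f y powr p) \<partial>M)"
      by (rule nn_integral_cmult) measurable
    also have "\<dots> \<le> ennreal (E * C2)"
      using mult_left_mono[OF f(2), of "ennreal (E * C2)"] by simp
    finally show "(\<integral>\<^sup>+x. ?\<Phi> x \<partial>M) \<le> ennreal (E * C2)" .
  qed
  then show ?thesis using C2(1) by (intro exI[of _ "E * C2"]) (auto simp: E_def)
qed

end

section \<open>Distinct exponents: interpolation over scales\<close>

context quasi_metric_measure
begin

text \<open>
  Marcinkiewicz interpolation carried out by hand: at scale \<open>r\<close> the function is truncated at height
  \<open>r powr (- Q / p)\<close> and the kernel at distance \<open>r\<close>; the far part is at most a multiple of
  \<open>r powr (- \<kappa>)\<close>, and the level sets at these heights recover the \<open>q\<close>-th power.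
\<close>

lemma potential_bound_off_diagonal:
  assumes "1 < p" and "p < q" and "0 < a" and "a < Q / p" and "0 \<le> b" and "b < Q"
    and exponents: "(Q - b) / q = Q / p - a"
  shows "\<exists>C\<ge>0. \<forall>f \<in> borel_measurable M. (\<forall>y. 0 \<le> f y) \<longrightarrow> (\<integral>\<^sup>+y. ennreal (f y powr p) \<partial>M) \<le> 1 \<longrightarrow>
    (\<exists>\<Phi> \<in> borel_measurable M. (\<integral>\<^sup>+x. \<Phi> x \<partial>M) \<le> ennreal C \<and>
      (\<forall>x w. 0 \<le> w \<longrightarrow> ennreal w \<le> potential a f x \<longrightarrow> ennreal (w powr q * radius x powr (- b)) \<le> \<Phi> x))"
proof -
  define \<kappa> where "\<kappa> = Q / p - a"
  have \<kappa>: "\<kappa> > 0" using assms by (simp add: \<kappa>_def)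
  have q: "q > 0" using assms by simp
  have Qb: "Q - b = \<kappa> * q" using exponents q by (simp add: \<kappa>_def field_simps)
  have ap: "a * p < Q" using assms by (simp add: field_simps)
  have "a * 1 < a * p" using assms by (intro mult_strict_left_mono) auto
  then have aQ: "a < Q" using ap by simp
  have "b < a * p"
  proof -
    have "\<kappa> * p < \<kappa> * q" using \<kappa> assms by (intro mult_strict_left_mono) auto
    moreover have "\<kappa> * p = Q - a * p" using assms by (simp add: \<kappa>_def field_simps)
    ultimately show ?thesis using Qb by simp
  qed
  \<comment> \<open>There is room for an exponent \<open>s0\<close> below \<open>p\<close> that
    still satisfies \<open>b < a * s0\<close>. It will handle the part of \<open>f\<close> above the
    truncation height and \<open>s1 > p\<close> the part below; the signs of \<open>e0\<close> and
    \<open>e1\<close> make the respective integrals over scales converge.\<close>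
  then have "max 1 (b / a) < p" using assms by (simp add: pos_divide_less_eq mult.commute)
  then obtain s0 where s0: "max 1 (b / a) < s0" "s0 < p" using dense by blast
  then have s0': "1 < s0" "b < a * s0" using assms by (simp_all add: pos_divide_less_eq mult.commute)
  define s1 where "s1 = p + 1"
  have s1: "1 < s1" "b < a * s1" "p < s1" using assms \<open>b < a * p\<close> by (simp_all add: s1_def algebra_simps)
  define e0 where "e0 = Q * (s0 - p) / p"
  define e1 where "e1 = Q * (s1 - p) / p"
  have e0: "e0 < 0" using s0 assms Q_pos by (simp add: e0_def divide_neg_pos mult_pos_neg)
  have e1: "e1 > 0" using s1 assms Q_pos by (simp add: e1_def)
  obtain Cf where Cf: "Cf \<ge> 0" "\<And>f x r. f \<in> borel_measurable M \<Longrightarrow> (\<And>y. 0 \<le> f y) \<Longrightarrow>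
      (\<integral>\<^sup>+y. ennreal (f y powr p) \<partial>M) \<le> 1 \<Longrightarrow> r > 0 \<Longrightarrow>
      (\<integral>\<^sup>+y. ennreal (f y * d x y powr (a - Q)) * indicator {y. r \<le> d x y} y \<partial>M) \<le> ennreal (Cf * r powr (- \<kappa>))"
    using potential_far[of p a] assms unfolding \<kappa>_def by blast
  obtain C0 D0 where C0: "C0 \<ge> 0" "D0 \<ge> 0" "\<And>g r. g \<in> borel_measurable M \<Longrightarrow> r > 0 \<Longrightarrow> (\<And>y. 0 \<le> g y) \<Longrightarrow>
    \<exists>G \<in> borel_measurable M.
      (\<forall>x. (\<integral>\<^sup>+y. ennreal (g y * d x y powr (a - Q)) * indicator {y. d x y < r} y \<partial>M)
        \<le> G x + ennreal (C0 * r powr (- \<kappa>))) \<and>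
      (\<integral>\<^sup>+x. G x * ennreal (radius x powr (- b)) \<partial>M)
        \<le> ennreal (D0 * r powr (e0 + (Q - b) - \<kappa>)) * (\<integral>\<^sup>+y. ennreal (g y powr s0) \<partial>M)"
    using potential_near[OF s0'(1) assms(1,3) aQ assms(5,6) s0'(2) \<kappa>_def] unfolding e0_def by blast
  obtain C1 D1 where C1: "C1 \<ge> 0" "D1 \<ge> 0" "\<And>g r. g \<in> borel_measurable M \<Longrightarrow> r > 0 \<Longrightarrow> (\<And>y. 0 \<le> g y) \<Longrightarrow>
    \<exists>G \<in> borel_measurable M.
      (\<forall>x. (\<integral>\<^sup>+y. ennreal (g y * d x y powr (a - Q)) * indicator {y. d x y < r} y \<partial>M)
        \<le> G x + ennreal (C1 * r powr (- \<kappa>))) \<and>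
      (\<integral>\<^sup>+x. G x * ennreal (radius x powr (- b)) \<partial>M)
        \<le> ennreal (D1 * r powr (e1 + (Q - b) - \<kappa>)) * (\<integral>\<^sup>+y. ennreal (g y powr s1) \<partial>M)"
    using potential_near[OF s1(1) assms(1,3) aQ assms(5,6) s1(2) \<kappa>_def] unfolding e1_def by blast
  \<comment> \<open>The three constants pay for the far part and the two near remainders; the extra
    1 forces \<open>G0 + G1\<close> to be at least \<open>r powr (- \<kappa>)\<close> on the level
    set.\<close>
  define c where "c = Cf + C0 + C1 + 1"
  have c: "c > 0" using Cf(1) C0(1) C1(1) by (simp add: c_def)
  \<comment> \<open>Normalised so that the integral over scales from \<open>2 * \<rho>\<close> on,
    with \<rho> as below, returns exactly \<open>w powr q\<close>.\<close>
  define B where "B = 2 powr (Q - b) * c powr q * (Q - b)"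
  have B: "B > 0" using c assms by (simp add: B_def)
  define j0 where "j0 = 1 / (- e0)"
  define j1 where "j1 = 1 / e1"
  have j: "j0 > 0" "j1 > 0" using e0 e1 by (simp_all add: j0_def j1_def)
  define C where "C = B * D0 * j0 + B * D1 * j1"
  have "C \<ge> 0" using B C0(2) C1(2) j by (simp add: C_def)
  have "\<exists>\<Phi> \<in> borel_measurable M. (\<integral>\<^sup>+x. \<Phi> x \<partial>M) \<le> ennreal C \<and>
      (\<forall>x w. 0 \<le> w \<longrightarrow> ennreal w \<le> potential a f x \<longrightarrow> ennreal (w powr q * radius x powr (- b)) \<le> \<Phi> x)"
    if [measurable]: "f \<in> borel_measurable M" and f: "\<And>y. 0 \<le> f y" "(\<integral>\<^sup>+y. ennreal (f y powr p) \<partial>M) \<le> 1" for f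
  proof -
    define I where "I = potential a f"
    have [measurable]: "I \<in> borel_measurable M" unfolding I_def by measurable
    define h where "h r = r powr (- (Q / p))" for r :: real
    have [measurable]: "h \<in> borel_measurable borel" unfolding h_def by measurable
    define f0 where "f0 r y = (if h r < f y then f y else 0)" for r y
    define f1 where "f1 r y = (if f y \<le> h r then f y else 0)" for r y
    \<comment> \<open>Chebyshev's inequality: on the level set \<open>r powr \<kappa>\<close> times
      \<open>G0 + G1\<close> is at least 1, so it dominates the indicator.\<close>
    have weak: "(\<integral>\<^sup>+x. ennreal (radius x powr (- b)) * indicator {x. ennreal (c * r powr (- \<kappa>)) < I x} x \<partial>M)
      \<le> ennreal (D0 * r powr (e0 + (Q - b))) * (\<integral>\<^sup>+y. ennreal (f0 r y powr s0) \<partial>M)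
        + ennreal (D1 * r powr (e1 + (Q - b))) * (\<integral>\<^sup>+y. ennreal (f1 r y powr s1) \<partial>M)"
      if r: "r > 0" for r
    proof -
      have [measurable]: "f0 r \<in> borel_measurable M" "f1 r \<in> borel_measurable M"
        unfolding f0_def f1_def by measurable
      have nn: "0 \<le> f0 r y" "0 \<le> f1 r y" for y using f(1) by (auto simp: f0_def f1_def)
      obtain G0 where [measurable]: "G0 \<in> borel_measurable M"
        and G0: "\<And>x. (\<integral>\<^sup>+y. ennreal (f0 r y * d x y powr (a - Q)) * indicator {y. d x y < r} y \<partial>M)
            \<le> G0 x + ennreal (C0 * r powr (- \<kappa>))"
          "(\<integral>\<^sup>+x. G0 x * ennreal (radius x powr (- b)) \<partial>M)
            \<le> ennreal (D0 * r powr (e0 + (Q - b) - \<kappa>)) * (\<integral>\<^sup>+y. ennreal (f0 r y powr s0) \<partial>M)"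
        using C0(3)[of "f0 r" r] nn r by auto
      obtain G1 where [measurable]: "G1 \<in> borel_measurable M"
        and G1: "\<And>x. (\<integral>\<^sup>+y. ennreal (f1 r y * d x y powr (a - Q)) * indicator {y. d x y < r} y \<partial>M)
            \<le> G1 x + ennreal (C1 * r powr (- \<kappa>))"
          "(\<integral>\<^sup>+x. G1 x * ennreal (radius x powr (- b)) \<partial>M)
            \<le> ennreal (D1 * r powr (e1 + (Q - b) - \<kappa>)) * (\<integral>\<^sup>+y. ennreal (f1 r y powr s1) \<partial>M)"
        using C1(3)[of "f1 r" r] nn r by auto
      define R where "R = r powr (- \<kappa>)"
      have R: "R > 0" using r by (simp add: R_def)
      have I_le: "I x \<le> (G0 x + G1 x) + ennreal ((Cf + C0 + C1) * R)" for x
      proof -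
        have [measurable]: "{y. r \<le> d x y} \<in> sets M" by (rule sets_Collect_M) measurable
        have "I x = (\<integral>\<^sup>+y. (ennreal (f0 r y * d x y powr (a - Q)) * indicator {y. d x y < r} y
            + ennreal (f1 r y * d x y powr (a - Q)) * indicator {y. d x y < r} y)
            + ennreal (f y * d x y powr (a - Q)) * indicator {y. r \<le> d x y} y \<partial>M)"
          unfolding I_def potential_def by (intro nn_integral_cong) (auto simp: f0_def f1_def indicator_def)
        also have "\<dots> = ((\<integral>\<^sup>+y. ennreal (f0 r y * d x y powr (a - Q)) * indicator {y. d x y < r} y \<partial>M)
            + (\<integral>\<^sup>+y. ennreal (f1 r y * d x y powr (a - Q)) * indicator {y. d x y < r} y \<partial>M))
            + (\<integral>\<^sup>+y. ennreal (f y * d x y powr (a - Q)) * indicator {y. r \<le> d x y} y \<partial>M)"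
          by (simp add: nn_integral_add)
        also have "\<dots> \<le> ((G0 x + ennreal (C0 * R)) + (G1 x + ennreal (C1 * R))) + ennreal (Cf * R)"
          unfolding R_def by (intro add_mono G0(1) G1(1) Cf(2) f r) measurable
        also have "\<dots> = (G0 x + G1 x) + (ennreal (C0 * R) + ennreal (C1 * R) + ennreal (Cf * R))"
          by (simp add: ac_simps)
        also have "ennreal (C0 * R) + ennreal (C1 * R) + ennreal (Cf * R) = ennreal ((Cf + C0 + C1) * R)"
          using C0(1) C1(1) Cf(1) R by (simp add: ennreal_plus[symmetric] algebra_simps del: ennreal_plus)
        finally show ?thesis .
      qed
      have "R \<noteq> 0" using R by simp
      have "(\<integral>\<^sup>+x. ennreal (radius x powr (- b)) * indicator {x. ennreal (c * r powr (- \<kappa>)) < I x} x \<partial>M)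
        \<le> (\<integral>\<^sup>+x. ennreal (r powr \<kappa>) * (G0 x * ennreal (radius x powr (- b)))
            + ennreal (r powr \<kappa>) * (G1 x * ennreal (radius x powr (- b))) \<partial>M)"
      proof (intro nn_integral_mono)
        fix x
        show "ennreal (radius x powr (- b)) * indicator {x. ennreal (c * r powr (- \<kappa>)) < I x} x
          \<le> ennreal (r powr \<kappa>) * (G0 x * ennreal (radius x powr (- b)))
            + ennreal (r powr \<kappa>) * (G1 x * ennreal (radius x powr (- b)))"
        proof (cases "ennreal (c * r powr (- \<kappa>)) < I x")
          case True
          have "ennreal R \<le> G0 x + G1 x"
          proof (rule ccontr)
            assume "\<not> ennreal R \<le> G0 x + G1 x"
            then have "I x \<le> ennreal R + ennreal ((Cf + C0 + C1) * R)"
              using I_le[of x] by (meson add_right_mono less_imp_le not_le order_trans)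
            also have "\<dots> = ennreal (c * r powr (- \<kappa>))"
              using C0(1) C1(1) Cf(1) R
              by (simp add: ennreal_plus[symmetric] c_def R_def algebra_simps del: ennreal_plus)
            finally show False using True by simp
          qed
          then have "ennreal (r powr \<kappa>) * ennreal R \<le> ennreal (r powr \<kappa>) * (G0 x + G1 x)"
            by (rule mult_left_mono) simp
          moreover have "ennreal (r powr \<kappa>) * ennreal R = 1"
            using r by (simp add: R_def ennreal_mult[symmetric] powr_add[symmetric])
          ultimately have "1 * ennreal (radius x powr (- b)) \<le> ennreal (r powr \<kappa>) * (G0 x + G1 x) * ennreal (radius x powr (- b))"
            by (intro mult_right_mono) auto
          then show ?thesis using True by (simp add: algebra_simps)
        qed simp
      qed
      also have "\<dots> = ennreal (r powr \<kappa>) * (\<integral>\<^sup>+x. G0 x * ennreal (radius x powr (- b)) \<partial>M)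
          + ennreal (r powr \<kappa>) * (\<integral>\<^sup>+x. G1 x * ennreal (radius x powr (- b)) \<partial>M)"
        by (simp add: nn_integral_add nn_integral_cmult)
      also have "\<dots> \<le> ennreal (r powr \<kappa>) * (ennreal (D0 * r powr (e0 + (Q - b) - \<kappa>)) * (\<integral>\<^sup>+y. ennreal (f0 r y powr s0) \<partial>M))
          + ennreal (r powr \<kappa>) * (ennreal (D1 * r powr (e1 + (Q - b) - \<kappa>)) * (\<integral>\<^sup>+y. ennreal (f1 r y powr s1) \<partial>M))"
        by (intro add_mono mult_left_mono G0(2) G1(2)) auto
      also have "\<dots> = ennreal (D0 * r powr (e0 + (Q - b))) * (\<integral>\<^sup>+y. ennreal (f0 r y powr s0) \<partial>M)
          + ennreal (D1 * r powr (e1 + (Q - b))) * (\<integral>\<^sup>+y. ennreal (f1 r y powr s1) \<partial>M)"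
      proof -
        have "ennreal (r powr \<kappa>) * (ennreal (D * r powr (e + (Q - b) - \<kappa>)) * J) = ennreal (D * r powr (e + (Q - b))) * J"
          if "D \<ge> 0" for D e J
        proof -
          have "r powr \<kappa> * (D * r powr (e + (Q - b) - \<kappa>)) = D * (r powr \<kappa> * r powr (e + (Q - b) - \<kappa>))"
            by (simp only: mult.left_commute)
          also have "r powr \<kappa> * r powr (e + (Q - b) - \<kappa>) = r powr (e + (Q - b))"
            by (simp add: powr_add[symmetric])
          finally have "ennreal (r powr \<kappa>) * ennreal (D * r powr (e + (Q - b) - \<kappa>)) = ennreal (D * r powr (e + (Q - b)))"
            using that by (simp only: ennreal_mult[symmetric] powr_ge_zero mult_nonneg_nonneg)
          then show ?thesis by (simp only: mult.assoc[symmetric])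
        qed
        then show ?thesis using C0(2) C1(2) by simp
      qed
      finally show ?thesis .
    qed
    \<comment> \<open>Layer cake parametrised by the scale instead of the height: at scale
      \<open>r\<close> the height is \<open>c * r powr (- \<kappa>)\<close>, and since
      \<open>Q - b = \<kappa> * q\<close>, the density \<open>r powr (- (Q - b) - 1)\<close>
      corresponds to a \<open>q\<close>-th power of the height.\<close>
    let ?\<Phi> = "\<lambda>x. \<integral>\<^sup>+r. ennreal B * (ennreal (r powr (- (Q - b) - 1)) * indicator {0<..} r)
        * (ennreal (radius x powr (- b)) * indicator {x. ennreal (c * r powr (- \<kappa>)) < I x} x) \<partial>lborel"
    have [measurable]: "?\<Phi> \<in> borel_measurable M"
      by (intro sigma_finite_measure.borel_measurable_nn_integral[OF sigma_finite_lborel]) measurable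
    have lower: "ennreal (w powr q * radius x powr (- b)) \<le> ?\<Phi> x" if w: "0 \<le> w" "ennreal w \<le> I x" for x w
    proof (cases "w = 0")
      case False
      then have w0: "w > 0" using w by simp
      \<comment> \<open>The scale whose height is \<open>w\<close>. Starting at
        \<open>2 * \<rho>\<close> makes the inequality defining the level set strict.\<close>
      define \<rho> where "\<rho> = (c / w) powr (1 / \<kappa>)"
      have \<rho>: "\<rho> > 0" using c w0 by (simp add: \<rho>_def)
      have level: "ennreal (c * r powr (- \<kappa>)) < I x" if "2 * \<rho> \<le> r" for r
      proof -
        have "r powr (- \<kappa>) < \<rho> powr (- \<kappa>)"
          using that \<rho> \<kappa> by (intro powr_less_mono2_neg) auto
        then have "c * r powr (- \<kappa>) < c * \<rho> powr (- \<kappa>)" using c by simp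
        also have "\<dots> = w" using c w0 \<kappa> by (simp add: \<rho>_def powr_powr powr_minus field_simps)
        finally have "ennreal (c * r powr (- \<kappa>)) < ennreal w" using w0 by (intro ennreal_lessI)
        then show ?thesis using w(2) by simp
      qed
      have "ennreal (w powr q * radius x powr (- b))
        = ennreal B * ennreal (radius x powr (- b)) * ennreal ((2 * \<rho>) powr (- (Q - b)) / (Q - b))"
      proof -
        have "\<rho> powr (- (Q - b)) = (c / w) powr (- q)"
          using \<kappa> by (simp add: \<rho>_def powr_powr Qb)
        also have "\<dots> = w powr q / c powr q"
          using c w0 by (simp add: powr_minus powr_divide)
        finally have "B * ((2 * \<rho>) powr (- (Q - b)) / (Q - b)) = (2 powr (Q - b) * 2 powr (- (Q - b))) * w powr q"
          using assms c \<rho> by (simp add: B_def powr_mult)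
        also have "2 powr (Q - b) * 2 powr (- (Q - b)) = (1 :: real)"
          by (simp only: powr_add[symmetric]) simp
        finally have "w powr q = B * ((2 * \<rho>) powr (- (Q - b)) / (Q - b))" by simp
        then show ?thesis using B assms by (simp add: ennreal_mult[symmetric] mult_ac)
      qed
      also have "\<dots> = ennreal B * ennreal (radius x powr (- b))
          * (\<integral>\<^sup>+r. ennreal (r powr (- (Q - b) - 1)) * indicator {2 * \<rho>..} r \<partial>lborel)"
        using nn_integral_powr_to_inf[of "Q - b" "2 * \<rho>"] assms \<rho> by simp
      also have "\<dots> = (\<integral>\<^sup>+r. ennreal B * ennreal (radius x powr (- b))
          * (ennreal (r powr (- (Q - b) - 1)) * indicator {2 * \<rho>..} r) \<partial>lborel)"
        by (rule nn_integral_cmult[symmetric]) measurable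
      also have "\<dots> \<le> ?\<Phi> x"
        using \<rho> level by (intro nn_integral_mono) (auto simp: indicator_def mult_ac)
      finally show ?thesis .
    qed simp
    have meas0: "(\<lambda>z. f0 (snd z) (fst z)) \<in> borel_measurable (M \<Otimes>\<^sub>M borel)"
      and meas1: "(\<lambda>z. f1 (snd z) (fst z)) \<in> borel_measurable (M \<Otimes>\<^sub>M borel)"
      unfolding f0_def f1_def by measurable
    have inner0: "(\<integral>\<^sup>+r. ennreal (r powr (e0 - 1)) * indicator {0<..} r * ennreal (f0 r y powr s0) \<partial>lborel)
        \<le> ennreal j0 * ennreal (f y powr p)" for y
    proof (cases "f y = 0")
      case True
      then have "f0 r y = 0" for r by (simp add: f0_def)
      then show ?thesis by simp
    next
      case False
      then have fy: "f y > 0" using f(1)[of y] by simp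
      \<comment> \<open>The scale at which the truncation height passes \<open>f y\<close>:
        \<open>f0 r y\<close> vanishes for smaller \<open>r\<close>. The exponent \<open>e0\<close>
        is such that \<open>f y powr s0 * \<rho> powr e0 = f y powr p\<close>.\<close>
      define \<rho> where "\<rho> = f y powr (- (p / Q))"
      have \<rho>: "\<rho> > 0" using fy by (simp add: \<rho>_def)
      have "(\<integral>\<^sup>+r. ennreal (r powr (e0 - 1)) * indicator {0<..} r * ennreal (f0 r y powr s0) \<partial>lborel)
        \<le> (\<integral>\<^sup>+r. ennreal (f y powr s0) * (ennreal (r powr (- (- e0) - 1)) * indicator {\<rho>..} r) \<partial>lborel)"
      proof (intro nn_integral_mono)
        fix r :: real
        show "ennreal (r powr (e0 - 1)) * indicator {0<..} r * ennreal (f0 r y powr s0)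
          \<le> ennreal (f y powr s0) * (ennreal (r powr (- (- e0) - 1)) * indicator {\<rho>..} r)"
        proof (cases "0 < r \<and> h r < f y")
          case True
          then have "f y powr (- (p / Q)) \<le> h r powr (- (p / Q))"
            using assms Q_pos by (intro powr_mono2') (auto simp: h_def)
          also have "\<dots> = r" using True assms Q_pos by (simp add: h_def powr_powr)
          finally show ?thesis using True by (simp add: \<rho>_def f0_def mult.commute)
        qed (auto simp: f0_def)
      qed
      also have "\<dots> = ennreal (f y powr s0) * ennreal (\<rho> powr (- (- e0)) / (- e0))"
        using nn_integral_powr_to_inf[of "- e0" \<rho>] e0 \<rho> by (simp add: nn_integral_cmult)
      also have "\<dots> = ennreal ((f y powr s0 * \<rho> powr e0) * j0)"
      proof -
        have *: "\<rho> powr (- (- e0)) / (- e0) = \<rho> powr e0 * j0" by (simp add: j0_def)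
        show ?thesis unfolding * using j by (simp add: ennreal_mult[symmetric] mult.assoc)
      qed
      also have "f y powr s0 * \<rho> powr e0 = f y powr p"
        using assms Q_pos by (simp add: \<rho>_def e0_def powr_powr powr_add[symmetric])
      finally show ?thesis using j by (simp add: ennreal_mult[symmetric] mult.commute)
    qed
    have inner1: "(\<integral>\<^sup>+r. ennreal (r powr (e1 - 1)) * indicator {0<..} r * ennreal (f1 r y powr s1) \<partial>lborel)
        \<le> ennreal j1 * ennreal (f y powr p)" for y
    proof (cases "f y = 0")
      case True
      then have "f1 r y = 0" for r by (simp add: f1_def)
      then show ?thesis by simp
    next
      case False
      then have fy: "f y > 0" using f(1)[of y] by simp
      \<comment> \<open>The same scale; now \<open>f1 r y\<close> vanishes for larger
        \<open>r\<close>, and \<open>e1 > 0\<close> gives convergence at 0.\<close>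
      define \<rho> where "\<rho> = f y powr (- (p / Q))"
      have \<rho>: "\<rho> > 0" using fy by (simp add: \<rho>_def)
      have "(\<integral>\<^sup>+r. ennreal (r powr (e1 - 1)) * indicator {0<..} r * ennreal (f1 r y powr s1) \<partial>lborel)
        \<le> (\<integral>\<^sup>+r. ennreal (f y powr s1) * (ennreal (r powr (e1 - 1)) * indicator {0..\<rho>} r) \<partial>lborel)"
      proof (intro nn_integral_mono)
        fix r :: real
        show "ennreal (r powr (e1 - 1)) * indicator {0<..} r * ennreal (f1 r y powr s1)
          \<le> ennreal (f y powr s1) * (ennreal (r powr (e1 - 1)) * indicator {0..\<rho>} r)"
        proof (cases "0 < r \<and> f y \<le> h r")
          case True
          have "r = h r powr (- (p / Q))" using True assms Q_pos by (simp add: h_def powr_powr)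
          also have "\<dots> \<le> f y powr (- (p / Q))"
            using True fy assms Q_pos by (intro powr_mono2') auto
          finally show ?thesis using True by (simp add: \<rho>_def f1_def mult.commute)
        qed (auto simp: f1_def)
      qed
      also have "\<dots> = ennreal (f y powr s1) * ennreal (\<rho> powr e1 / e1)"
        using nn_integral_powr_0_to[of e1 \<rho>] e1 \<rho> by (simp add: nn_integral_cmult)
      also have "\<dots> = ennreal ((f y powr s1 * \<rho> powr e1) * j1)"
        using e1 by (simp add: ennreal_mult[symmetric] j1_def)
      also have "f y powr s1 * \<rho> powr e1 = f y powr p"
        using assms Q_pos by (simp add: \<rho>_def e1_def powr_powr powr_add[symmetric])
      finally show ?thesis using j by (simp add: ennreal_mult[symmetric] mult.commute)
    qed
    have swap: "(\<integral>\<^sup>+r. ennreal (r powr (e - 1)) * indicator {0<..} r * (\<integral>\<^sup>+y. ennreal (g r y powr s) \<partial>M) \<partial>lborel)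
        \<le> ennreal E"
      if [measurable]: "(\<lambda>z. g (snd z) (fst z)) \<in> borel_measurable (M \<Otimes>\<^sub>M borel)" and "E \<ge> 0"
        and inner: "\<And>y. (\<integral>\<^sup>+r. ennreal (r powr (e - 1)) * indicator {0<..} r * ennreal (g r y powr s) \<partial>lborel) \<le> ennreal E * ennreal (f y powr p)"
      for g :: "real \<Rightarrow> 'a \<Rightarrow> real" and e s E
    proof -
      have [measurable]: "(\<lambda>y. g r y) \<in> borel_measurable M" for r
        using measurable_compose[OF measurable_Pair[OF measurable_ident measurable_const[of r borel]] that(1)] by simp
      have joint: "(\<lambda>(y, r). ennreal (r powr (e - 1)) * indicator {0<..} r * ennreal (g r y powr s)) \<in> borel_measurable (M \<Otimes>\<^sub>M lborel)"
        using that(1) unfolding case_prod_beta by measurable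
      have "(\<integral>\<^sup>+r. ennreal (r powr (e - 1)) * indicator {0<..} r * (\<integral>\<^sup>+y. ennreal (g r y powr s) \<partial>M) \<partial>lborel)
        = (\<integral>\<^sup>+r. (\<integral>\<^sup>+y. ennreal (r powr (e - 1)) * indicator {0<..} r * ennreal (g r y powr s) \<partial>M) \<partial>lborel)"
        by (rule nn_integral_cong, rule nn_integral_cmult[symmetric], measurable)
      also have "\<dots> = (\<integral>\<^sup>+y. (\<integral>\<^sup>+r. ennreal (r powr (e - 1)) * indicator {0<..} r * ennreal (g r y powr s) \<partial>lborel) \<partial>M)"
        by (rule pair_sigma_finite.Fubini'[OF pair_M_lborel joint])
      also have "\<dots> \<le> (\<integral>\<^sup>+y. ennreal E * ennreal (f y powr p) \<partial>M)"
        by (intro nn_integral_mono inner)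
      also have "\<dots> = ennreal E * (\<integral>\<^sup>+y. ennreal (f y powr p) \<partial>M)" by (rule nn_integral_cmult) measurable
      also have "\<dots> \<le> ennreal E" using mult_left_mono[OF f(2), of "ennreal E"] by simp
      finally show ?thesis .
    qed
    have mI: "(\<lambda>r. \<integral>\<^sup>+y. ennreal (f0 r y powr s0) \<partial>M) \<in> borel_measurable lborel"
      "(\<lambda>r. \<integral>\<^sup>+y. ennreal (f1 r y powr s1) \<partial>M) \<in> borel_measurable lborel"
      unfolding f0_def f1_def by measurable
    have "(\<integral>\<^sup>+x. ?\<Phi> x \<partial>M) = (\<integral>\<^sup>+r. (\<integral>\<^sup>+x. ennreal B * (ennreal (r powr (- (Q - b) - 1)) * indicator {0<..} r)
        * (ennreal (radius x powr (- b)) * indicator {x. ennreal (c * r powr (- \<kappa>)) < I x} x) \<partial>M) \<partial>lborel)"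
      by (rule pair_sigma_finite.Fubini'[OF pair_M_lborel, symmetric]) measurable
    also have "\<dots> = (\<integral>\<^sup>+r. ennreal B * (ennreal (r powr (- (Q - b) - 1)) * indicator {0<..} r)
        * (\<integral>\<^sup>+x. ennreal (radius x powr (- b)) * indicator {x. ennreal (c * r powr (- \<kappa>)) < I x} x \<partial>M) \<partial>lborel)"
    proof (intro nn_integral_cong nn_integral_cmult)
      fix r
      have [measurable]: "{x. ennreal (c * r powr (- \<kappa>)) < I x} \<in> sets M" by (rule sets_Collect_M) measurable
      show "(\<lambda>x. ennreal (radius x powr (- b)) * indicator {x. ennreal (c * r powr (- \<kappa>)) < I x} x) \<in> borel_measurable M"
        by measurable
    qed
    also have "\<dots> \<le> (\<integral>\<^sup>+r. ennreal (B * D0) * (ennreal (r powr (e0 - 1)) * indicator {0<..} r * (\<integral>\<^sup>+y. ennreal (f0 r y powr s0) \<partial>M))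
        + ennreal (B * D1) * (ennreal (r powr (e1 - 1)) * indicator {0<..} r * (\<integral>\<^sup>+y. ennreal (f1 r y powr s1) \<partial>M)) \<partial>lborel)"
    proof (intro nn_integral_mono)
      fix r :: real
      let ?J0 = "\<integral>\<^sup>+y. ennreal (f0 r y powr s0) \<partial>M" and ?J1 = "\<integral>\<^sup>+y. ennreal (f1 r y powr s1) \<partial>M"
      show "ennreal B * (ennreal (r powr (- (Q - b) - 1)) * indicator {0<..} r)
        * (\<integral>\<^sup>+x. ennreal (radius x powr (- b)) * indicator {x. ennreal (c * r powr (- \<kappa>)) < I x} x \<partial>M)
        \<le> ennreal (B * D0) * (ennreal (r powr (e0 - 1)) * indicator {0<..} r * ?J0)
        + ennreal (B * D1) * (ennreal (r powr (e1 - 1)) * indicator {0<..} r * ?J1)"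
      proof (cases "r > 0")
        case True
        have "ennreal B * ennreal (r powr (- (Q - b) - 1))
          * (\<integral>\<^sup>+x. ennreal (radius x powr (- b)) * indicator {x. ennreal (c * r powr (- \<kappa>)) < I x} x \<partial>M)
          \<le> ennreal B * ennreal (r powr (- (Q - b) - 1))
            * (ennreal (D0 * r powr (e0 + (Q - b))) * ?J0 + ennreal (D1 * r powr (e1 + (Q - b))) * ?J1)"
          by (intro mult_left_mono weak True) simp
        also have "\<dots> = ennreal (B * D0 * (r powr (- (Q - b) - 1) * r powr (e0 + (Q - b)))) * ?J0
            + ennreal (B * D1 * (r powr (- (Q - b) - 1) * r powr (e1 + (Q - b)))) * ?J1"
          using B C0(2) C1(2) by (simp add: ennreal_mult distrib_left mult_ac)
        also have "r powr (- (Q - b) - 1) * r powr (e0 + (Q - b)) = r powr (e0 - 1)"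
          by (simp add: powr_add[symmetric])
        also have "r powr (- (Q - b) - 1) * r powr (e1 + (Q - b)) = r powr (e1 - 1)"
          by (simp add: powr_add[symmetric])
        finally show ?thesis using True B C0(2) C1(2) by (simp add: ennreal_mult mult.assoc)
      qed simp
    qed
    also have "\<dots> = ennreal (B * D0) * (\<integral>\<^sup>+r. ennreal (r powr (e0 - 1)) * indicator {0<..} r * (\<integral>\<^sup>+y. ennreal (f0 r y powr s0) \<partial>M) \<partial>lborel)
        + ennreal (B * D1) * (\<integral>\<^sup>+r. ennreal (r powr (e1 - 1)) * indicator {0<..} r * (\<integral>\<^sup>+y. ennreal (f1 r y powr s1) \<partial>M) \<partial>lborel)"
      using mI by (simp add: nn_integral_add nn_integral_cmult)
    also have "\<dots> \<le> ennreal (B * D0) * ennreal j0 + ennreal (B * D1) * ennreal j1"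
      using j by (intro add_mono mult_left_mono swap meas0 meas1 inner0 inner1) auto
    also have "\<dots> = ennreal C"
      using B C0(2) C1(2) j
      by (simp add: C_def ennreal_mult[symmetric] ennreal_plus[symmetric] del: ennreal_plus)
    finally have "(\<integral>\<^sup>+x. ?\<Phi> x \<partial>M) \<le> ennreal C" .
    with lower show ?thesis by (intro bexI[of _ ?\<Phi>]) (auto simp: I_def)
  qed
  with \<open>C \<ge> 0\<close> show ?thesis by blast
qed

end

lemma (in quasi_metric_measure) potential_bound:
  assumes "1 < p" and "p \<le> q" and "0 < a" and "a < Q / p" and "0 \<le> b" and "b < Q"
    and exponents: "(Q - b) / q = Q / p - a"
  shows "\<exists>C\<ge>0. \<forall>f \<in> borel_measurable M. (\<forall>y. 0 \<le> f y) \<longrightarrow> (\<integral>\<^sup>+y. ennreal (f y powr p) \<partial>M) \<le> 1 \<longrightarrow>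
    (\<exists>\<Phi> \<in> borel_measurable M. (\<integral>\<^sup>+x. \<Phi> x \<partial>M) \<le> ennreal C \<and>
      (\<forall>x w. 0 \<le> w \<longrightarrow> ennreal w \<le> potential a f x \<longrightarrow> ennreal (w powr q * radius x powr (- b)) \<le> \<Phi> x))"
proof (cases "p = q")
  case True
  then have "b = a * p" using exponents assms by (simp add: field_simps)
  with potential_bound_diagonal[of p a] assms show ?thesis by (simp add: True)
next
  case False
  then show ?thesis using assms by (intro potential_bound_off_diagonal) auto
qed

section \<open>The convolution inequality\<close>

lemma completion_ex_borel_measurable_complex:
  fixes g :: "'a \<Rightarrow> complex"
  assumes g: "g \<in> borel_measurable (completion M)"
  shows "\<exists>g'\<in>borel_measurable M. AE x in M. g x = g' x"
proof -
  have "(\<lambda>x. Re (g x)) \<in> borel_measurable (completion M)" "(\<lambda>x. Im (g x)) \<in> borel_measurable (completion M)"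
    using g by measurable
  then obtain u v where [measurable]: "u \<in> borel_measurable M" "v \<in> borel_measurable M"
    and uv: "AE x in M. Re (g x) = u x" "AE x in M. Im (g x) = v x"
    using completion_ex_borel_measurable_real by metis
  have "(\<lambda>x. Complex (u x) (v x)) \<in> borel_measurable M"
    unfolding Complex_eq by measurable
  moreover have "AE x in M. g x = Complex (u x) (v x)"
    using uv by eventually_elim (simp add: complex_eq_iff)
  ultimately show ?thesis by (intro bexI[of _ "\<lambda>x. Complex (u x) (v x)"])
qed

text \<open>Completeness makes preimages differing by a null set measurable together. Nothing is
  presupposed about \<open>f\<close>: the convolution integrand contains a Lebesgue measurable
  kernel composed with the group law, and it inherits measurability from a Borel version in this
  way.\<close>

lemma borel_measurable_completion_cong_AE:
  fixes f g :: "'a \<Rightarrow> 'b::topological_space"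
  assumes g: "g \<in> borel_measurable (completion M)" and eq: "AE x in M. f x = g x"
  shows "f \<in> borel_measurable (completion M)"
proof (rule measurableI)
  fix S :: "'b set" assume "S \<in> sets borel"
  then have sets: "g -` S \<inter> space (completion M) \<in> sets (completion M)" by (rule measurable_sets[OF g])
  have "AE x in completion M. x \<in> g -` S \<inter> space (completion M) \<longleftrightarrow> x \<in> f -` S \<inter> space (completion M)"
    using AE_completion[OF eq] by eventually_elim simp
  from this sets show "f -` S \<inter> space (completion M) \<in> sets (completion M)"
    by (rule completion.in_sets_AE) (rule Int_lower2)
qed simp

lemma distr_lborel_uminus: "distr lborel borel uminus = (lborel :: 'a::euclidean_space measure)"
  by (subst lborel_affine[of "- 1" 0]) (simp_all add: density_1 one_ennreal_def[symmetric])

context quasi_normed_homogeneous_group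
begin

text \<open>Balls of the left-invariant distance are left translates of quasi-norm balls, so left
  invariance of Lebesgue measure gives them all the same volume; symmetry is invariance of
  \<open>N\<close> under inversion.\<close>

lemma quasi_metric_measure_left_invariant:
  assumes "homogeneous_dimension A > 0"
  shows "\<exists>V K. quasi_metric_measure lborel (\<lambda>x y. N (gmul (- x) y)) (homogeneous_dimension A) V K"
proof -
  obtain K where K: "K > 0" "\<And>x y. N (gmul x y) \<le> K * (N x + N y)"
    using quasi_triangle by blast
  obtain V where V: "V \<ge> 0" "\<And>r. r > 0 \<Longrightarrow> emeasure lborel {x. N x < r} = ennreal (V * r powr homogeneous_dimension A)"
    using emeasure_quasi_norm_ball by blast
  have "quasi_metric_measure lborel (\<lambda>x y. N (gmul (- x) y)) (homogeneous_dimension A) V K"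
  proof
    show "space lborel = (UNIV :: (real ^ 'n) set)" by simp
    have "continuous_on UNIV (\<lambda>z. N (gmul (- fst z) (snd z)))"
      by (rule continuous_on_compose2[OF continuous_on_quasi_norm[of UNIV]],
          rule continuous_on_compose2[OF mult_continuous, of UNIV "\<lambda>z. (- fst z, snd z)", simplified])
        (auto intro!: continuous_intros)
    then have "(\<lambda>z. N (gmul (- fst z) (snd z))) \<in> borel_measurable borel"
      by (rule borel_measurable_continuous_onI)
    then show "(\<lambda>z. N (gmul (- fst z) (snd z))) \<in> borel_measurable (lborel \<Otimes>\<^sub>M lborel)"
      by (simp add: borel_prod[symmetric] cong: measurable_cong_sets)
    show "0 \<le> N (gmul (- x) y)" for x y by (rule quasi_norm_nonneg)
    show "N (gmul (- x) y) = N (gmul (- y) x)" for x y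
      using quasi_norm_uminus[of "gmul (- x) y"] by (simp add: uminus_mult)
    show "N (gmul (- x) z) \<le> K * (N (gmul (- x) y) + N (gmul (- y) z))" for x y z
      using K(2)[of "gmul (- x) y" "gmul (- y) z"] by (simp add: local.assoc)
    show "emeasure lborel {y. N (gmul (- x) y) < r} \<le> ennreal (V * r powr homogeneous_dimension A)"
      if "r > 0" for r x
    proof -
      have "{x. N x < r} \<in> sets borel"
        by (intro borel_open open_Collect_less continuous_on_quasi_norm continuous_on_const)
      then have "emeasure lborel (gmul (- x) -` {x. N x < r}) = emeasure lborel {x. N x < r}"
        by (rule emeasure_lborel_left_translation)
      then show ?thesis using V(2)[OF that] by (simp add: vimage_def)
    qed
  qed (use K V assms in \<open>auto intro: sigma_finite_lborel\<close>)
  then show ?thesis by blast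
qed

text \<open>The map sending \<open>y\<close> to \<open>gmul (- y) x\<close> is left translation by
  \<open>- x\<close> followed by negation; both preserve Lebesgue measure, so null sets pull back to
  null sets.\<close>

lemma AE_lborel_convolution_argument:
  assumes "AE z in lborel. P z"
  shows "AE y in lborel. P (gmul (- y) x)"
proof -
  have [measurable]: "gmul (- x) \<in> borel \<rightarrow>\<^sub>M borel"
    by (rule borel_measurable_continuous_onI[OF continuous_on_mult_left])
  have "AE z in distr lborel borel uminus. P z"
    unfolding distr_lborel_uminus by (rule assms)
  then have "AE z in lborel. P (- z)" by (rule AE_distrD[rotated]) measurable
  then have "AE z in distr lborel borel (gmul (- x)). P (- z)"
    unfolding distr_lborel_left_translation .
  then have "AE y in lborel. P (- gmul (- x) y)" by (rule AE_distrD[rotated]) measurable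
  then show ?thesis by (simp add: uminus_mult)
qed

lemma convolution_potential_bound:
  fixes C2 p q a b :: real
  defines "Q \<equiv> homogeneous_dimension A"
  assumes "1 < p" and "p \<le> q" and "0 < a" and "a < Q / p" and "0 \<le> b" and "b < Q"
    and exponents: "(Q - b) / q = Q / p - a" and "C2 > 0"
  shows "\<exists>C1>0. \<forall>T \<in> borel_measurable (lebesgue_on (- {0})).
    (\<forall>x. x \<noteq> 0 \<longrightarrow> norm (T x) \<le> C2 * N x powr (a - Q)) \<longrightarrow>
    (\<forall>f \<in> Lp_space p.
      (AE x in lebesgue. convolution_exists_at gmul ginv f T x) \<and>
      (\<lambda>x. convolution gmul ginv f T x / of_real (N x powr (b / q))) \<in> Lp_space q \<and>
      Lp_norm q (\<lambda>x. convolution gmul ginv f T x / of_real (N x powr (b / q)))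
        \<le> C1 * Lp_norm p f)"
proof -
  have Q: "Q > 0" using assms by simp
  then obtain V K where "quasi_metric_measure lborel (\<lambda>x y. N (gmul (- x) y)) Q V K"
    using quasi_metric_measure_left_invariant unfolding Q_def by blast
  then interpret qm: quasi_metric_measure lborel "\<lambda>x y. N (gmul (- x) y)" 0 Q V K .
  have radius: "N (gmul (- 0) x) = N x" for x by simp
  obtain C where C: "C \<ge> 0" "\<And>f. f \<in> borel_measurable lborel \<Longrightarrow> (\<And>y. 0 \<le> f y) \<Longrightarrow>
      (\<integral>\<^sup>+y. ennreal (f y powr p) \<partial>lborel) \<le> 1 \<Longrightarrow>
      \<exists>\<Phi> \<in> borel_measurable lborel. (\<integral>\<^sup>+x. \<Phi> x \<partial>lborel) \<le> ennreal C \<and>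
        (\<forall>x w. 0 \<le> w \<longrightarrow> ennreal w \<le> qm.potential a f x \<longrightarrow> ennreal (w powr q * N x powr (- b)) \<le> \<Phi> x)"
    using qm.potential_bound[OF assms(2-8)] unfolding radius by blast
  \<comment> \<open>The added 1 guarantees a positive constant even for
    \<open>C = 0\<close>.\<close>
  define C1 where "C1 = C2 * (C + 1) powr (1 / q)"
  have "C1 > 0" using C(1) \<open>C2 > 0\<close> by (simp add: C1_def)
  have [measurable]: "N \<in> borel_measurable borel"
    by (rule borel_measurable_continuous_onI[OF continuous_on_quasi_norm])
  have q: "q > 1" using assms by simp
  have "(AE x in lebesgue. convolution_exists_at gmul ginv f T x) \<and>
      (\<lambda>x. convolution gmul ginv f T x / of_real (N x powr (b / q))) \<in> Lp_space q \<and>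
      Lp_norm q (\<lambda>x. convolution gmul ginv f T x / of_real (N x powr (b / q))) \<le> C1 * Lp_norm p f"
    if T: "T \<in> borel_measurable (lebesgue_on (- {0}))"
      and T_bound: "\<And>x. x \<noteq> 0 \<Longrightarrow> norm (T x) \<le> C2 * N x powr (a - Q)"
      and f: "f \<in> Lp_space p" for T f
  proof -
    have f_meas: "f \<in> borel_measurable lebesgue" and f_int: "integrable lebesgue (\<lambda>x. norm (f x) powr p)"
      using f by (auto simp: Lp_space_def)
    \<comment> \<open>Measurability on the product and the potential estimate are available for
      Borel functions, so \<open>f\<close> and \<open>T\<close> are replaced by Borel versions; for
      each \<open>x\<close> the integrand changes only on a null set of \<open>y\<close>.\<close>
    obtain f' where [measurable]: "f' \<in> borel_measurable borel" and f': "AE y in lborel. f y = f' y"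
      using completion_ex_borel_measurable_complex[OF f_meas] by auto
    obtain T' where [measurable]: "T' \<in> borel_measurable borel"
      and T': "AE z in lborel. T z = T' z" and T'_bound: "\<And>z. norm (T' z) \<le> C2 * N z powr (a - Q)"
    proof -
      have "(\<lambda>z. if z \<in> - {0} then T z else 0) \<in> borel_measurable lebesgue"
        using T by (subst borel_measurable_if) auto
      from completion_ex_borel_measurable_complex[OF this]
      obtain U where [measurable]: "U \<in> borel_measurable borel"
        and U: "AE z in lborel. (if z \<in> - {0} then T z else 0) = U z" by auto
      show thesis
      \<comment> \<open>A Borel version obeys the kernel bound only almost everywhere. Setting it to
        0 where the bound fails makes the bound hold at every point; at the origin it then forces
        the value 0.\<close>
      proof (rule that[of "\<lambda>z. if norm (U z) \<le> C2 * N z powr (a - Q) then U z else 0"])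
        have "AE z in lborel. z \<noteq> (0 :: real ^ 'n)" by (rule AE_lborel_singleton)
        then show "AE z in lborel. T z = (if norm (U z) \<le> C2 * N z powr (a - Q) then U z else 0)"
          using U by eventually_elim (use T_bound in force)
      qed (use \<open>C2 > 0\<close> in auto)
    qed
    have [measurable]: "(\<lambda>z. gmul (- fst z) (snd z)) \<in> borel \<Otimes>\<^sub>M borel \<rightarrow>\<^sub>M borel"
    proof -
      have "continuous_on UNIV (\<lambda>z. gmul (- fst z) (snd z))"
        by (rule continuous_on_compose2[OF mult_continuous, of UNIV "\<lambda>z. (- fst z, snd z)", simplified])
          (auto intro!: continuous_intros)
      then show ?thesis unfolding borel_prod by (rule borel_measurable_continuous_onI)
    qed
    have mult_meas [measurable (raw)]: "(\<lambda>z. gmul (- g z) (h z)) \<in> L \<rightarrow>\<^sub>M borel"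
      if "g \<in> L \<rightarrow>\<^sub>M borel" "h \<in> L \<rightarrow>\<^sub>M borel" for g h and L :: "'c measure"
      using measurable_compose[OF measurable_Pair[OF that], of "\<lambda>z. gmul (- fst z) (snd z)" borel] by simp
    define F where "F x y = f' y * T' (gmul (- y) x)" for x y
    have [measurable]: "(\<lambda>z. F (g z) (h z)) \<in> borel_measurable L"
      if "g \<in> L \<rightarrow>\<^sub>M borel" "h \<in> L \<rightarrow>\<^sub>M borel" for g h and L :: "'c measure"
      unfolding F_def using that by measurable
    have F_AE: "AE y in lborel. f y * T (gmul (ginv y) x) = F x y" for x
      using f' AE_lborel_convolution_argument[OF T', of x]
      by eventually_elim (simp add: F_def ginv_eq_uminus)
    have F_lebesgue: "F x \<in> borel_measurable lebesgue" for x
      by (rule measurable_completion) measurable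
    have F_meas: "(\<lambda>y. f y * T (gmul (ginv y) x)) \<in> borel_measurable lebesgue" for x
      by (rule borel_measurable_completion_cong_AE[OF F_lebesgue F_AE])
    have exists_iff: "convolution_exists_at gmul ginv f T x \<longleftrightarrow> integrable lborel (F x)" for x
    proof -
      have "convolution_exists_at gmul ginv f T x \<longleftrightarrow> integrable lebesgue (F x)"
        unfolding convolution_exists_at_def
        by (rule integrable_cong_AE[OF F_meas F_lebesgue AE_completion[OF F_AE]])
      then show ?thesis by (subst integrable_completion[symmetric]) auto
    qed
    have conv_eq: "convolution gmul ginv f T x = (LINT y|lborel. F x y)" for x
    proof -
      have "convolution gmul ginv f T x = (LINT y|lebesgue. F x y)"
        unfolding convolution_def
        by (rule integral_cong_AE[OF F_meas F_lebesgue AE_completion[OF F_AE]])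
      then show ?thesis by (subst integral_completion[symmetric]) auto
    qed
    define S where "S = (LINT x|lebesgue. norm (f x) powr p)"
    have S: "S \<ge> 0" by (simp add: S_def)
    have f'_norm: "(\<integral>\<^sup>+y. ennreal (norm (f' y) powr p) \<partial>lborel) = ennreal S"
    proof -
      have "(\<integral>\<^sup>+y. ennreal (norm (f' y) powr p) \<partial>lborel) = (\<integral>\<^sup>+y. ennreal (norm (f y) powr p) \<partial>lborel)"
        by (rule nn_integral_cong_AE) (use f' in \<open>eventually_elim, simp\<close>)
      also have "\<dots> = (\<integral>\<^sup>+y. ennreal (norm (f y) powr p) \<partial>lebesgue)"
        by (rule nn_integral_completion[symmetric])
      also have "\<dots> = ennreal S" unfolding S_def by (rule nn_integral_eq_integral[OF f_int]) simp
      finally show ?thesis .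
    qed
    define G where "G x = convolution gmul ginv f T x / of_real (N x powr (b / q))" for x
    have [measurable]: "(\<lambda>x. LINT y|lborel. F x y) \<in> borel_measurable borel"
      by measurable
    have G_meas [measurable]: "G \<in> borel_measurable borel"
      unfolding G_def conv_eq by measurable
    have G_norm: "norm (G x) powr q = norm (LINT y|lborel. F x y) powr q * N x powr (- b)" for x
      using q quasi_norm_nonneg[of x]
      by (simp add: G_def conv_eq norm_divide powr_divide powr_powr powr_minus_divide)
    \<comment> \<open>Normalising by a number strictly larger than the norm of \<open>f\<close>
      allows division even when \<open>f\<close> vanishes almost everywhere.\<close>
    have key: "(AE x in lborel. integrable lborel (F x)) \<and>
        (\<integral>\<^sup>+x. ennreal (norm (G x) powr q) \<partial>lborel) \<le> ennreal ((C2 * n) powr q * C)"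
      if n: "n > S powr (1 / p)" for n
    proof -
      have n0: "n > 0" using n powr_ge_zero[of S "1 / p"] by linarith
      define g where "g y = norm (f' y) / n" for y
      have [measurable]: "g \<in> borel_measurable lborel" unfolding g_def by measurable
      have g0: "0 \<le> g y" for y using n0 by (simp add: g_def)
      have "(\<integral>\<^sup>+y. ennreal (g y powr p) \<partial>lborel) = (\<integral>\<^sup>+y. ennreal (1 / n powr p) * ennreal (norm (f' y) powr p) \<partial>lborel)"
        using n0 by (intro nn_integral_cong) (simp add: g_def powr_divide ennreal_mult[symmetric])
      also have "\<dots> = ennreal (1 / n powr p) * ennreal S"
        by (simp add: nn_integral_cmult f'_norm)
      also have "\<dots> \<le> 1"
      proof -
        have "S = (S powr (1 / p)) powr p" using S assms by (simp add: powr_powr)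
        also have "\<dots> \<le> n powr p" using n assms by (intro powr_mono2) auto
        finally show ?thesis using n0 S by (simp add: ennreal_mult[symmetric] divide_le_eq)
      qed
      finally obtain \<Phi> where [measurable]: "\<Phi> \<in> borel_measurable lborel" and \<Phi>: "(\<integral>\<^sup>+x. \<Phi> x \<partial>lborel) \<le> ennreal C"
        "\<And>x w. 0 \<le> w \<Longrightarrow> ennreal w \<le> qm.potential a g x \<Longrightarrow> ennreal (w powr q * N x powr (- b)) \<le> \<Phi> x"
        using C(2)[of g] g0 by auto
      have F_le: "(\<integral>\<^sup>+y. ennreal (norm (F x y)) \<partial>lborel) \<le> ennreal (C2 * n) * qm.potential a g x" for x
      proof -
        have "(\<integral>\<^sup>+y. ennreal (norm (F x y)) \<partial>lborel) \<le> (\<integral>\<^sup>+y. ennreal (C2 * n) * ennreal (g y * N (gmul (- x) y) powr (a - Q)) \<partial>lborel)"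
        proof (intro nn_integral_mono)
          fix y
          have "norm (F x y) \<le> norm (f' y) * (C2 * N (gmul (- y) x) powr (a - Q))"
            unfolding F_def norm_mult by (intro mult_left_mono T'_bound) simp
          also have "\<dots> = (C2 * n) * (g y * N (gmul (- x) y) powr (a - Q))"
            using n0 by (simp add: g_def qm.d_sym[of y x])
          finally show "ennreal (norm (F x y)) \<le> ennreal (C2 * n) * ennreal (g y * N (gmul (- x) y) powr (a - Q))"
            using n0 \<open>C2 > 0\<close> g0[of y] by (simp add: ennreal_mult[symmetric] ennreal_leI)
        qed
        also have "\<dots> = ennreal (C2 * n) * qm.potential a g x"
          unfolding qm.potential_def by (rule nn_integral_cmult) measurable
        finally show ?thesis .
      qed
      have AE_int: "AE x in lborel. integrable lborel (F x)"
      proof -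
        have "AE x in lborel. \<Phi> x \<noteq> \<infinity>"
          by (rule nn_integral_PInf_AE) (use \<Phi>(1) in \<open>auto simp: top_unique\<close>)
        moreover have "AE x in lborel. x \<noteq> (0 :: real ^ 'n)" by (rule AE_lborel_singleton)
        ultimately show ?thesis
        proof eventually_elim
          case (elim x)
          then have "N x > 0" using quasi_norm_nonneg[of x] quasi_norm_eq_0_iff[of x] by linarith
          have "qm.potential a g x \<noteq> \<infinity>"
          proof
            assume inf: "qm.potential a g x = \<infinity>"
            obtain c where c: "c \<ge> 0" "\<Phi> x = ennreal c" using elim by (cases "\<Phi> x") auto
            \<comment> \<open>If the potential were infinite, every real \<open>w\<close> would be
              admissible; this one has weighted power \<open>c + 1\<close>, exceeding the finite
              value \<open>c\<close> of the majorant.\<close>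
            define w where "w = ((c + 1) * N x powr b) powr (1 / q)"
            have "ennreal (w powr q * N x powr (- b)) \<le> \<Phi> x"
              by (rule \<Phi>(2)) (auto simp: w_def inf)
            moreover have "w powr q * N x powr (- b) = c + 1"
              using c q \<open>N x > 0\<close> by (simp add: w_def powr_powr powr_minus)
            ultimately show False using c by (simp add: ennreal_le_iff)
          qed
          then have "ennreal (C2 * n) * qm.potential a g x < \<infinity>"
            by (simp add: ennreal_mult_less_top less_top)
          then have "(\<integral>\<^sup>+y. ennreal (norm (F x y)) \<partial>lborel) < \<infinity>"
            using F_le[of x] by (rule order.strict_trans1[rotated])
          then show ?case by (intro integrableI_bounded) auto
        qed
      qed
      have "(\<integral>\<^sup>+x. ennreal (norm (G x) powr q) \<partial>lborel) \<le> (\<integral>\<^sup>+x. ennreal ((C2 * n) powr q) * \<Phi> x \<partial>lborel)"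
      proof (intro nn_integral_mono)
        fix x
        define w where "w = norm (LINT y|lborel. F x y) / (C2 * n)"
        have C2n: "C2 * n > 0" using n0 \<open>C2 > 0\<close> by simp
        have "ennreal (C2 * n) * ennreal w \<le> ennreal (C2 * n) * qm.potential a g x"
        proof (cases "integrable lborel (F x)")
          case True
          have "ennreal (C2 * n) * ennreal w = ennreal (norm (LINT y|lborel. F x y))"
            using C2n n0 \<open>C2 > 0\<close> by (simp add: w_def ennreal_mult[symmetric])
          also have "\<dots> \<le> (\<integral>\<^sup>+y. ennreal (norm (F x y)) \<partial>lborel)"
            using integral_norm_bound_ennreal[OF True] .
          finally show ?thesis using F_le[of x] by (rule order_trans)
        next
          case False
          \<comment> \<open>At points where the convolution does not exist, its value is 0 by
            convention.\<close>
          then have "w = 0" by (simp add: w_def not_integrable_integral_eq)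
          then show ?thesis by simp
        qed
        then have "ennreal w \<le> qm.potential a g x"
          using C2n by (subst (asm) ennreal_mult_le_mult_iff) auto
        then have "ennreal (w powr q * N x powr (- b)) \<le> \<Phi> x"
          using C2n n0 \<open>C2 > 0\<close> by (intro \<Phi>(2)) (auto simp: w_def)
        then have "ennreal ((C2 * n) powr q) * ennreal (w powr q * N x powr (- b)) \<le> ennreal ((C2 * n) powr q) * \<Phi> x"
          by (rule mult_left_mono) simp
        moreover have "(C2 * n) powr q * (w powr q * N x powr (- b)) = norm (G x) powr q"
        proof -
          have "(C2 * n) powr q * w powr q = norm (LINT y|lborel. F x y) powr q"
            using C2n n0 \<open>C2 > 0\<close> by (simp add: w_def flip: powr_mult)
          then show ?thesis by (simp add: G_norm mult.assoc[symmetric])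
        qed
        ultimately show "ennreal (norm (G x) powr q) \<le> ennreal ((C2 * n) powr q) * \<Phi> x"
          by (simp add: ennreal_mult[symmetric])
      qed
      also have "\<dots> = ennreal ((C2 * n) powr q) * (\<integral>\<^sup>+x. \<Phi> x \<partial>lborel)" by (rule nn_integral_cmult) measurable
      also have "\<dots> \<le> ennreal ((C2 * n) powr q) * ennreal C" by (intro mult_left_mono \<Phi>(1)) simp
      also have "\<dots> = ennreal ((C2 * n) powr q * C)" using C(1) by (simp add: ennreal_mult)
      finally show ?thesis using AE_int by blast
    qed
    have G_meas_lebesgue: "G \<in> borel_measurable lebesgue"
      using measurable_completion[of G lborel borel] G_meas by simp
    have "(AE x in lborel. integrable lborel (F x))"
      using key[of "S powr (1 / p) + 1"] by simp
    then have AE: "AE x in lebesgue. convolution_exists_at gmul ginv f T x"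
      unfolding exists_iff by (rule AE_completion)
    have G_int: "integrable lebesgue (\<lambda>x. norm (G x) powr q)"
    proof (rule integrableI_bounded)
      show "(\<integral>\<^sup>+x. ennreal (norm (norm (G x) powr q)) \<partial>lebesgue) < \<infinity>"
        using key[of "S powr (1 / p) + 1"] by (auto simp: nn_integral_completion intro: le_less_trans)
    qed (use G_meas_lebesgue in measurable)
    have norm_le: "Lp_norm q G \<le> C1 * n" if n: "n > Lp_norm p f" for n
    proof -
      have n': "n > S powr (1 / p)" using n by (simp add: Lp_norm_def S_def)
      then have n0: "n > 0" using powr_ge_zero[of S "1 / p"] by linarith
      have "ennreal (LINT x|lebesgue. norm (G x) powr q) = (\<integral>\<^sup>+x. ennreal (norm (G x) powr q) \<partial>lborel)"
        using nn_integral_eq_integral[OF G_int] by (simp add: nn_integral_completion)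
      also have "\<dots> \<le> ennreal ((C2 * n) powr q * C)" using key[OF n'] by blast
      finally have "(LINT x|lebesgue. norm (G x) powr q) \<le> (C2 * n) powr q * C"
        using C(1) by (simp add: ennreal_le_iff)
      also have "\<dots> \<le> (C2 * n) powr q * (C + 1)" by (intro mult_left_mono) auto
      finally have "Lp_norm q G \<le> ((C2 * n) powr q * (C + 1)) powr (1 / q)"
        unfolding Lp_norm_def using q by (intro powr_mono2) auto
      also have "\<dots> = C1 * n"
        using q n0 C(1) \<open>C2 > 0\<close> by (simp add: C1_def powr_mult powr_powr mult_ac)
      finally show ?thesis .
    qed
    have "Lp_norm q G \<le> C1 * Lp_norm p f"
    \<comment> \<open>The normalising number \<open>n\<close> tends to the norm of \<open>f\<close>
      from above.\<close>
    proof (rule field_le_epsilon)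
      fix e :: real assume "e > 0"
      then have "Lp_norm q G \<le> C1 * (Lp_norm p f + e / C1)"
        using \<open>C1 > 0\<close> by (intro norm_le) simp
      then show "Lp_norm q G \<le> C1 * Lp_norm p f + e" using \<open>C1 > 0\<close> by (simp add: distrib_left)
    qed
    moreover have "G \<in> Lp_space q" using G_meas_lebesgue G_int by (simp add: Lp_space_def)
    ultimately show ?thesis using AE unfolding G_def[abs_def] by blast
  qed
  with \<open>C1 > 0\<close> show ?thesis by blast
qed

end

theorem theorem3p5:
  fixes gmul :: "real ^ 'n \<Rightarrow> real ^ 'n \<Rightarrow> real ^ 'n"
    and ginv A :: "real ^ 'n \<Rightarrow> real ^ 'n"
    and N :: "real ^ 'n \<Rightarrow> real"
    and Q p q a b C2 :: real
  assumes "homogeneous_group gmul ginv A"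
    and "Q = homogeneous_dimension A"
    and "homogeneous_quasi_norm ginv A N"
    and "1 < p" and "p \<le> q"
    and "0 < a" and "a < Q / p"
    and "0 \<le> b" and "b < Q"
    and "a / Q = 1 / p - 1 / q + b / (q * Q)"
    and "C2 > 0"
  shows "\<exists>C1>0. \<forall>T \<in> borel_measurable (lebesgue_on (- {0})).
    (\<forall>x. x \<noteq> 0 \<longrightarrow> norm (T x) \<le> C2 * N x powr (a - Q)) \<longrightarrow>
    (\<forall>f \<in> Lp_space p.
      (AE x in lebesgue. convolution_exists_at gmul ginv f T x) \<and>
      (\<lambda>x. convolution gmul ginv f T x / of_real (N x powr (b / q))) \<in> Lp_space q \<and>
      Lp_norm q (\<lambda>x. convolution gmul ginv f T x / of_real (N x powr (b / q)))
        \<le> C1 * Lp_norm p f)"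
proof -
  interpret homogeneous_group gmul ginv A by fact
  interpret quasi_normed_homogeneous_group gmul ginv A N by unfold_locales fact
  have "Q > 0" using assms by simp
  \<comment> \<open>Multiplied by \<open>Q\<close>, the exponent relation says that its two sides,
    rearranged, are the common scaling degree \<open>(Q - b) / q = Q / p - a\<close>.\<close>
  have "a = Q * (1 / p - 1 / q + b / (q * Q))"
    using assms(10) \<open>Q > 0\<close> by (simp add: field_simps)
  also have "\<dots> = Q / p - (Q - b) / q"
    using assms \<open>Q > 0\<close> by (simp add: divide_simps) (simp add: algebra_simps)
  finally have "(Q - b) / q = Q / p - a" by simp
  with assms show ?thesis
    using convolution_potential_bound[of p q a b C2] by simp
qed

end
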